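(* Let $\Omega\subset\mathbb{R}^n$ be an open bounded set, $\ell=\operatorname{diam}\Omega$, $x_0\in\Omega$, let $p\in WL(\Omega)$ satisfy $1<p_-\le p(x)\le p_+<\infty$, and let $\omega_1$ and $\omega_2$ fulfill $$\int_0^t\omega_1(r)\frac{dr}{r}\le C\,\omega_2(t),\qquad 0<t<\ell,$$ where $C$ does not depend on $t$. Then the Calderón–Zygmund singular integral operator $T$ is bounded from ${}^{\complement}\mathcal{M}^{p(\cdot),\omega_1}_{\{x_0\}}(\Omega)$ to ${}^{\complement}\mathcal{M}^{p(\cdot),\omega_2}_{\{x_0\}}(\Omega)$.
   Context: $B(x,r)$ is the open ball in $\mathbb{R}^n$, $\widetilde B(x,r)=B(x,r)\cap\Omega$. For measurable $p:\Omega\to[1,\infty)$: $p_-=\operatorname{ess\,inf}_\Omega p$, $p_+=\operatorname{ess\,sup}_\Omega p$, $p'(x)=\frac{p(x)}{p(x)-1}$. $L^{p(\cdot)}(E)$ is the variable exponent Lebesgue space with the Luxemburg norm $\|f\|_{L^{p(\cdot)}(E)}=\inf\{\eta>0:\int_E|f(x)/\eta|^{p(x)}dx\le1\}$. $WL(\Omega)$ is the class of functions on $\Omega$ with $|p(x)-p(y)|\le\frac{A}{-\ln|x-y|}$ for all $x,y\in\Omega$, $|x-y|\le\frac12$, with $A>0$ independent of $x,y$. The functions $\omega,\omega_1,\omega_2$ are non-negative and measurable on $(0,\ell)$ and bounded outside any neighbourhood $(0,\delta)$ of the origin. The variable exponent generalized local "complementary" Morrey space ${}^{\complement}\mathcal{M}^{p(\cdot),\omega}_{\{x_0\}}(\Omega)$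 is defined by the norm $$\|f\|_{{}^{\complement}\mathcal{M}^{p(\cdot),\omega}_{\{x_0\}}(\Omega)}=\sup_{0<r<\ell}\frac{r^{n/p'(x_0)}}{\omega(r)}\|f\|_{L^{p(\cdot)}(\Omega\setminus\widetilde B(x_0,r))}.$$ Standing assumption for each such space: $\sup_{0<r<\ell}\frac{r^{n/p'(x_0)}}{\omega(r)}<\infty$ (in particular $\omega>0$). $Tf(x)=\int_\Omega K(x,y)f(y)\,dy$ is a Calderón–Zygmund type singular operator with a standard kernel in the sense of Coifman and Meyer: $K$ is continuous on $\{(x,y)\in\mathbb{R}^n\times\mathbb{R}^n:x\ne y\}$ and for some $C,\sigma>0$ one has $|K(x,y)|\le C|x-y|^{-n}$ for $x\neq y$; $|K(x,y)-K(x,z)|\le C\frac{|y-z|^\sigma}{|x-y|^{n+\sigma}}$ if $|x-y|>2|y-z|$; and $|K(x,y)-K(\xi,y)|\le C\frac{|x-\xi|^\sigma}{|x-y|^{n+\sigma}}$ if $|x-y|>2|x-\xi|$. The associated operator is bounded on $L^2(\mathbb{R}^n)$, is given by the integral with kernel $K$ at points outside the support of $f$, and is extended to $L^1$ by its weak type $(1,1)$ bound; functions on $\Omega$ are extended by zero. Boundedness means a norm inequality with constant independent of $f$. *)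

theory Defs
  imports "HOL-Analysis.Analysis" "HOL-Probability.Essential_Supremum"
begin

section \<open>Variable exponents\<close>

text \<open>The essential infimum \<open>p\<^sub>-\<close> is expressed through the essential supremum of \<open>-p\<close>.\<close>

definition exponent_minus :: "(real ^ 'n) set \<Rightarrow> (real ^ 'n \<Rightarrow> real) \<Rightarrow> ereal" where
  "exponent_minus \<Omega> p = - esssup (lebesgue_on \<Omega>) (\<lambda>x. - ereal (p x))"

definition exponent_plus :: "(real ^ 'n) set \<Rightarrow> (real ^ 'n \<Rightarrow> real) \<Rightarrow> ereal" where
  "exponent_plus \<Omega> p = esssup (lebesgue_on \<Omega>) (\<lambda>x. ereal (p x))"

definition conjugate_exponent :: "(real ^ 'n \<Rightarrow> real) \<Rightarrow> real ^ 'n \<Rightarrow> real" where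
  "conjugate_exponent p x = p x / (p x - 1)"

text \<open>For \<open>x = y\<close> the inequality below reads \<open>0 \<le> 0\<close>, since \<open>ln 0 = 0\<close> and \<open>A / 0 = 0\<close>.\<close>

definition WL :: "(real ^ 'n) set \<Rightarrow> (real ^ 'n \<Rightarrow> real) set" where
  "WL \<Omega> = {p. \<exists>A>0. \<forall>x\<in>\<Omega>. \<forall>y\<in>\<Omega>. norm (x - y) \<le> 1/2 \<longrightarrow>
                  \<bar>p x - p y\<bar> \<le> A / (- ln (norm (x - y)))}"

text \<open>The Luxemburg norm; it is \<open>\<infinity>\<close> if no \<open>\<eta>\<close> is admissible.\<close>

definition luxemburg_norm ::
    "(real ^ 'n \<Rightarrow> real) \<Rightarrow> (real ^ 'n) set \<Rightarrow> (real ^ 'n \<Rightarrow> complex) \<Rightarrow> ennreal" where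
  "luxemburg_norm p E f =
     Inf {ennreal \<eta> | \<eta>. \<eta> > 0 \<and>
            (\<integral>\<^sup>+ x\<in>E. ennreal (norm (f x / of_real \<eta>) powr p x) \<partial>lebesgue) \<le> 1}"


section \<open>Local complementary Morrey spaces\<close>

text \<open>
  The quotient \<open>r\<^bsup>n/p'(x\<^sub>0)\<^esup> / \<omega>(r)\<close> is taken in \<^typ>\<open>ennreal\<close>, where \<open>a / 0 = \<infinity>\<close> for \<open>a > 0\<close>.
  Finiteness of its supremum therefore forces \<open>\<omega> > 0\<close> on \<open>(0, diam \<Omega>)\<close>.
\<close>

definition morrey_factor ::
    "(real ^ 'n \<Rightarrow> real) \<Rightarrow> (real \<Rightarrow> real) \<Rightarrow> real ^ 'n \<Rightarrow> real \<Rightarrow> ennreal" where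
  "morrey_factor p \<omega> x\<^sub>0 r =
     ennreal (r powr (real CARD('n) / conjugate_exponent p x\<^sub>0)) / ennreal (\<omega> r)"

definition admissible_weight ::
    "(real ^ 'n) set \<Rightarrow> (real ^ 'n \<Rightarrow> real) \<Rightarrow> real ^ 'n \<Rightarrow> (real \<Rightarrow> real) \<Rightarrow> bool" where
  "admissible_weight \<Omega> p x\<^sub>0 \<omega> \<longleftrightarrow>
     \<omega> \<in> borel_measurable (lebesgue_on {0<..<diameter \<Omega>}) \<and>
     (\<forall>r\<in>{0<..<diameter \<Omega>}. 0 \<le> \<omega> r) \<and>
     (\<forall>\<delta>>0. bounded (\<omega> ` {\<delta>..<diameter \<Omega>})) \<and>
     (SUP r\<in>{0<..<diameter \<Omega>}. morrey_factor p \<omega> x\<^sub>0 r) < \<infinity>"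

definition compl_morrey_norm ::
    "(real ^ 'n) set \<Rightarrow> (real ^ 'n \<Rightarrow> real) \<Rightarrow> (real \<Rightarrow> real) \<Rightarrow> real ^ 'n \<Rightarrow>
     (real ^ 'n \<Rightarrow> complex) \<Rightarrow> ennreal" where
  "compl_morrey_norm \<Omega> p \<omega> x\<^sub>0 f =
     (SUP r\<in>{0<..<diameter \<Omega>}.
        morrey_factor p \<omega> x\<^sub>0 r * luxemburg_norm p (\<Omega> - (ball x\<^sub>0 r \<inter> \<Omega>)) f)"

definition compl_morrey_space ::
    "(real ^ 'n) set \<Rightarrow> (real ^ 'n \<Rightarrow> real) \<Rightarrow> (real \<Rightarrow> real) \<Rightarrow> real ^ 'n \<Rightarrow>
     (real ^ 'n \<Rightarrow> complex) set" where
  "compl_morrey_space \<Omega> p \<omega> x\<^sub>0 =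
     {f \<in> borel_measurable (lebesgue_on \<Omega>). compl_morrey_norm \<Omega> p \<omega> x\<^sub>0 f < \<infinity>}"


section \<open>Calderon--Zygmund operators\<close>

definition standard_kernel :: "(real ^ 'n \<Rightarrow> real ^ 'n \<Rightarrow> complex) \<Rightarrow> bool" where
  "standard_kernel K \<longleftrightarrow>
     continuous_on {(x, y). x \<noteq> y} (\<lambda>(x, y). K x y) \<and>
     (\<exists>C>0. \<exists>\<sigma>>0.
        (\<forall>x y. x \<noteq> y \<longrightarrow> norm (K x y) \<le> C * norm (x - y) powr (- real CARD('n))) \<and>
        (\<forall>x y z. norm (x - y) > 2 * norm (y - z) \<longrightarrow>
           norm (K x y - K x z)
             \<le> C * norm (y - z) powr \<sigma> / norm (x - y) powr (real CARD('n) + \<sigma>)) \<and>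
        (\<forall>x \<xi> y. norm (x - y) > 2 * norm (x - \<xi>) \<longrightarrow>
           norm (K x y - K \<xi> y)
             \<le> C * norm (x - \<xi>) powr \<sigma> / norm (x - y) powr (real CARD('n) + \<sigma>)))"

definition L1 :: "(real ^ 'n \<Rightarrow> complex) set" where
  "L1 = {f. integrable lebesgue f}"

definition L2 :: "(real ^ 'n \<Rightarrow> complex) set" where
  "L2 = {f \<in> borel_measurable lebesgue. integrable lebesgue (\<lambda>x. (norm (f x))\<^sup>2)}"

definition L1_norm :: "(real ^ 'n \<Rightarrow> complex) \<Rightarrow> real" where
  "L1_norm f = (\<integral>x. norm (f x) \<partial>lebesgue)"

definition L2_norm :: "(real ^ 'n \<Rightarrow> complex) \<Rightarrow> real" where
  "L2_norm f = sqrt (\<integral>x. (norm (f x))\<^sup>2 \<partial>lebesgue)"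

text \<open>
  Linearity modulo null sets.  Together with the norm bounds below it implies that \<open>T\<close> respects
  almost everywhere equality, so that it may be applied to representatives.
\<close>

definition ae_linear_on ::
    "(real ^ 'n \<Rightarrow> complex) set \<Rightarrow> ((real ^ 'n \<Rightarrow> complex) \<Rightarrow> real ^ 'n \<Rightarrow> complex) \<Rightarrow> bool" where
  "ae_linear_on V T \<longleftrightarrow>
     (\<forall>f\<in>V. \<forall>g\<in>V. \<forall>a b. AE x in lebesgue.
        T (\<lambda>y. a * f y + b * g y) x = a * T f x + b * T g x)"

text \<open>
  The operator \<open>T\<close> is relevant on \<open>L1 \<union> L2\<close> only.  On \<open>L1\<close> it is determined by its values on
  \<open>L1 \<inter> L2\<close>, by density, linearity and the weak type \<open>(1,1)\<close> bound.
\<close>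

definition calderon_zygmund_operator ::
    "(real ^ 'n \<Rightarrow> real ^ 'n \<Rightarrow> complex) \<Rightarrow>
     ((real ^ 'n \<Rightarrow> complex) \<Rightarrow> real ^ 'n \<Rightarrow> complex) \<Rightarrow> bool" where
  "calderon_zygmund_operator K T \<longleftrightarrow>
     standard_kernel K \<and>
     ae_linear_on L2 T \<and>
     (\<exists>A. \<forall>f\<in>L2. T f \<in> L2 \<and> L2_norm (T f) \<le> A * L2_norm f) \<and>
     (\<forall>f\<in>L2. AE x in lebesgue. x \<notin> closure {y. f y \<noteq> 0} \<longrightarrow>
        T f x = (\<integral>y. K x y * f y \<partial>lebesgue)) \<and>
     ae_linear_on L1 T \<and>
     (\<exists>A. \<forall>f\<in>L1. T f \<in> borel_measurable lebesgue \<and>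
        (\<forall>s>0. emeasure lebesgue {x. norm (T f x) > s} \<le> ennreal (A * L1_norm f / s)))"

definition zero_extension :: "(real ^ 'n) set \<Rightarrow> (real ^ 'n \<Rightarrow> complex) \<Rightarrow> real ^ 'n \<Rightarrow> complex" where
  "zero_extension \<Omega> f = (\<lambda>x. if x \<in> \<Omega> then f x else 0)"

text \<open>
  A Calderon--Zygmund operator acts on functions on \<open>\<Omega>\<close> through their zero extensions, and it is
  defined on \<open>L1\<close>.  Boundedness on a Morrey space, whose elements need not be square integrable
  near \<open>x\<^sub>0\<close>, includes that the zero extensions belong to this domain.
\<close>

definition bounded_between_compl_morrey ::
    "(real ^ 'n) set \<Rightarrow> (real ^ 'n \<Rightarrow> real) \<Rightarrow> real ^ 'n \<Rightarrow> (real \<Rightarrow> real) \<Rightarrow> (real \<Rightarrow> real) \<Rightarrow>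
     ((real ^ 'n \<Rightarrow> complex) \<Rightarrow> real ^ 'n \<Rightarrow> complex) \<Rightarrow> bool" where
  "bounded_between_compl_morrey \<Omega> p x\<^sub>0 \<omega>\<^sub>1 \<omega>\<^sub>2 T \<longleftrightarrow>
     (\<exists>C::real. \<forall>f \<in> compl_morrey_space \<Omega> p \<omega>\<^sub>1 x\<^sub>0.
        zero_extension \<Omega> f \<in> L1 \<and>
        T (zero_extension \<Omega> f) \<in> compl_morrey_space \<Omega> p \<omega>\<^sub>2 x\<^sub>0 \<and>
        compl_morrey_norm \<Omega> p \<omega>\<^sub>2 x\<^sub>0 (T (zero_extension \<Omega> f))
          \<le> ennreal C * compl_morrey_norm \<Omega> p \<omega>\<^sub>1 x\<^sub>0 f)"

end

theory Submission
  imports Defs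
begin

text \<open>
  Let \<open>n\<close> be the dimension and let \<open>f\<close> be a function of the source space.  Fix a radius \<open>r\<close> and split
  \<open>f\<close> at the sphere of radius \<open>r/2\<close> about \<open>x\<^sub>0\<close>.  The outer part lies in the variable exponent space, on
  which \<open>T\<close> is bounded.  The inner part is integrable, and at points \<open>x\<close> at distance at least \<open>r\<close>
  from \<open>x\<^sub>0\<close> the size of the kernel bounds its image by \<open>C |x - x\<^sub>0|\<^bsup>-n\<^esup>\<close> times its integral.
  Log-Hoelder continuity at \<open>x\<^sub>0\<close> allows the exponent to be frozen there: outside the ball of radius \<open>r\<close> the
  norm of \<open>|x - x\<^sub>0|\<^bsup>-n\<^esup>\<close> is of order \<open>r\<^bsup>-n/p'(x\<^sub>0)\<^esup>\<close>, and Hoelder's inequality on the dyadic annuli about \<open>x\<^sub>0\<close>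
  bounds the integral of \<open>|f|\<close> over the ball of radius \<open>t\<close> by the integral of \<open>\<omega>\<^sub>1(s)/s\<close> over \<open>(0,t)\<close>
  (\<open>ball_integral_bound\<close>).  The hypothesis on \<open>\<omega>\<^sub>1\<close> and \<open>\<omega>\<^sub>2\<close> then controls both parts
  (\<open>truncated_modular_estimate\<close>).  Instead of norms the argument uses statements of the form
  \<open>\<integral> (|f|/\<mu>)\<^bsup>p(x)\<^esup> \<le> 1\<close>, where \<open>\<mu>\<close> belongs to a number \<open>N\<close> strictly above the norm of \<open>f\<close>.

  The main work is the boundedness of \<open>T\<close> on the variable exponent space (\<open>cz_modular_bound\<close>).  By duality it
  is enough to bound \<open>\<integral> |T f| g\<close> if the modulars of \<open>f\<close> and \<open>g\<close>, for the exponent and its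
  conjugate, are at most one (\<open>cz_pairing_bound\<close>).  Three facts lead to this bound.

  First, a stopping time argument on dyadic cubes (\<open>oscillation_domination\<close>): suppose that on every
  cube \<open>Q\<close> the function \<open>F\<close> differs from some constant by more than \<open>a(Q)\<close> only on a small fraction of
  \<open>Q\<close>, and that \<open>a(Q)\<close> times the average of \<open>g\<close> over \<open>Q\<close> is at most \<open>W\<close> everywhere on \<open>Q\<close>.  Then the
  integral of \<open>|F - c| g\<close> over the top cube is at most four times that of \<open>W\<close>.  Second, for \<open>F = T f\<close>
  one may take for \<open>a(Q)\<close> a multiple of the largest average of \<open>|f|\<close> over balls about \<open>Q\<close>; this uses
  the weak type bound near \<open>Q\<close> and the smoothness of the kernel away from it (\<open>cz_oscillation\<close>).
  Third, Young's inequality with the exponents at a point \<open>y\<close> of \<open>Q\<close> separates the averages of \<open>f\<close>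
  and \<open>g\<close>, and log-Hoelder continuity compares \<open>b\<^bsup>p(y)\<^esup>\<close>, for an average \<open>b\<close> of \<open>|f|\<close>, with the power
  \<open>p\<^sub>-\<close> of an average of \<open>|f|\<^bsup>p(x)/p\<^sub>-\<^esup>\<close> (\<open>variable_maximal_bound\<close>).  Since \<open>p\<^sub>- > 1\<close>, the classical
  maximal inequality provides a dominating function \<open>W\<close> whose integral is bounded.
\<close>

section \<open>The Hardy--Littlewood maximal inequality\<close>

lemma emeasure_ball_scaled:
  fixes z :: "'a::euclidean_space"
  assumes "0 \<le> r" "0 \<le> s"
  shows "emeasure lebesgue (ball z (s * r)) = ennreal (s ^ DIM('a)) * emeasure lebesgue (ball z r)"
  using assms by (simp add: emeasure_ball power_mult_distrib mult.left_commute flip: ennreal_mult)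

lemma emeasure_ball_pos:
  fixes z :: "'a::euclidean_space"
  assumes "0 < r"
  shows "0 < emeasure lebesgue (ball z r)" "emeasure lebesgue (ball z r) < \<infinity>"
  using assms by (simp_all add: emeasure_ball ennreal_zero_less_mult_iff)

text \<open>
  The value \<open>None\<close> fills up the enumeration of a finite family, so that countable additivity along sequences
  covers finite and infinite families alike.
\<close>

lemma disjoint_enumeration:
  fixes \<C> :: "'i set" and B :: "'i \<Rightarrow> 'a set"
  assumes "countable \<C>" and disj: "\<And>i j. i \<in> \<C> \<Longrightarrow> j \<in> \<C> \<Longrightarrow> i \<noteq> j \<Longrightarrow> B i \<inter> B j = {}"
  obtains e :: "nat \<Rightarrow> 'i option" where
    "\<And>n i. e n = Some i \<Longrightarrow> i \<in> \<C>" "\<And>i. i \<in> \<C> \<Longrightarrow> \<exists>n. e n = Some i"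
    "disjoint_family (\<lambda>n. case e n of None \<Rightarrow> {} | Some i \<Rightarrow> B i)"
proof -
  define e where "e n = (if n \<in> to_nat_on \<C> ` \<C> then Some (from_nat_into \<C> n) else None)" for n
  show thesis
  proof (rule that[of e])
    show "i \<in> \<C>" if "e n = Some i" for n i
      using that \<open>countable \<C>\<close> unfolding e_def
      by (auto split: if_splits)
    show "\<exists>n. e n = Some i" if "i \<in> \<C>" for i
      using that \<open>countable \<C>\<close> by (intro exI[of _ "to_nat_on \<C> i"]) (auto simp: e_def)
    have "B i \<inter> B j = {}" if "e m = Some i" "e n = Some j" "m \<noteq> n" for m n i j
      using that \<open>countable \<C>\<close> disj[of i j]
      by (auto simp: e_def inj_on_eq_iff split: if_splits)
    then show "disjoint_family (\<lambda>n. case e n of None \<Rightarrow> {} | Some i \<Rightarrow> B i)"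
      by (auto simp: disjoint_family_on_def split: option.splits)
  qed
qed

lemma dyadic_scale_left:
  fixes b :: real
  assumes "1 < b"
  shows "\<exists>k. 2 ^ k < b \<and> b \<le> 2 ^ Suc k"
proof -
  define k where "k = (LEAST k. b \<le> 2 ^ Suc k)"
  obtain j where "b < 2 ^ j" using real_arch_pow[of 2 b] by auto
  then have "b \<le> 2 ^ Suc j" using power_increasing[of j "Suc j" "2::real"] by linarith
  then have "b \<le> 2 ^ Suc k" unfolding k_def by (rule LeastI)
  moreover have "2 ^ k < b"
  proof (cases k)
    case (Suc l)
    then show ?thesis using not_less_Least[of l "\<lambda>k. b \<le> 2 ^ Suc k"] by (simp add: k_def)
  qed (use assms in simp)
  ultimately show ?thesis by blast
qed

lemma dyadic_scale_right:
  fixes r s :: real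
  assumes "0 < r" "r \<le> s"
  shows "\<exists>k. 2 ^ k * r \<le> s \<and> s < 2 ^ Suc k * r"
proof (cases "\<exists>k. s = 2 ^ k * r")
  case True
  then show ?thesis using \<open>0 < r\<close> by auto
next
  case False
  then have "s \<noteq> 2 ^ 0 * r" by blast
  then have "1 < s / r" using assms by simp
  then obtain k where k: "2 ^ k < s / r" "s / r \<le> 2 ^ Suc k" using dyadic_scale_left by blast
  have "2 ^ k * r \<le> s" "s \<le> 2 ^ Suc k * r"
    using k \<open>0 < r\<close> by (simp_all add: less_divide_eq divide_le_eq less_imp_le)
  moreover have "s \<noteq> 2 ^ Suc k * r" using False by blast
  ultimately show ?thesis by force
qed

text \<open>
  The set where the uncentred maximal function of \<open>F\<close> over balls exceeds \<open>t\<close>.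
\<close>

definition large_average_set :: "('a::euclidean_space \<Rightarrow> ennreal) \<Rightarrow> real \<Rightarrow> 'a set" where
  "large_average_set F t =
     \<Union>{ball z r | z r. 0 < r \<and> ennreal t * emeasure lebesgue (ball z r) < (\<integral>\<^sup>+x\<in>ball z r. F x \<partial>lebesgue)}"

lemma open_large_average_set: "open (large_average_set F t)"
  by (auto simp: large_average_set_def)

text \<open>
  Vitali's covering lemma selects disjoint balls with large averages whose fivefold dilates cover the
  level set, and on each selected ball the large average bounds the measure by the integral of \<open>F\<close>.
  The radii are bounded, as the covering lemma requires, because the integral of \<open>F\<close> may be assumed
  finite.
\<close>

lemma weak_type_maximal:
  fixes F :: "'a::euclidean_space \<Rightarrow> ennreal"
  assumes F: "F \<in> borel_measurable lebesgue" and "0 < t"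
  shows "ennreal t * emeasure lebesgue (large_average_set F t) \<le> ennreal (5 ^ DIM('a)) * (\<integral>\<^sup>+x. F x \<partial>lebesgue)"
proof (cases "(\<integral>\<^sup>+x. F x \<partial>lebesgue) = \<infinity>")
  case True
  then show ?thesis by (simp add: ennreal_mult_top)
next
  case False
  then obtain I where I: "0 \<le> I" "(\<integral>\<^sup>+x. F x \<partial>lebesgue) = ennreal I"
    by (metis ennreal_cases infinity_ennreal_def)
  define \<K> where "\<K> = {(z, r). 0 < r \<and> ennreal t * emeasure lebesgue (ball z r) < (\<integral>\<^sup>+x\<in>ball z r. F x \<partial>lebesgue)}"
  define v where "v = unit_ball_vol (real DIM('a))"
  have "v > 0" by (simp add: v_def)
  define B where "B = max 1 (I / (t * v))"
  have radius: "0 < snd i \<and> snd i \<le> B" if "i \<in> \<K>" for i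
  proof -
    obtain z r where i: "i = (z, r)" by fastforce
    have "0 < r" using that by (auto simp: \<K>_def i)
    have "ennreal t * emeasure lebesgue (ball z r) < (\<integral>\<^sup>+x\<in>ball z r. F x \<partial>lebesgue)"
      using that by (auto simp: \<K>_def i)
    also have "(\<integral>\<^sup>+x\<in>ball z r. F x \<partial>lebesgue) \<le> ennreal I"
      unfolding I(2)[symmetric] by (intro nn_integral_mono) (simp add: indicator_def)
    finally have "t * (v * r ^ DIM('a)) < I"
      using \<open>0 < t\<close> \<open>0 < r\<close> \<open>v > 0\<close> I(1)
      by (simp add: emeasure_ball v_def ennreal_less_iff flip: ennreal_mult)
    then have *: "r ^ DIM('a) < I / (t * v)"
      using \<open>0 < t\<close> \<open>v > 0\<close> by (simp add: field_simps)
    have "r \<le> B"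
    proof (cases "r \<le> 1")
      case False
      then have "r \<le> r ^ DIM('a)" by (simp add: self_le_power)
      with * show ?thesis by (simp add: B_def)
    qed (simp add: B_def)
    with \<open>0 < r\<close> show ?thesis by (simp add: i)
  qed
  obtain \<C> where \<C>: "countable \<C>" "\<C> \<subseteq> \<K>"
    "pairwise (\<lambda>i j. disjnt (cball (fst i) (snd i)) (cball (fst j) (snd j))) \<C>"
    "\<And>i. i \<in> \<K> \<Longrightarrow> \<exists>j. j \<in> \<C> \<and> \<not> disjnt (cball (fst i) (snd i)) (cball (fst j) (snd j))
        \<and> cball (fst i) (snd i) \<subseteq> ball (fst j) (5 * snd j)"
    by (rule Vitali_covering_lemma_cballs_balls[where K=\<K> and r=snd and B=B and a=fst]) (use radius in \<open>auto intro: that\<close>)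
  have "ball (fst i) (snd i) \<inter> ball (fst j) (snd j) = {}" if "i \<in> \<C>" "j \<in> \<C>" "i \<noteq> j" for i j
    using \<C>(3) that ball_subset_cball unfolding pairwise_def disjnt_def by blast
  then obtain e where e: "\<And>n i. e n = Some i \<Longrightarrow> i \<in> \<C>" "\<And>i. i \<in> \<C> \<Longrightarrow> \<exists>n::nat. e n = Some i"
    "disjoint_family (\<lambda>n. case e n of None \<Rightarrow> {} | Some i \<Rightarrow> ball (fst i) (snd i))"
    by (rule disjoint_enumeration[OF \<C>(1), of "\<lambda>i. ball (fst i) (snd i)"]) (auto intro: that)
  define b where "b n = (case e n of None \<Rightarrow> {} | Some i \<Rightarrow> ball (fst i) (snd i))" for n
  define b5 where "b5 n = (case e n of None \<Rightarrow> {} | Some i \<Rightarrow> ball (fst i) (5 * snd i))" for n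
  have [measurable]: "b n \<in> sets lebesgue" "b5 n \<in> sets lebesgue" for n
    by (auto simp: b_def b5_def split: option.splits)
  have "large_average_set F t \<subseteq> (\<Union>n. b5 n)"
  proof
    fix x assume "x \<in> large_average_set F t"
    then obtain i where i: "i \<in> \<K>" "x \<in> ball (fst i) (snd i)"
      unfolding large_average_set_def \<K>_def by fastforce
    then obtain j where "j \<in> \<C>" "x \<in> ball (fst j) (5 * snd j)"
      using \<C>(4) by (metis ball_subset_cball subsetD)
    obtain m where "e m = Some j" using e(2)[OF \<open>j \<in> \<C>\<close>] by blast
    then have "x \<in> b5 m" using \<open>x \<in> ball (fst j) (5 * snd j)\<close> by (simp add: b5_def)
    then show "x \<in> (\<Union>n. b5 n)" by blast
  qed
  then have "emeasure lebesgue (large_average_set F t) \<le> emeasure lebesgue (\<Union>n. b5 n)"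
    by (intro emeasure_mono) auto
  also have "\<dots> \<le> (\<Sum>n. emeasure lebesgue (b5 n))"
    by (intro emeasure_subadditive_countably) auto
  finally have "ennreal t * emeasure lebesgue (large_average_set F t) \<le> (\<Sum>n. ennreal t * emeasure lebesgue (b5 n))"
    by (simp add: mult_left_mono)
  also have "\<dots> \<le> (\<Sum>n. ennreal (5 ^ DIM('a)) * (\<integral>\<^sup>+x\<in>b n. F x \<partial>lebesgue))"
  proof (intro suminf_le)
    fix n show "ennreal t * emeasure lebesgue (b5 n) \<le> ennreal (5 ^ DIM('a)) * (\<integral>\<^sup>+x\<in>b n. F x \<partial>lebesgue)"
    proof (cases "e n")
      case (Some i)
      have "i \<in> \<K>" using e(1)[OF Some] \<C>(2) by blast
      then have i: "0 < snd i" "ennreal t * emeasure lebesgue (ball (fst i) (snd i)) \<le> (\<integral>\<^sup>+x\<in>ball (fst i) (snd i). F x \<partial>lebesgue)"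
        by (auto simp: \<K>_def less_imp_le)
      have "ennreal t * emeasure lebesgue (b5 n)
        = ennreal (5 ^ DIM('a)) * (ennreal t * emeasure lebesgue (ball (fst i) (snd i)))"
        using emeasure_ball_scaled[of "snd i" 5 "fst i"] i(1) by (simp add: b5_def Some mult.left_commute)
      also have "\<dots> \<le> ennreal (5 ^ DIM('a)) * (\<integral>\<^sup>+x\<in>b n. F x \<partial>lebesgue)"
        using i(2) by (intro mult_left_mono) (auto simp: b_def Some)
      finally show ?thesis .
    qed (simp add: b5_def)
  qed auto
  also have "\<dots> = ennreal (5 ^ DIM('a)) * (\<Sum>n. (\<integral>\<^sup>+x\<in>b n. F x \<partial>lebesgue))"
    by (rule ennreal_suminf_cmult)
  also have "(\<Sum>n. (\<integral>\<^sup>+x\<in>b n. F x \<partial>lebesgue)) = (\<integral>\<^sup>+x\<in>(\<Union>n. b n). F x \<partial>lebesgue)"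
    by (rule nn_integral_disjoint_family[symmetric]) (use F e(3) in \<open>auto simp: b_def[abs_def] split: option.splits\<close>)
  also have "\<dots> \<le> (\<integral>\<^sup>+x. F x \<partial>lebesgue)"
    by (intro nn_integral_mono) (simp add: indicator_def)
  finally show ?thesis by (simp add: mult_left_mono)
qed

text \<open>
  A geometric sum is of the order of its largest term, the one with \<open>2\<^sup>k\<close> just below \<open>y\<close>.
\<close>

lemma sum_dyadic_powers_below:
  fixes y s :: real
  assumes "0 < s" "0 \<le> y"
  shows "(\<Sum>k. ennreal (if 2 ^ k < y then 2 powr (real k * s) else 0)) \<le> ennreal (y powr s / (1 - 2 powr - s))"
proof -
  define D where "D = 1 / (1 - 2 powr - s)"
  have q: "0 < 2 powr - s" "2 powr - s < (1::real)" using \<open>0 < s\<close> by (auto simp: powr_less_one)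
  then have "D > 0" by (simp add: D_def)
  have DD: "2 powr - s * D + 1 = D" using q \<open>0 < s\<close> unfolding D_def by (simp add: divide_simps)
  define S where "S m = (\<Sum>k<m. if 2 ^ k < y then 2 powr (real k * s) else 0)" for m
  have "S m \<le> y powr s * D \<and> S m \<le> 2 powr ((real m - 1) * s) * D" for m
  proof (induction m)
    case 0
    then show ?case using \<open>D > 0\<close> by (simp add: S_def)
  next
    case (Suc m)
    show ?case
    proof (cases "2 ^ m < y")
      case True
      have "S (Suc m) = S m + 2 powr (real m * s)" using True by (simp add: S_def)
      also have "\<dots> \<le> 2 powr ((real m - 1) * s) * D + 2 powr (real m * s)" using Suc by simp
      also have "\<dots> = 2 powr (real m * s) * (2 powr - s * D + 1)"
        by (simp add: algebra_simps flip: powr_add)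
      also have "\<dots> = 2 powr (real m * s) * D" by (simp add: DD)
      finally have 1: "S (Suc m) \<le> 2 powr (real m * s) * D" .
      have "2 powr (real m * s) = (2 ^ m) powr s"
        by (simp add: powr_powr[symmetric] powr_realpow)
      also have "\<dots> \<le> y powr s" using True \<open>0 < s\<close> by (intro powr_mono2) auto
      finally show ?thesis using 1 \<open>D > 0\<close>
        by (auto intro: order_trans mult_right_mono)
    next
      case False
      then have "S (Suc m) = S m" by (simp add: S_def)
      moreover have "2 powr ((real m - 1) * s) * D \<le> 2 powr ((real (Suc m) - 1) * s) * D"
        using \<open>D > 0\<close> \<open>0 < s\<close> by (intro mult_right_mono powr_mono) auto
      ultimately show ?thesis using Suc by linarith
    qed
  qed
  then have "S m \<le> y powr s / (1 - 2 powr - s)" for m by (simp add: D_def)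
  then show ?thesis
    by (intro suminf_le_const) (auto simp: sum_ennreal S_def intro!: ennreal_leI)
qed

text \<open>
  The strong type inequality for the maximal function \<open>M F\<close>, stated through its consequence for single
  balls.  The function \<open>W\<close> is the sum of \<open>2\<^bsup>kq\<^esup>\<close> over all \<open>k \<ge> 0\<close> with \<open>M F > 2\<^sup>k\<close>, hence comparable to
  \<open>(M F)\<^sup>q\<close> where \<open>M F > 1\<close>; elsewhere the summand 1 in \<open>1 + W\<close> takes over.  The integral of \<open>W\<close> is
  estimated by interpolation: at height \<open>2\<^sup>k\<close> the values of \<open>F\<close> below \<open>2\<^bsup>k-1\<^esup>\<close> account for at most half
  of an average above \<open>2\<^sup>k\<close>, so that the weak type inequality applies to the remaining part of \<open>F\<close>, and the sum
  over \<open>k\<close> is geometric.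
\<close>

theorem maximal_function_bound:
  fixes q :: real
  assumes "1 < q"
  obtains C :: real where "0 < C"
    "\<And>F. F \<in> borel_measurable lebesgue \<Longrightarrow> (\<And>x. 0 \<le> F x) \<Longrightarrow>
      \<exists>W :: 'a::euclidean_space \<Rightarrow> ennreal. W \<in> borel_measurable lebesgue
        \<and> (\<integral>\<^sup>+x. W x \<partial>lebesgue) \<le> ennreal C * (\<integral>\<^sup>+x. ennreal (F x powr q) \<partial>lebesgue)
        \<and> (\<forall>z r b x. x \<in> ball z r \<longrightarrow> 0 \<le> b \<longrightarrow>
             ennreal b * emeasure lebesgue (ball z r) \<le> (\<integral>\<^sup>+x\<in>ball z r. ennreal (F x) \<partial>lebesgue) \<longrightarrow>
             ennreal (b powr q) \<le> ennreal (2 powr q) * (1 + W x))"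
proof -
  define n where "n = DIM('a)"
  define C where "C = 2 * 5 ^ n * (2 powr (q - 1) / (1 - 2 powr - (q - 1)))"
  have "2 powr - (q - 1) < (1::real)" using \<open>1 < q\<close> by (simp add: powr_less_one)
  then have "0 < C" by (simp add: C_def)
  show thesis
  proof (rule that[OF \<open>0 < C\<close>])
    fix F :: "'a \<Rightarrow> real"
    assume F[measurable]: "F \<in> borel_measurable lebesgue" and F0: "\<And>x. 0 \<le> F x"
    define U where "U k = large_average_set (\<lambda>x. ennreal (F x)) (2 ^ k)" for k
    have [measurable]: "ball z r \<in> sets lebesgue" for z :: 'a and r by simp
    have U[measurable]: "U k \<in> sets lebesgue" for k by (simp add: U_def open_large_average_set)
    define W where "W x = (\<Sum>k. ennreal (2 powr (real k * q)) * indicator (U k) x)" for x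
    have W[measurable]: "W \<in> borel_measurable lebesgue" unfolding W_def by measurable
    define G where "G k x = (if 2 ^ k < 2 * F x then ennreal (F x) else 0)" for k x
    have [measurable]: "G k \<in> borel_measurable lebesgue" for k unfolding G_def by measurable
    have level: "ennreal (2 powr (real k * q)) * emeasure lebesgue (U k)
        \<le> ennreal (2 * 5 ^ n) * (ennreal (2 powr (real k * (q - 1))) * (\<integral>\<^sup>+x. G k x \<partial>lebesgue))" for k
    proof -
      have "U k \<subseteq> large_average_set (G k) (2 ^ k / 2)"
      proof
        fix x assume "x \<in> U k"
        then obtain z r where zr: "0 < r" "x \<in> ball z r"
          "ennreal (2 ^ k) * emeasure lebesgue (ball z r) < (\<integral>\<^sup>+x\<in>ball z r. ennreal (F x) \<partial>lebesgue)"
          unfolding U_def large_average_set_def by blast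
        let ?h = "ennreal (2 ^ k / 2)" and ?B = "ball z r"
        have fin: "?h * emeasure lebesgue ?B \<noteq> \<infinity>"
          using emeasure_ball_pos(2)[OF \<open>0 < r\<close>, of z] by (simp add: ennreal_mult_eq_top_iff less_top)
        have "?h * emeasure lebesgue ?B + ?h * emeasure lebesgue ?B = ennreal (2 ^ k) * emeasure lebesgue ?B"
          by (simp flip: distrib_right ennreal_plus)
        also have "\<dots> < (\<integral>\<^sup>+x\<in>?B. ennreal (F x) \<partial>lebesgue)" by (rule zr)
        also have "\<dots> \<le> (\<integral>\<^sup>+x. ?h * indicator ?B x + G k x * indicator ?B x \<partial>lebesgue)"
          by (intro nn_integral_mono) (auto simp: G_def indicator_def intro!: ennreal_leI)
        also have "\<dots> = ?h * emeasure lebesgue ?B + (\<integral>\<^sup>+x\<in>?B. G k x \<partial>lebesgue)"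
          by (subst nn_integral_add) (auto simp: nn_integral_cmult_indicator)
        finally have "?h * emeasure lebesgue ?B < (\<integral>\<^sup>+x\<in>?B. G k x \<partial>lebesgue)"
          using fin by (simp add: ennreal_add_left_cancel_less)
        then show "x \<in> large_average_set (G k) (2 ^ k / 2)"
          unfolding large_average_set_def using zr by blast
      qed
      then have "emeasure lebesgue (U k) \<le> emeasure lebesgue (large_average_set (G k) (2 ^ k / 2))"
        by (intro emeasure_mono) (simp add: open_large_average_set)+
      then have "ennreal (2 ^ k / 2) * emeasure lebesgue (U k)
          \<le> ennreal (2 ^ k / 2) * emeasure lebesgue (large_average_set (G k) (2 ^ k / 2))"
        by (rule mult_left_mono) simp
      also have "\<dots> \<le> ennreal (5 ^ n) * (\<integral>\<^sup>+x. G k x \<partial>lebesgue)"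
        unfolding n_def by (rule weak_type_maximal) auto
      finally have le: "ennreal (2 ^ k / 2) * emeasure lebesgue (U k) \<le> ennreal (5 ^ n) * (\<integral>\<^sup>+x. G k x \<partial>lebesgue)" .
      define P where "P = 2 powr (real k * (q - 1))"
      have "2 * P * (2 ^ k / 2) = 2 powr (real k * q)"
        by (simp add: P_def algebra_simps flip: powr_add powr_realpow)
      then have "ennreal (2 powr (real k * q)) = ennreal (2 * P) * ennreal (2 ^ k / 2)"
        by (subst ennreal_mult[symmetric]) (simp_all add: P_def)
      then have "ennreal (2 powr (real k * q)) * emeasure lebesgue (U k)
          = ennreal (2 * P) * (ennreal (2 ^ k / 2) * emeasure lebesgue (U k))"
        by (simp only: mult.assoc)
      also have "\<dots> \<le> ennreal (2 * P) * (ennreal (5 ^ n) * (\<integral>\<^sup>+x. G k x \<partial>lebesgue))"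
        using le by (rule mult_left_mono) simp
      also have "\<dots> = ennreal (2 * P * 5 ^ n) * (\<integral>\<^sup>+x. G k x \<partial>lebesgue)"
        by (subst ennreal_mult) (simp_all add: P_def mult.assoc)
      also have "\<dots> = ennreal (2 * 5 ^ n * P) * (\<integral>\<^sup>+x. G k x \<partial>lebesgue)"
        by (simp add: ac_simps)
      also have "\<dots> = ennreal (2 * 5 ^ n) * (ennreal P * (\<integral>\<^sup>+x. G k x \<partial>lebesgue))"
        by (subst ennreal_mult) (simp_all add: P_def mult.assoc)
      finally show ?thesis unfolding P_def .
    qed
    have "(\<integral>\<^sup>+x. W x \<partial>lebesgue) = (\<Sum>k. ennreal (2 powr (real k * q)) * emeasure lebesgue (U k))"
      unfolding W_def by (subst nn_integral_suminf) (auto simp: nn_integral_cmult_indicator)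
    also have "\<dots> \<le> (\<Sum>k. ennreal (2 * 5 ^ n) * (ennreal (2 powr (real k * (q - 1))) * (\<integral>\<^sup>+x. G k x \<partial>lebesgue)))"
      using level by (intro suminf_le) auto
    also have "\<dots> = ennreal (2 * 5 ^ n) * (\<integral>\<^sup>+x. (\<Sum>k. ennreal (2 powr (real k * (q - 1))) * G k x) \<partial>lebesgue)"
      by (simp add: nn_integral_suminf nn_integral_cmult ennreal_suminf_cmult)
    also have "\<dots> \<le> ennreal (2 * 5 ^ n) * (\<integral>\<^sup>+x. ennreal (2 powr (q - 1) / (1 - 2 powr - (q - 1))) * ennreal (F x powr q) \<partial>lebesgue)"
    proof (intro mult_left_mono nn_integral_mono)
      fix x
      have "(\<Sum>k. ennreal (2 powr (real k * (q - 1))) * G k x)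
        = (\<Sum>k. ennreal (F x) * ennreal (if 2 ^ k < 2 * F x then 2 powr (real k * (q - 1)) else 0))"
        by (intro suminf_cong) (auto simp: G_def mult.commute)
      also have "\<dots> = ennreal (F x) * (\<Sum>k. ennreal (if 2 ^ k < 2 * F x then 2 powr (real k * (q - 1)) else 0))"
        by simp
      also have "\<dots> \<le> ennreal (F x) * ennreal ((2 * F x) powr (q - 1) / (1 - 2 powr - (q - 1)))"
        using \<open>1 < q\<close> F0 by (intro mult_left_mono sum_dyadic_powers_below) auto
      also have "\<dots> = ennreal (2 powr (q - 1) / (1 - 2 powr - (q - 1))) * ennreal (F x powr q)"
      proof -
        have "F x * F x powr (q - 1) = F x powr q"
          using F0[of x] by (cases "F x = 0") (auto simp: powr_mult_base)
        then have "F x * ((2 * F x) powr (q - 1) / (1 - 2 powr - (q - 1))) = 2 powr (q - 1) / (1 - 2 powr - (q - 1)) * F x powr q"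
          using F0[of x] by (simp add: powr_mult)
        then show ?thesis
          using F0[of x] \<open>2 powr - (q - 1) < (1::real)\<close> by (simp flip: ennreal_mult)
      qed
      finally show "(\<Sum>k. ennreal (2 powr (real k * (q - 1))) * G k x)
        \<le> ennreal (2 powr (q - 1) / (1 - 2 powr - (q - 1))) * ennreal (F x powr q)" .
    qed auto
    also have "\<dots> = ennreal C * (\<integral>\<^sup>+x. ennreal (F x powr q) \<partial>lebesgue)"
    proof -
      have "0 \<le> 2 powr (q - 1) / (1 - 2 powr - (q - 1))"
        using \<open>2 powr - (q - 1) < (1::real)\<close> by simp
      then have "ennreal C = ennreal (2 * 5 ^ n) * ennreal (2 powr (q - 1) / (1 - 2 powr - (q - 1)))"
        unfolding C_def by (subst ennreal_mult[symmetric]) auto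
      moreover have "(\<integral>\<^sup>+x. ennreal (2 powr (q - 1) / (1 - 2 powr - (q - 1))) * ennreal (F x powr q) \<partial>lebesgue)
          = ennreal (2 powr (q - 1) / (1 - 2 powr - (q - 1))) * (\<integral>\<^sup>+x. ennreal (F x powr q) \<partial>lebesgue)"
        by (rule nn_integral_cmult) measurable
      ultimately show ?thesis by (simp only: mult.assoc)
    qed
    finally have 1: "(\<integral>\<^sup>+x. W x \<partial>lebesgue) \<le> ennreal C * (\<integral>\<^sup>+x. ennreal (F x powr q) \<partial>lebesgue)" .
    have 2: "ennreal (b powr q) \<le> ennreal (2 powr q) * (1 + W x)"
      if x: "x \<in> ball z r" and "0 \<le> b"
        and b: "ennreal b * emeasure lebesgue (ball z r) \<le> (\<integral>\<^sup>+x\<in>ball z r. ennreal (F x) \<partial>lebesgue)" for z r b x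
    proof (cases "b \<le> 1")
      case True
      then have "b powr q \<le> 2 powr q" using \<open>0 \<le> b\<close> \<open>1 < q\<close> by (intro powr_mono2) auto
      then have "ennreal (b powr q) \<le> ennreal (2 powr q) * 1" by (simp add: ennreal_leI)
      also have "\<dots> \<le> ennreal (2 powr q) * (1 + W x)" by (intro mult_left_mono) auto
      finally show ?thesis .
    next
      case False
      then obtain k where k: "2 ^ k < b" "b \<le> 2 ^ Suc k" using dyadic_scale_left[of b] by auto
      have "0 < r" using x by (metis ball_eq_empty empty_iff not_le)
      have "ennreal (2 ^ k) * emeasure lebesgue (ball z r) < ennreal b * emeasure lebesgue (ball z r)"
        using k(1) emeasure_ball_pos[OF \<open>0 < r\<close>, of z]
        by (intro ennreal_mult_strict_right_mono) (auto simp: ennreal_less_iff)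
      also note b
      finally have "x \<in> U k" unfolding U_def large_average_set_def using x \<open>0 < r\<close> by blast
      have "b powr q \<le> (2 ^ Suc k) powr q" using k(2) \<open>0 \<le> b\<close> \<open>1 < q\<close> by (intro powr_mono2) auto
      also have "\<dots> = 2 powr q * 2 powr (real k * q)"
        by (simp add: powr_mult powr_powr flip: powr_realpow)
      finally have "ennreal (b powr q) \<le> ennreal (2 powr q) * ennreal (2 powr (real k * q))"
        by (simp add: ennreal_leI flip: ennreal_mult)
      also have "ennreal (2 powr (real k * q)) = (\<Sum>j\<in>{k}. ennreal (2 powr (real j * q)) * indicator (U j) x)"
        using \<open>x \<in> U k\<close> by simp
      also have "\<dots> \<le> W x" unfolding W_def by (rule sum_le_suminf) auto
      also have "W x \<le> 1 + W x" by simp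
      finally show ?thesis by (simp add: mult_left_mono)
    qed
    show "\<exists>W. W \<in> borel_measurable lebesgue
        \<and> (\<integral>\<^sup>+x. W x \<partial>lebesgue) \<le> ennreal C * (\<integral>\<^sup>+x. ennreal (F x powr q) \<partial>lebesgue)
        \<and> (\<forall>z r b x. x \<in> ball z r \<longrightarrow> 0 \<le> b \<longrightarrow>
             ennreal b * emeasure lebesgue (ball z r) \<le> (\<integral>\<^sup>+x\<in>ball z r. ennreal (F x) \<partial>lebesgue) \<longrightarrow>
             ennreal (b powr q) \<le> ennreal (2 powr q) * (1 + W x))"
      using W 1 2 by blast
  qed
qed

section \<open>Maximal inequality for log-Hoelder continuous exponents\<close>

text \<open>
  The conjugate exponent satisfies the same conditions with other constants, so that all consequences
  apply to both exponents of a dual pair.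
\<close>

locale log_holder_exponent =
  fixes \<Omega> :: "'a::euclidean_space set" and u :: "'a \<Rightarrow> real" and um up A :: real
  assumes Omega_sets: "\<Omega> \<in> sets lebesgue" and Omega_bounded: "bounded \<Omega>"
    and exponent_measurable: "u \<in> borel_measurable (lebesgue_on \<Omega>)"
    and exponent_gt_1: "1 < um"
    and exponent_ge: "\<And>x. x \<in> \<Omega> \<Longrightarrow> um \<le> u x"
    and exponent_le: "\<And>x. x \<in> \<Omega> \<Longrightarrow> u x \<le> up"
    and log_holder_const: "0 < A"
    and log_holder: "\<And>x y. x \<in> \<Omega> \<Longrightarrow> y \<in> \<Omega> \<Longrightarrow> norm (x - y) \<le> 1/2 \<Longrightarrow>
                       \<bar>u x - u y\<bar> \<le> A / (- ln (norm (x - y)))"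
begin

lemma exponent_gt_1': "x \<in> \<Omega> \<Longrightarrow> 1 < u x"
  using exponent_gt_1 exponent_ge[of x] by linarith

lemma exponent_diff_le: "x \<in> \<Omega> \<Longrightarrow> y \<in> \<Omega> \<Longrightarrow> \<bar>u x - u y\<bar> \<le> up - um"
  using exponent_ge[of x] exponent_ge[of y] exponent_le[of x] exponent_le[of y] by linarith

definition osc_const :: real where "osc_const = max (2 powr (up - um)) (exp A)"

lemma osc_const_ge_1: "1 \<le> osc_const"
proof -
  have "1 \<le> exp A" using log_holder_const by simp
  then show ?thesis unfolding osc_const_def by linarith
qed

text \<open>
  Between points at distance at most \<open>t\<close> the exponent varies by at most \<open>A / ln (1/t)\<close>, and \<open>t\<close>
  to the power \<open>- A / ln (1/t)\<close> is \<open>exp A\<close>.  Through this inequality log-Hoelder continuity enters.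
\<close>

lemma powr_oscillation_le:
  assumes "x \<in> \<Omega>" "y \<in> \<Omega>" "norm (x - y) \<le> t" "0 < t"
  shows "t powr (- \<bar>u x - u y\<bar>) \<le> osc_const"
proof -
  let ?d = "\<bar>u x - u y\<bar>"
  consider "1 \<le> t" | "1/2 \<le> t" "t < 1" | "t < 1/2" "x \<noteq> y" | "x = y" by linarith
  then show ?thesis
  proof cases
    case 1
    then have "t powr (- ?d) \<le> t powr 0" by (intro powr_mono) auto
    then show ?thesis using 1 osc_const_ge_1 by simp
  next
    case 2
    have "t powr (- ?d) = (1 / t) powr ?d" using \<open>0 < t\<close> by (simp add: powr_minus powr_divide inverse_eq_divide)
    also have "\<dots> \<le> 2 powr ?d" using 2 \<open>0 < t\<close> by (intro powr_mono2) (auto simp: field_simps)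
    also have "\<dots> \<le> 2 powr (up - um)" using exponent_diff_le[OF assms(1,2)] by (intro powr_mono) auto
    finally show ?thesis by (simp add: osc_const_def)
  next
    case 3
    have n: "0 < norm (x - y)" using 3 by simp
    then have l: "ln (norm (x - y)) \<le> ln t" "ln t < 0" using assms 3 by auto
    have "?d \<le> A / (- ln (norm (x - y)))" using assms 3 by (intro log_holder) auto
    also have "\<dots> \<le> A / (- ln t)" using l log_holder_const by (intro divide_left_mono) (auto simp: mult_neg_neg)
    finally have "- ?d * ln t \<le> A" using l by (simp add: field_simps)
    then have "t powr (- ?d) \<le> exp A" using \<open>0 < t\<close> by (simp add: powr_def)
    then show ?thesis by (simp add: osc_const_def)
  next
    case 4
    then show ?thesis using \<open>0 < t\<close> osc_const_ge_1 by simp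
  qed
qed

text \<open>
  The exponent is measurable on \<open>\<Omega>\<close> only; where \<open>f\<close> vanishes it may be replaced by 0.
\<close>

lemma measurable_powr_exponent:
  fixes f :: "'a \<Rightarrow> real"
  assumes f[measurable]: "f \<in> borel_measurable lebesgue" and off: "\<And>x. x \<notin> \<Omega> \<Longrightarrow> f x = 0"
    and \<phi>[measurable]: "\<phi> \<in> borel_measurable borel"
  shows "(\<lambda>x. f x powr \<phi> (u x)) \<in> borel_measurable lebesgue"
proof -
  have [measurable]: "(\<lambda>x. if x \<in> \<Omega> then u x else 0) \<in> borel_measurable lebesgue"
    using exponent_measurable Omega_sets by (simp add: borel_measurable_if)
  have "(\<lambda>x. f x powr \<phi> (u x)) = (\<lambda>x. f x powr \<phi> (if x \<in> \<Omega> then u x else 0))"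
    using off by fastforce
  then show ?thesis by simp
qed

lemma L1_le_modular:
  fixes f :: "'a \<Rightarrow> real"
  assumes f: "f \<in> borel_measurable lebesgue" and off: "\<And>x. x \<notin> \<Omega> \<Longrightarrow> f x = 0" and f0: "\<And>x. 0 \<le> f x"
  shows "(\<integral>\<^sup>+x. ennreal (f x) \<partial>lebesgue) \<le> (\<integral>\<^sup>+x. ennreal (f x powr u x) \<partial>lebesgue) + emeasure lebesgue \<Omega>"
proof -
  have [measurable]: "(\<lambda>x. f x powr u x) \<in> borel_measurable lebesgue"
    using measurable_powr_exponent[OF f off, of "\<lambda>x. x"] by simp
  have "f x \<le> f x powr u x + indicator \<Omega> x" for x
  proof (cases "x \<in> \<Omega> \<and> 1 < f x")
    case True
    then have "f x powr 1 \<le> f x powr u x" using exponent_gt_1'[of x] by (intro powr_mono) auto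
    then show ?thesis using True by simp
  next
    case False
    have "f x \<le> indicator \<Omega> x" using False off[of x] by (cases "x \<in> \<Omega>") auto
    then show ?thesis using powr_ge_zero[of "f x" "u x"] by linarith
  qed
  then have "(\<integral>\<^sup>+x. ennreal (f x) \<partial>lebesgue) \<le> (\<integral>\<^sup>+x. ennreal (f x powr u x) + indicator \<Omega> x \<partial>lebesgue)"
    by (intro nn_integral_mono) (metis ennreal_indicator ennreal_leI ennreal_plus indicator_pos_le powr_ge_zero)
  also have "\<dots> = (\<integral>\<^sup>+x. ennreal (f x powr u x) \<partial>lebesgue) + emeasure lebesgue \<Omega>"
    using Omega_sets by (subst nn_integral_add) auto
  finally show ?thesis .
qed

lemma emeasure_Omega_finite: "emeasure lebesgue \<Omega> < \<infinity>"
  using Omega_bounded Omega_sets bounded_set_imp_lmeasurable fmeasurableD2 by (metis infinity_ennreal_def less_top)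

text \<open>
  On every ball \<open>1 + W\<close> dominates the average of \<open>f\<close>, raised to the value of the exponent at any point of the
  ball.
\<close>

definition dominates_averages :: "real \<Rightarrow> ('a \<Rightarrow> real) \<Rightarrow> ('a \<Rightarrow> ennreal) \<Rightarrow> bool" where
  "dominates_averages C f W \<longleftrightarrow>
     W \<in> borel_measurable lebesgue \<and> (\<integral>\<^sup>+x. W x \<partial>lebesgue) \<le> ennreal C
     \<and> (\<forall>z r b x y. x \<in> ball z r \<longrightarrow> y \<in> ball z r \<inter> \<Omega> \<longrightarrow> 0 \<le> b \<longrightarrow>
          ennreal b * emeasure lebesgue (ball z r) \<le> (\<integral>\<^sup>+x\<in>ball z r. ennreal (f x) \<partial>lebesgue) \<longrightarrow>
          ennreal (b powr u y) \<le> ennreal C * (1 + W x))"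

text \<open>
  Let \<open>b\<close> be an average of \<open>f\<close> over a ball.  At least half of it comes from the set where \<open>f > b/2\<close>.
  With \<open>e = u/um \<ge> 1\<close>, at points \<open>w\<close> of that set \<open>f(w) \<le> f(w)\<^bsup>e(w)\<^esup> (b/2)\<^bsup>1-e(w)\<^esup>\<close>.  Replacing
  \<open>e(w)\<close> by \<open>e(y)\<close> in the power of \<open>b/2\<close> costs a constant factor, because \<open>b\<close> is at most a negative
  power of the radius and \<open>u\<close> is log-Hoelder continuous.  Hence \<open>(b/2)\<^bsup>e(y)\<^esup>\<close> is bounded by the average
  of \<open>F = f\<^bsup>e\<^esup>\<close>, and the maximal inequality with the constant exponent \<open>um\<close> applies to \<open>F\<close>.
\<close>

theorem variable_maximal_bound:
  obtains C :: real where "0 < C"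
    "\<And>f. f \<in> borel_measurable lebesgue \<Longrightarrow> (\<And>x. 0 \<le> f x) \<Longrightarrow> (\<And>x. x \<notin> \<Omega> \<Longrightarrow> f x = 0) \<Longrightarrow>
      (\<integral>\<^sup>+x. ennreal (f x powr u x) \<partial>lebesgue) \<le> 1 \<Longrightarrow>
      \<exists>W. dominates_averages C f W"
proof -
  define n where "n = DIM('a)"
  define v where "v = unit_ball_vol (real n)"
  have "0 < v" by (simp add: v_def)
  obtain C1 :: real where "0 < C1" and max: "\<And>F. F \<in> borel_measurable lebesgue \<Longrightarrow> (\<And>x. 0 \<le> F x) \<Longrightarrow>
      \<exists>W :: 'a \<Rightarrow> ennreal. W \<in> borel_measurable lebesgue
        \<and> (\<integral>\<^sup>+x. W x \<partial>lebesgue) \<le> ennreal C1 * (\<integral>\<^sup>+x. ennreal (F x powr um) \<partial>lebesgue)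
        \<and> (\<forall>z r b x. x \<in> ball z r \<longrightarrow> 0 \<le> b \<longrightarrow>
             ennreal b * emeasure lebesgue (ball z r) \<le> (\<integral>\<^sup>+x\<in>ball z r. ennreal (F x) \<partial>lebesgue) \<longrightarrow>
             ennreal (b powr um) \<le> ennreal (2 powr um) * (1 + W x))"
    by (rule maximal_function_bound[OF exponent_gt_1]) blast
  define C0 where "C0 = 1 + measure lebesgue \<Omega>"
  have C0: "1 + emeasure lebesgue \<Omega> = ennreal C0"
    using emeasure_Omega_finite by (simp add: C0_def emeasure_eq_ennreal_measure)
  have C0_ge: "0 \<le> C0" by (simp add: C0_def)
  define H where "H = max 1 (C0 * 2 ^ n / v)"
  define Kc where "Kc = H powr (up - um) * osc_const ^ n"
  define K2 where "K2 = Kc powr (1 / um)"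
  have "1 \<le> H" by (simp add: H_def)
  define C where "C = max C1 (2 powr up * K2 powr um * 2 powr um + 2 powr up)"
  show thesis
  proof (rule that[of C])
    show "0 < C" using \<open>0 < C1\<close> by (simp add: C_def)
    fix f :: "'a \<Rightarrow> real"
    assume f[measurable]: "f \<in> borel_measurable lebesgue" and f0: "\<And>x. 0 \<le> f x"
      and off: "\<And>x. x \<notin> \<Omega> \<Longrightarrow> f x = 0" and mod: "(\<integral>\<^sup>+x. ennreal (f x powr u x) \<partial>lebesgue) \<le> 1"
    define F where "F x = f x powr (u x / um)" for x
    have [measurable]: "F \<in> borel_measurable lebesgue"
      unfolding F_def using measurable_powr_exponent[OF f off, of "\<lambda>t. t / um"] by simp
    have Fum: "F x powr um = f x powr u x" for x
      using exponent_gt_1 by (simp add: F_def powr_powr)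
    obtain W where W: "W \<in> borel_measurable lebesgue"
      "(\<integral>\<^sup>+x. W x \<partial>lebesgue) \<le> ennreal C1 * (\<integral>\<^sup>+x. ennreal (F x powr um) \<partial>lebesgue)"
      "\<And>z r b x. x \<in> ball z r \<Longrightarrow> 0 \<le> b \<Longrightarrow>
             ennreal b * emeasure lebesgue (ball z r) \<le> (\<integral>\<^sup>+x\<in>ball z r. ennreal (F x) \<partial>lebesgue) \<Longrightarrow>
             ennreal (b powr um) \<le> ennreal (2 powr um) * (1 + W x)"
      using max[of F] by (auto simp: F_def)
    have "(\<integral>\<^sup>+x. W x \<partial>lebesgue) \<le> ennreal C1 * 1"
      using W(2) unfolding Fum by (rule order_trans) (intro mult_left_mono mod zero_le)
    then have Wint: "(\<integral>\<^sup>+x. W x \<partial>lebesgue) \<le> ennreal C"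
      by (rule order_trans) (simp add: C_def ennreal_leI)
    have L1: "(\<integral>\<^sup>+x. ennreal (f x) \<partial>lebesgue) \<le> ennreal C0"
      using L1_le_modular[OF f off f0] mod C0 by (metis add_right_mono order_trans)
    have main: "ennreal (b powr u y) \<le> ennreal C * (1 + W x)"
      if x: "x \<in> ball z r" and y: "y \<in> ball z r \<inter> \<Omega>" and "0 \<le> b"
        and b: "ennreal b * emeasure lebesgue (ball z r) \<le> (\<integral>\<^sup>+x\<in>ball z r. ennreal (f x) \<partial>lebesgue)"
      for z r b x y
    proof (cases "b \<le> 2")
      case True
      have "b powr u y \<le> 2 powr u y" using True \<open>0 \<le> b\<close> y exponent_gt_1'[of y] by (intro powr_mono2) auto
      also have "\<dots> \<le> 2 powr up" using y exponent_le[of y] by (intro powr_mono) auto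
      also have "\<dots> \<le> C" by (simp add: C_def le_max_iff_disj)
      finally have "ennreal (b powr u y) \<le> ennreal C * 1" by (simp add: ennreal_leI)
      also have "\<dots> \<le> ennreal C * (1 + W x)" by (intro mult_left_mono) auto
      finally show ?thesis .
    next
      case False
      have "0 < r" using x by (metis ball_eq_empty empty_iff not_le)
      define B where "B = ball z r"
      have B[measurable]: "B \<in> sets lebesgue" by (simp add: B_def)
      define b0 where "b0 = b / 2"
      have "1 < b0" using False by (simp add: b0_def)
      define e where "e = u y / um"
      define k where "k = K2 * b0 powr (1 - e)"
      have "ennreal b * emeasure lebesgue B \<le> ennreal C0"
        using b L1 unfolding B_def
        by (elim order_trans) (rule order_trans[OF nn_integral_mono], auto simp: indicator_def)
      then have "b * (v * r ^ n) \<le> C0"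
        using \<open>0 < r\<close> \<open>0 \<le> b\<close> \<open>0 < v\<close>
        by (simp add: B_def emeasure_ball v_def[symmetric] n_def[symmetric] ennreal_le_iff[OF C0_ge] flip: ennreal_mult)
      then have "b0 \<le> C0 / (v * r ^ n)"
        using \<open>0 < r\<close> \<open>0 < v\<close> \<open>0 \<le> b\<close> by (simp add: b0_def field_simps) (smt (verit, best) \<open>0 \<le> b\<close> mult_nonneg_nonneg zero_le_power)
      also have "\<dots> = (C0 * 2 ^ n / v) / (2 * r) ^ n" using \<open>0 < r\<close> by (simp add: power_mult_distrib)
      also have "\<dots> \<le> H / (2 * r) ^ n" using \<open>0 < r\<close> by (intro divide_right_mono) (auto simp: H_def)
      finally have b0: "b0 \<le> H / (2 * r) ^ n" .
      have osc: "b0 powr (u y - u w) \<le> Kc" if w: "w \<in> B" "w \<in> \<Omega>" for w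
      proof -
        let ?d = "\<bar>u y - u w\<bar>"
        have "dist y w \<le> dist z y + dist z w" by (metis dist_triangle3 dist_commute)
        then have dist: "norm (y - w) \<le> 2 * r" using w y by (simp add: B_def dist_norm)
        have "b0 powr (u y - u w) \<le> b0 powr ?d" using \<open>1 < b0\<close> by (intro powr_mono) auto
        also have "\<dots> \<le> (H / (2 * r) ^ n) powr ?d" using b0 \<open>1 < b0\<close> by (intro powr_mono2) auto
        also have "\<dots> = H powr ?d * ((2 * r) powr (- ?d)) ^ n"
        proof -
          have pw: "(t ^ n) powr d = (t powr d) ^ n" if "0 < t" for t d :: real
            using that by (simp add: powr_powr powr_power mult.commute flip: powr_realpow)
          have "0 < 2 * r" using \<open>0 < r\<close> by simp
          from pw[OF this] have "((2 * r) ^ n) powr ?d = ((2 * r) powr ?d) ^ n" .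
          moreover have "(H / (2 * r) ^ n) powr ?d = H powr ?d / ((2 * r) ^ n) powr ?d"
            by (rule powr_divide)
          ultimately show ?thesis by (simp add: powr_minus power_inverse divide_inverse)
        qed
        also have "\<dots> \<le> H powr (up - um) * osc_const ^ n"
          using exponent_diff_le[of y w] y w \<open>1 \<le> H\<close> \<open>0 < r\<close> dist powr_oscillation_le[of y w "2 * r"]
          by (intro mult_mono power_mono powr_mono) auto
        finally show ?thesis by (simp add: Kc_def)
      qed
      (* At w = y the oscillation bound reads 1 \<le> Kc. *)
      have "1 \<le> Kc" using osc[of y] y \<open>1 < b0\<close> by (simp add: B_def)
      then have "1 \<le> K2" using exponent_gt_1 by (simp add: K2_def ge_one_powr_ge_zero)
      have pointwise: "f w \<le> b0 + k * F w" if w: "w \<in> B" for w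
      proof (cases "w \<in> \<Omega> \<and> b0 < f w")
        case True
        define e' where "e' = u w / um"
        have "1 \<le> e'" using True exponent_ge[of w] exponent_gt_1 by (simp add: e'_def)
        have "f w = f w powr e' * f w powr (1 - e')" using True \<open>1 < b0\<close> by (simp flip: powr_add)
        also have "\<dots> \<le> f w powr e' * b0 powr (1 - e')"
          using True \<open>1 < b0\<close> \<open>1 \<le> e'\<close> by (intro mult_left_mono powr_mono2') auto
        also have "b0 powr (1 - e') = b0 powr (1 - e) * (b0 powr (u y - u w)) powr (1 / um)"
          by (simp add: e_def e'_def powr_powr diff_divide_distrib flip: powr_add)
        also have "\<dots> \<le> b0 powr (1 - e) * K2"
          unfolding K2_def using osc[OF w] True exponent_gt_1 by (intro mult_left_mono powr_mono2) auto
        finally have "f w \<le> f w powr e' * (b0 powr (1 - e) * K2)" by (simp add: mult_left_mono)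
        also have "\<dots> = k * F w" by (simp add: k_def F_def e'_def ac_simps)
        finally show ?thesis using \<open>1 < b0\<close> by simp
      next
        case False
        then show ?thesis using off[of w] \<open>1 < b0\<close> \<open>1 \<le> K2\<close>
          by (auto simp: k_def F_def intro!: add_increasing2)
      qed
      have "k > 0" using \<open>1 \<le> K2\<close> \<open>1 < b0\<close> by (simp add: k_def)
      have fin: "ennreal b0 * emeasure lebesgue B \<noteq> \<infinity>"
        using emeasure_ball_pos(2)[OF \<open>0 < r\<close>, of z] by (simp add: B_def ennreal_mult_eq_top_iff less_top)
      have "ennreal b0 * emeasure lebesgue B + ennreal b0 * emeasure lebesgue B = ennreal b * emeasure lebesgue B"
        using \<open>1 < b0\<close> by (simp add: b0_def flip: distrib_right ennreal_plus)
      also have "\<dots> \<le> (\<integral>\<^sup>+x\<in>B. ennreal (f x) \<partial>lebesgue)" using b by (simp add: B_def)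
      also have "\<dots> \<le> (\<integral>\<^sup>+x. ennreal b0 * indicator B x + ennreal k * (ennreal (F x) * indicator B x) \<partial>lebesgue)"
      proof (intro nn_integral_mono)
        fix w
        have "ennreal (b0 + k * F w) = ennreal b0 + ennreal k * ennreal (F w)"
          using \<open>1 < b0\<close> \<open>k > 0\<close> by (simp add: F_def ennreal_mult)
        then show "ennreal (f w) * indicator B w \<le> ennreal b0 * indicator B w + ennreal k * (ennreal (F w) * indicator B w)"
          using ennreal_leI[OF pointwise[of w]] by (simp add: indicator_def)
      qed
      also have "\<dots> = ennreal b0 * emeasure lebesgue B + ennreal k * (\<integral>\<^sup>+x\<in>B. ennreal (F x) \<partial>lebesgue)"
        by (subst nn_integral_add) (auto simp: nn_integral_cmult_indicator nn_integral_cmult)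
      finally have "ennreal b0 * emeasure lebesgue B \<le> ennreal k * (\<integral>\<^sup>+x\<in>B. ennreal (F x) \<partial>lebesgue)"
        using fin by (simp add: ennreal_add_left_cancel_le)
      then have "ennreal (1 / k) * (ennreal b0 * emeasure lebesgue B) \<le> ennreal (1 / k) * (ennreal k * (\<integral>\<^sup>+x\<in>B. ennreal (F x) \<partial>lebesgue))"
        by (rule mult_left_mono) simp
      then have "ennreal (b0 / k) * emeasure lebesgue B \<le> (\<integral>\<^sup>+x\<in>B. ennreal (F x) \<partial>lebesgue)"
        using \<open>k > 0\<close> \<open>1 < b0\<close> by (simp add: mult.assoc[symmetric] flip: ennreal_mult)
      then have "ennreal ((b0 / k) powr um) \<le> ennreal (2 powr um) * (1 + W x)"
        using W(3)[of x z r "b0 / k"] x \<open>k > 0\<close> \<open>1 < b0\<close> by (simp add: B_def)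
      moreover have "b0 / k = b0 powr e / K2"
        using \<open>1 < b0\<close> \<open>1 \<le> K2\<close> by (simp add: k_def powr_diff)
      moreover have "(b0 powr e / K2) powr um = b0 powr u y / K2 powr um"
        using exponent_gt_1 \<open>1 \<le> K2\<close> by (simp add: powr_divide powr_powr e_def)
      ultimately have *: "ennreal (b0 powr u y / K2 powr um) \<le> ennreal (2 powr um) * (1 + W x)" by simp
      have "b powr u y = 2 powr u y * b0 powr u y" using \<open>1 < b0\<close> by (simp add: b0_def flip: powr_mult)
      also have "\<dots> \<le> 2 powr up * b0 powr u y" using y exponent_le[of y] by (intro mult_right_mono powr_mono) auto
      also have "\<dots> = (2 powr up * K2 powr um) * (b0 powr u y / K2 powr um)" using \<open>1 \<le> K2\<close> by simp
      finally have "ennreal (b powr u y) \<le> ennreal (2 powr up * K2 powr um) * ennreal (b0 powr u y / K2 powr um)"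
        by (simp add: ennreal_leI flip: ennreal_mult)
      also have "\<dots> \<le> ennreal (2 powr up * K2 powr um) * (ennreal (2 powr um) * (1 + W x))"
        using * by (intro mult_left_mono) auto
      also have "\<dots> = ennreal (2 powr up * K2 powr um * 2 powr um) * (1 + W x)"
        by (simp add: mult.assoc[symmetric] flip: ennreal_mult)
      also have "\<dots> \<le> ennreal C * (1 + W x)"
        by (intro mult_right_mono ennreal_leI) (auto simp: C_def le_max_iff_disj)
      finally show ?thesis .
    qed
    show "\<exists>W. dominates_averages C f W"
      unfolding dominates_averages_def using W(1) Wint main by blast
  qed
qed

end

section \<open>Domination of a function by its local oscillations\<close>

text \<open>
  These are the properties of dyadic cubes on which stopping time arguments rest; \<open>Q k x\<close> stands for
  the cube of generation \<open>k\<close> that contains \<open>x\<close>.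
\<close>

locale nested_grid =
  fixes Q :: "nat \<Rightarrow> 'a::euclidean_space \<Rightarrow> 'a set" and M :: real
  assumes self: "x \<in> Q k x"
    and cube_eq: "y \<in> Q k x \<Longrightarrow> Q k y = Q k x"
    and nested_Suc: "Q (Suc k) x \<subseteq> Q k x"
    and cube_lmeasurable: "Q k x \<in> lmeasurable"
    and cube_pos: "0 < measure lebesgue (Q k x)"
    and doubling: "measure lebesgue (Q k x) \<le> M * measure lebesgue (Q (Suc k) x)"
    and countable_level: "countable (range (Q k))"
    and shrinking: "open U \<Longrightarrow> x \<in> U \<Longrightarrow> \<exists>k. Q k x \<subseteq> U"
begin

definition cubes :: "'a set set" where "cubes = (\<Union>k. range (Q k))"

lemma countable_cubes: "countable cubes"
  unfolding cubes_def by (intro countable_UN countable_level) auto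

lemma nested: "m \<le> k \<Longrightarrow> Q k x \<subseteq> Q m x"
  by (induction k rule: dec_induct) (use nested_Suc in blast)+

lemma cubesE:
  assumes "P \<in> cubes" obtains k x where "P = Q k x"
  using assms unfolding cubes_def by auto

lemma cubes_lmeasurable: "P \<in> cubes \<Longrightarrow> P \<in> lmeasurable"
  and cubes_pos: "P \<in> cubes \<Longrightarrow> 0 < measure lebesgue P"
  using cube_lmeasurable cube_pos by (auto elim: cubesE)

lemma M_ge_1: "1 \<le> M"
proof -
  have le: "measure lebesgue (Q (Suc 0) x) \<le> measure lebesgue (Q 0 x)" for x
    using nested_Suc cube_lmeasurable by (intro measure_mono_fmeasurable) auto
  then have "1 * measure lebesgue (Q (Suc 0) undefined) \<le> M * measure lebesgue (Q (Suc 0) undefined)"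
    using order_trans[OF le doubling] by simp
  then show ?thesis using cube_pos[of "Suc 0" undefined] by (simp only: mult_le_cancel_right_pos)
qed

text \<open>
  A Calderon--Zygmund decomposition of an open superset \<open>E'\<close> of \<open>E\<close> inside \<open>P\<close>.  Openness plays the role of
  Lebesgue's density theorem, since every point of \<open>E'\<close> has a cube that lies in \<open>E'\<close>.  For each point
  of \<open>E'\<close> select the first generation in which the cube around it is filled by \<open>E'\<close> to more than the
  fraction \<open>1/(2M)\<close>.  Selected cubes are equal or disjoint, their total measure is at most \<open>2M\<close> times
  that of \<open>E'\<close>, and as their parents were not selected, \<open>E'\<close> fills at most half of each of them.
\<close>

lemma stopping_cubes:
  assumes P: "P \<in> cubes" and E: "E \<in> sets lebesgue" "E \<subseteq> P"
    and small: "measure lebesgue E \<le> measure lebesgue P / (8 * M)"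
  shows "\<exists>R :: nat \<Rightarrow> 'a set. (\<forall>i. R i = {} \<or> R i \<in> cubes) \<and> (\<forall>i. R i \<subseteq> P) \<and> disjoint_family R
    \<and> E \<subseteq> (\<Union>i. R i) \<and> emeasure lebesgue (\<Union>i. R i) \<le> ennreal (measure lebesgue P / 2)
    \<and> (\<forall>i. measure lebesgue (E \<inter> R i) \<le> measure lebesgue (R i) / 2)"
proof -
  obtain k x where Pk: "P = Q k x" using P by (rule cubesE)
  have M: "1 \<le> M" by (rule M_ge_1)
  have Ppos: "0 < measure lebesgue P" and Pl: "P \<in> lmeasurable"
    using P cubes_pos cubes_lmeasurable by auto
  define \<epsilon> where "\<epsilon> = measure lebesgue P / (8 * M)"
  have "0 < \<epsilon>" using Ppos M by (simp add: \<epsilon>_def)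
  obtain T where T: "open T" "E \<subseteq> T" "T - E \<in> lmeasurable" "emeasure lebesgue (T - E) < ennreal \<epsilon>"
    using sets_lebesgue_outer_open[OF E(1) \<open>0 < \<epsilon>\<close>] by blast
  define E' where "E' = T \<inter> P"
  have El: "E \<in> lmeasurable" using E Pl by (meson fmeasurableI2)
  have E'l: "E' \<in> lmeasurable" unfolding E'_def by (rule fmeasurableI2[OF Pl]) (use T(1) Pl in auto)
  have "measure lebesgue E' \<le> measure lebesgue (E \<union> (T - E))"
    using E'l fmeasurable.Un[OF El T(3)]
    by (intro measure_mono_fmeasurable) (auto simp: E'_def simp del: Un_Diff_cancel)
  also have "\<dots> \<le> measure lebesgue E + measure lebesgue (T - E)"
    using El T(3) by (intro measure_Un_le) auto
  also have "measure lebesgue (T - E) \<le> \<epsilon>"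
    using T(3,4) \<open>0 < \<epsilon>\<close> by (simp add: emeasure_eq_measure2 ennreal_less_iff)
  finally have E'small: "measure lebesgue E' \<le> measure lebesgue P / (4 * M)"
    using small M by (simp add: \<epsilon>_def field_simps)
  define S where "S y m \<longleftrightarrow> measure lebesgue (Q m y) < 2 * M * measure lebesgue (E' \<inter> Q m y)" for y m
  have Q_int_l: "E' \<inter> Q m y \<in> lmeasurable" for m y
    using E'l cube_lmeasurable by (intro fmeasurable.Int) auto
  have Py: "P = Q k y" if "y \<in> E'" for y using cube_eq[of y k x] that by (simp add: E'_def Pk)
  have S_ex: "\<exists>m. S y m" if y: "y \<in> E'" for y
  proof -
    obtain m where m: "Q m y \<subseteq> T" using shrinking[of T y] T(1) y by (auto simp: E'_def)
    have "Q (max m k) y \<subseteq> E'" using m nested[of m "max m k" y] nested[of k "max m k" y] Py[OF y] by (auto simp: E'_def)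
    then have "E' \<inter> Q (max m k) y = Q (max m k) y" by blast
    then have "S y (max m k)" using cube_pos[of "max m k" y] M by (simp add: S_def)
    then show ?thesis ..
  qed
  have not_S: "\<not> S y m" if y: "y \<in> E'" and "m \<le> k" for y m
  proof -
    have "2 * M * measure lebesgue (E' \<inter> Q m y) \<le> 2 * M * measure lebesgue E'"
      using M E'l Q_int_l by (intro mult_left_mono measure_mono_fmeasurable) auto
    also have "\<dots> \<le> measure lebesgue P / 2" using E'small M by (simp add: field_simps)
    also have "\<dots> \<le> measure lebesgue P" using Ppos by simp
    also have "\<dots> \<le> measure lebesgue (Q m y)"
      using nested[OF \<open>m \<le> k\<close>, of y] Py[OF y] cube_lmeasurable Pl by (intro measure_mono_fmeasurable) auto
    finally show ?thesis by (simp add: S_def)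
  qed
  define \<tau> where "\<tau> y = (LEAST m. S y m)" for y
  have S\<tau>: "S y (\<tau> y)" if "y \<in> E'" for y using S_ex[OF that] unfolding \<tau>_def by (rule LeastI_ex)
  have \<tau>_gt: "k < \<tau> y" if "y \<in> E'" for y using S\<tau>[OF that] not_S[OF that] not_le by blast
  define stop where "stop y = Q (\<tau> y) y" for y
  have stop_half: "measure lebesgue (E' \<inter> stop y) \<le> measure lebesgue (stop y) / 2" if y: "y \<in> E'" for y
  proof -
    obtain m where m: "\<tau> y = Suc m" using \<tau>_gt[OF y] by (metis gr0_conv_Suc not_less0 zero_less_iff_neq_zero)
    have "\<not> S y m" using not_less_Least[of m "S y"] m unfolding \<tau>_def by auto
    then have "2 * M * measure lebesgue (E' \<inter> Q m y) \<le> M * measure lebesgue (stop y)"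
      using doubling[of m y] by (simp add: S_def stop_def m)
    moreover have "measure lebesgue (E' \<inter> stop y) \<le> measure lebesgue (E' \<inter> Q m y)"
      unfolding stop_def m using nested_Suc[of m y] Q_int_l by (intro measure_mono_fmeasurable) auto
    then have "2 * M * measure lebesgue (E' \<inter> stop y) \<le> 2 * M * measure lebesgue (E' \<inter> Q m y)"
      using M by (intro mult_left_mono) auto
    ultimately have "M * (2 * measure lebesgue (E' \<inter> stop y)) \<le> M * measure lebesgue (stop y)" by simp
    then have "2 * measure lebesgue (E' \<inter> stop y) \<le> measure lebesgue (stop y)"
      using M by (simp only: mult_le_cancel_left_pos)
    then show ?thesis by simp
  qed
  have stop_meet: "stop y' = stop y"
    if y: "y \<in> E'" "y' \<in> E'" and z: "z \<in> stop y" "z \<in> stop y'" and le: "\<tau> y \<le> \<tau> y'" for y y' z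
  proof -
    have "Q (\<tau> y) z = Q (\<tau> y) y" "Q (\<tau> y') z = Q (\<tau> y') y'"
      using z cube_eq by (auto simp: stop_def)
    then have "Q (\<tau> y') y' \<subseteq> Q (\<tau> y) y" using nested[OF le, of z] by simp
    then have eq: "Q (\<tau> y) y' = Q (\<tau> y) y" using self[of y' "\<tau> y'"] cube_eq by blast
    then have "S y' (\<tau> y)" using S\<tau>[OF y(1)] by (simp add: S_def)
    then have "\<tau> y' \<le> \<tau> y" unfolding \<tau>_def[of y'] by (rule Least_le)
    with le eq show ?thesis by (simp add: stop_def)
  qed
  have disj: "A \<inter> B = {}" if "A \<in> stop ` E'" "B \<in> stop ` E'" "A \<noteq> B" for A B
    using that stop_meet by (smt (verit) disjoint_iff imageE nle_le)
  have "countable (stop ` E')"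
    by (rule countable_subset[OF _ countable_cubes]) (auto simp: stop_def cubes_def)
  then obtain e where e: "\<And>n A. e n = Some A \<Longrightarrow> A \<in> stop ` E'" "\<And>A. A \<in> stop ` E' \<Longrightarrow> \<exists>n::nat. e n = Some A"
    "disjoint_family (\<lambda>n. case e n of None \<Rightarrow> {} | Some A \<Rightarrow> A)"
    using disj by (rule disjoint_enumeration[of "stop ` E'" "\<lambda>A. A"]) (assumption+, rule that)
  define R where "R n = (case e n of None \<Rightarrow> {} | Some A \<Rightarrow> A)" for n
  have R_cases: "R i = {} \<or> (\<exists>y\<in>E'. R i = stop y)" for i
    using e(1)[of i] by (auto simp: R_def split: option.splits)
  have cov: "E' \<subseteq> (\<Union>i. R i)"
  proof
    fix y assume "y \<in> E'"
    then obtain n where "e n = Some (stop y)" using e(2) by blast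
    then have "y \<in> R n" by (simp add: R_def stop_def self)
    then show "y \<in> (\<Union>i. R i)" by blast
  qed
  have Rl: "R i \<in> lmeasurable" for i
    using R_cases[of i] cube_lmeasurable by (auto simp: stop_def)
  have RE'l: "E' \<inter> R i \<in> lmeasurable" for i using Rl E'l by (intro fmeasurable.Int) auto
  have disjR: "disjoint_family R" using e(3) by (simp add: R_def[abs_def])
  have Rlarge: "emeasure lebesgue (R i) \<le> ennreal (2 * M) * emeasure lebesgue (E' \<inter> R i)" for i
  proof (cases "R i = {}")
    case False
    then obtain y where y: "y \<in> E'" "R i = stop y" using R_cases by blast
    have "measure lebesgue (R i) \<le> 2 * M * measure lebesgue (E' \<inter> R i)"
      using S\<tau>[OF y(1)] y(2) by (simp add: S_def stop_def)
    then show ?thesis using M Rl[of i] RE'l[of i]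
      by (simp add: emeasure_eq_measure2 ennreal_leI flip: ennreal_mult)
  qed simp
  have "emeasure lebesgue (\<Union>i. R i) = (\<Sum>i. emeasure lebesgue (R i))"
    using Rl disjR by (intro suminf_emeasure[symmetric]) auto
  also have "\<dots> \<le> (\<Sum>i. ennreal (2 * M) * emeasure lebesgue (E' \<inter> R i))"
    using Rlarge by (intro suminf_le) auto
  also have "\<dots> = ennreal (2 * M) * (\<Sum>i. emeasure lebesgue (E' \<inter> R i))" by (rule ennreal_suminf_cmult)
  also have "(\<Sum>i. emeasure lebesgue (E' \<inter> R i)) = emeasure lebesgue (\<Union>i. E' \<inter> R i)"
    using RE'l disjR by (intro suminf_emeasure) (auto simp: disjoint_family_on_def)
  also have "\<dots> \<le> emeasure lebesgue E'" using E'l by (intro emeasure_mono) auto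
  also have "ennreal (2 * M) * emeasure lebesgue E' \<le> ennreal (measure lebesgue P / 2)"
    using E'small M E'l by (simp add: emeasure_eq_measure2 field_simps flip: ennreal_mult)
  finally have 5: "emeasure lebesgue (\<Union>i. R i) \<le> ennreal (measure lebesgue P / 2)"
    by (simp add: mult_left_mono)
  show ?thesis
  proof (intro exI[of _ R] conjI allI)
    show "R i = {} \<or> R i \<in> cubes" for i using R_cases[of i] by (auto simp: stop_def cubes_def)
    show "R i \<subseteq> P" for i
    proof (cases "R i = {}")
      case False
      then obtain y where y: "y \<in> E'" "R i = stop y" using R_cases by blast
      then show ?thesis using nested[of k "\<tau> y" y] \<tau>_gt[of y] Py[of y] by (simp add: stop_def less_imp_le)
    qed simp
    show "E \<subseteq> (\<Union>i. R i)" using cov E T by (auto simp: E'_def)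
    show "measure lebesgue (E \<inter> R i) \<le> measure lebesgue (R i) / 2" for i
    proof (cases "R i = {}")
      case False
      then obtain y where y: "y \<in> E'" "R i = stop y" using R_cases by blast
      have "measure lebesgue (E \<inter> R i) \<le> measure lebesgue (E' \<inter> R i)"
        using E T RE'l[of i] El Rl[of i] by (intro measure_mono_fmeasurable) (auto simp: E'_def)
      with stop_half[OF y(1)] y show ?thesis by simp
    qed simp
  qed (use disjR 5 in auto)
qed

text \<open>
  The fraction \<open>1/(8M)\<close> is so small that the stopping cubes of the exceptional set cover at most half of \<open>P\<close>.
\<close>

definition admissible :: "('a \<Rightarrow> complex) \<Rightarrow> ('a \<Rightarrow> ennreal) \<Rightarrow> ('a \<Rightarrow> ennreal) \<Rightarrow> 'a set \<Rightarrow> real \<Rightarrow> complex \<Rightarrow> bool" where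
  "admissible F g W P a c \<longleftrightarrow> 0 \<le> a
     \<and> measure lebesgue {x\<in>P. a < norm (F x - c)} \<le> measure lebesgue P / (8 * M)
     \<and> (\<forall>x\<in>P. ennreal a * (\<integral>\<^sup>+y\<in>P. g y \<partial>lebesgue) \<le> W x * emeasure lebesgue P)"

text \<open>
  The two exceptional sets together do not fill \<open>R\<close>, and at any other point of \<open>R\<close> both
  constants are close to the value of \<open>F\<close>.
\<close>

lemma admissible_step:
  assumes F[measurable]: "F \<in> borel_measurable lebesgue"
    and "R \<in> cubes" "admissible F g W R a' c'" "admissible F g W P a c" "R \<subseteq> P"
    and half: "measure lebesgue ({x\<in>P. a < norm (F x - c)} \<inter> R) \<le> measure lebesgue R / 2"
  shows "norm (c - c') \<le> a + a'"
proof -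
  let ?E = "{x\<in>P. a < norm (F x - c)} \<inter> R" and ?E' = "{x\<in>R. a' < norm (F x - c')}"
  have R: "R \<in> lmeasurable" "0 < measure lebesgue R" using assms(2) cubes_lmeasurable cubes_pos by auto
  then have [measurable]: "R \<in> sets lebesgue" by auto
  have "?E = {x\<in>R. a < norm (F x - c)}" using \<open>R \<subseteq> P\<close> by auto
  moreover have "{x\<in>R. a < norm (F x - c)} \<in> sets lebesgue" "?E' \<in> sets lebesgue"
    by measurable
  ultimately have l: "?E \<in> lmeasurable" "?E' \<in> lmeasurable"
    using R(1) by (auto intro: fmeasurableI2)
  have "measure lebesgue ?E' \<le> measure lebesgue R / (8 * M)" using assms(3) by (simp add: admissible_def)
  also have "\<dots> \<le> measure lebesgue R / 8" using M_ge_1 R(2) by (intro divide_left_mono) auto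
  finally have "measure lebesgue (?E \<union> ?E') < measure lebesgue R"
    using half measure_Un_le[of ?E lebesgue ?E'] l R(2) by (auto simp: fmeasurableD)
  then have "\<not> R \<subseteq> ?E \<union> ?E'"
    using measure_mono_fmeasurable[of R "?E \<union> ?E'" lebesgue] R(1) l by (auto simp: fmeasurableD)
  then obtain x where "x \<in> R" "norm (F x - c) \<le> a" "norm (F x - c') \<le> a'"
    using \<open>R \<subseteq> P\<close> by force
  then show ?thesis
    using norm_triangle_ineq4[of "F x - c'" "F x - c"] by simp
qed

text \<open>
  The induction is over the number of rounds of stopping, where \<open>Z\<close> is covered by the cubes of the last round.
  Outside the selected cubes the integrand is at most \<open>2 a g\<close>, and inside a selected cube the passage to
  its own constants costs \<open>2 a g\<close> as well.  As \<open>W\<close> dominates \<open>a\<close> times the average of \<open>g\<close>, the total cost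
  \<open>2 a \<integral> g\<close> is paid for by the integral of \<open>W\<close> over the part of \<open>P\<close> that is left uncovered, which has
  at least half the measure of \<open>P\<close>.  The uncovered parts in different cubes and rounds are disjoint, so
  that the payments add up to one integral of \<open>W\<close>.  The additional summand \<open>a\<close> in the integrand
  absorbs the difference between the constants of consecutive rounds.
\<close>

lemma oscillation_stage:
  assumes F[measurable]: "F \<in> borel_measurable lebesgue"
    and g[measurable]: "g \<in> borel_measurable lebesgue" and W[measurable]: "W \<in> borel_measurable lebesgue"
    and all: "\<And>P. P \<in> cubes \<Longrightarrow> \<exists>a c. admissible F g W P a c"
    and P: "P \<in> cubes" "admissible F g W P a c"
  shows "\<exists>Z. Z \<in> sets lebesgue \<and> Z \<subseteq> P \<and> emeasure lebesgue Z \<le> ennreal ((1/2) ^ j) * emeasure lebesgue P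
           \<and> (\<integral>\<^sup>+x\<in>P - Z. ennreal (norm (F x - c) + a) * g x \<partial>lebesgue) \<le> 4 * (\<integral>\<^sup>+x\<in>P. W x \<partial>lebesgue)"
  using P
proof (induction j arbitrary: P a c)
  case 0
  then show ?case using cubes_lmeasurable[of P] by (intro exI[of _ P]) auto
next
  case (Suc j)
  note P = Suc.prems
  have a: "0 \<le> a" and small: "measure lebesgue {x\<in>P. a < norm (F x - c)} \<le> measure lebesgue P / (8 * M)"
    and dom: "\<And>x. x \<in> P \<Longrightarrow> ennreal a * (\<integral>\<^sup>+y\<in>P. g y \<partial>lebesgue) \<le> W x * emeasure lebesgue P"
    using P(2) by (auto simp: admissible_def)
  have Pl: "P \<in> lmeasurable" and Ppos: "0 < measure lebesgue P" using P(1) cubes_lmeasurable cubes_pos by auto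
  have [measurable]: "P \<in> sets lebesgue" using Pl by auto
  define E where "E = {x\<in>P. a < norm (F x - c)}"
  have E: "E \<in> sets lebesgue" unfolding E_def by measurable
  have EP: "E \<subseteq> P" by (auto simp: E_def)
  from stopping_cubes[OF P(1) E EP small[folded E_def]]
  obtain R :: "nat \<Rightarrow> 'a set" where "(\<forall>i. R i = {} \<or> R i \<in> cubes) \<and> (\<forall>i. R i \<subseteq> P) \<and> disjoint_family R
    \<and> E \<subseteq> (\<Union>i. R i) \<and> emeasure lebesgue (\<Union>i. R i) \<le> ennreal (measure lebesgue P / 2)
    \<and> (\<forall>i. measure lebesgue (E \<inter> R i) \<le> measure lebesgue (R i) / 2)"
    by (rule exE)
  then have R: "R i = {} \<or> R i \<in> cubes" "R i \<subseteq> P" "disjoint_family R"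
    "E \<subseteq> (\<Union>i. R i)" "emeasure lebesgue (\<Union>i. R i) \<le> ennreal (measure lebesgue P / 2)"
    "measure lebesgue (E \<inter> R i) \<le> measure lebesgue (R i) / 2" for i
    by blast+
  have [measurable]: "R i \<in> sets lebesgue" for i using R(1)[of i] cubes_lmeasurable[of "R i"] by auto
  define h where "h x = ennreal (norm (F x - c) + a) * g x" for x
  have [measurable]: "h \<in> borel_measurable lebesgue" unfolding h_def by measurable
  have "\<exists>Z. Z \<in> sets lebesgue \<and> Z \<subseteq> R i \<and> emeasure lebesgue Z \<le> ennreal ((1/2) ^ j) * emeasure lebesgue (R i)
      \<and> (\<integral>\<^sup>+x\<in>R i - Z. h x \<partial>lebesgue) \<le> (\<integral>\<^sup>+x\<in>R i. ennreal (2 * a) * g x + 4 * W x \<partial>lebesgue)" for i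
  proof (cases "R i = {}")
    case False
    then have Ri: "R i \<in> cubes" using R(1) by blast
    then obtain a' c' where adm': "admissible F g W (R i) a' c'" using all by blast
    then have a': "0 \<le> a'" by (simp add: admissible_def)
    have cc: "norm (c - c') \<le> a + a'"
      by (rule admissible_step[OF F Ri adm' P(2) R(2)]) (use R(6)[of i] in \<open>simp add: E_def\<close>)
    obtain Z where Z: "Z \<in> sets lebesgue" "Z \<subseteq> R i" "emeasure lebesgue Z \<le> ennreal ((1/2) ^ j) * emeasure lebesgue (R i)"
      "(\<integral>\<^sup>+x\<in>R i - Z. ennreal (norm (F x - c') + a') * g x \<partial>lebesgue) \<le> 4 * (\<integral>\<^sup>+x\<in>R i. W x \<partial>lebesgue)"
      using Suc.IH[OF Ri adm'] by blast
    note Z(1)[measurable]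
    have pw: "h x \<le> ennreal (norm (F x - c') + a') * g x + ennreal (2 * a) * g x" for x
    proof -
      have "norm (F x - c) \<le> norm (F x - c') + norm (c - c')"
        using norm_triangle_ineq[of "F x - c'" "c' - c"] by (simp add: norm_minus_commute)
      then have "ennreal (norm (F x - c) + a) \<le> ennreal (norm (F x - c') + a') + ennreal (2 * a)"
        using cc a a' by (simp add: ennreal_leI flip: ennreal_plus)
      then show ?thesis unfolding h_def distrib_right[symmetric] by (rule mult_right_mono) simp
    qed
    have "(\<integral>\<^sup>+x\<in>R i - Z. h x \<partial>lebesgue)
        \<le> (\<integral>\<^sup>+x. ennreal (norm (F x - c') + a') * g x * indicator (R i - Z) x + ennreal (2 * a) * g x * indicator (R i) x \<partial>lebesgue)"
      using pw by (intro nn_integral_mono) (auto simp: indicator_def)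
    also have "\<dots> = (\<integral>\<^sup>+x\<in>R i - Z. ennreal (norm (F x - c') + a') * g x \<partial>lebesgue) + (\<integral>\<^sup>+x\<in>R i. ennreal (2 * a) * g x \<partial>lebesgue)"
      by (rule nn_integral_add) measurable
    also have "\<dots> \<le> 4 * (\<integral>\<^sup>+x\<in>R i. W x \<partial>lebesgue) + (\<integral>\<^sup>+x\<in>R i. ennreal (2 * a) * g x \<partial>lebesgue)"
      using Z(4) by (rule add_right_mono)
    also have "\<dots> = (\<integral>\<^sup>+x. 4 * (W x * indicator (R i) x) + ennreal (2 * a) * g x * indicator (R i) x \<partial>lebesgue)"
      by (subst nn_integral_add) (auto simp: nn_integral_cmult)
    also have "\<dots> = (\<integral>\<^sup>+x\<in>R i. ennreal (2 * a) * g x + 4 * W x \<partial>lebesgue)"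
      by (intro nn_integral_cong) (simp add: indicator_def)
    finally show ?thesis using Z by blast
  qed (intro exI[of _ "{}"], simp)
  note ex = this
  from choice[OF allI[OF ex]] obtain Z where Zall: "\<forall>i. Z i \<in> sets lebesgue \<and> Z i \<subseteq> R i
      \<and> emeasure lebesgue (Z i) \<le> ennreal ((1/2) ^ j) * emeasure lebesgue (R i)
      \<and> (\<integral>\<^sup>+x\<in>R i - Z i. h x \<partial>lebesgue) \<le> (\<integral>\<^sup>+x\<in>R i. ennreal (2 * a) * g x + 4 * W x \<partial>lebesgue)"
    by (rule exE)
  then have Z: "Z i \<in> sets lebesgue" "Z i \<subseteq> R i" "emeasure lebesgue (Z i) \<le> ennreal ((1/2) ^ j) * emeasure lebesgue (R i)"
    "(\<integral>\<^sup>+x\<in>R i - Z i. h x \<partial>lebesgue) \<le> (\<integral>\<^sup>+x\<in>R i. ennreal (2 * a) * g x + 4 * W x \<partial>lebesgue)" for i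
    by blast+
  note Z(1)[measurable]
  define U where "U = (\<Union>i. R i)"
  have [measurable]: "U \<in> sets lebesgue" unfolding U_def by measurable
  have UP: "U \<subseteq> P" using R(2) by (auto simp: U_def)
  have disjZ: "disjoint_family (\<lambda>i. R i - Z i)" using R(3) by (auto simp: disjoint_family_on_def)
  have sizeZ: "emeasure lebesgue (\<Union>i. Z i) \<le> ennreal ((1/2) ^ Suc j) * emeasure lebesgue P"
  proof -
    have "emeasure lebesgue (\<Union>i. Z i) \<le> (\<Sum>i. emeasure lebesgue (Z i))"
      by (intro emeasure_subadditive_countably) auto
    also have "\<dots> \<le> (\<Sum>i. ennreal ((1/2) ^ j) * emeasure lebesgue (R i))"
      using Z(3) by (intro suminf_le) auto
    also have "\<dots> = ennreal ((1/2) ^ j) * (\<Sum>i. emeasure lebesgue (R i))" by (rule ennreal_suminf_cmult)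
    also have "(\<Sum>i. emeasure lebesgue (R i)) = emeasure lebesgue U"
      unfolding U_def by (rule suminf_emeasure) (use R(3) in auto)
    also have "ennreal ((1/2) ^ j) * emeasure lebesgue U \<le> ennreal ((1/2) ^ j) * ennreal (measure lebesgue P / 2)"
      using R(5) unfolding U_def by (rule mult_left_mono) simp
    also have "\<dots> = ennreal ((1/2) ^ Suc j * measure lebesgue P)"
      by (simp flip: ennreal_mult)
    also have "\<dots> = ennreal ((1/2) ^ Suc j) * emeasure lebesgue P"
      unfolding emeasure_eq_measure2[OF Pl] by (rule ennreal_mult) auto
    finally show ?thesis .
  qed
  have "(\<integral>\<^sup>+x\<in>P - (\<Union>i. Z i). h x \<partial>lebesgue)
      \<le> (\<integral>\<^sup>+x. ennreal (2 * a) * g x * indicator (P - U) x + h x * indicator (\<Union>i. R i - Z i) x \<partial>lebesgue)"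
  proof (intro nn_integral_mono)
    fix x
    show "h x * indicator (P - (\<Union>i. Z i)) x \<le> ennreal (2 * a) * g x * indicator (P - U) x + h x * indicator (\<Union>i. R i - Z i) x"
    proof (cases "x \<in> P - (\<Union>i. Z i)")
      case True
      show ?thesis
      proof (cases "x \<in> U")
        case False
        then have "x \<notin> E" using R(4) by (auto simp: U_def)
        then have "norm (F x - c) + a \<le> 2 * a" using True by (simp add: E_def)
        then have "h x \<le> ennreal (2 * a) * g x" unfolding h_def by (intro mult_right_mono ennreal_leI) auto
        then show ?thesis using True False by (simp add: add_increasing2)
      next
        case xU: True
        then have "x \<in> (\<Union>i. R i - Z i)" using True by (auto simp: U_def)
        then show ?thesis using True xU by simp
      qed
    qed simp
  qed
  also have "\<dots> = (\<integral>\<^sup>+x\<in>P - U. ennreal (2 * a) * g x \<partial>lebesgue) + (\<integral>\<^sup>+x\<in>(\<Union>i. R i - Z i). h x \<partial>lebesgue)"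
    by (rule nn_integral_add) measurable
  also have "(\<integral>\<^sup>+x\<in>(\<Union>i. R i - Z i). h x \<partial>lebesgue) = (\<Sum>i. \<integral>\<^sup>+x\<in>R i - Z i. h x \<partial>lebesgue)"
    by (rule nn_integral_disjoint_family[OF _ _ disjZ]) measurable
  also have "\<dots> \<le> (\<Sum>i. \<integral>\<^sup>+x\<in>R i. ennreal (2 * a) * g x + 4 * W x \<partial>lebesgue)"
    using Z(4) by (intro suminf_le) auto
  also have "\<dots> = (\<integral>\<^sup>+x\<in>U. ennreal (2 * a) * g x + 4 * W x \<partial>lebesgue)"
    unfolding U_def by (rule nn_integral_disjoint_family[OF _ _ R(3), symmetric]) measurable
  also have "(\<integral>\<^sup>+x\<in>P - U. ennreal (2 * a) * g x \<partial>lebesgue) + (\<integral>\<^sup>+x\<in>U. ennreal (2 * a) * g x + 4 * W x \<partial>lebesgue)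
      = (\<integral>\<^sup>+x. ennreal (2 * a) * g x * indicator (P - U) x + (ennreal (2 * a) * g x + 4 * W x) * indicator U x \<partial>lebesgue)"
    by (rule nn_integral_add[symmetric]) measurable
  also have "\<dots> = (\<integral>\<^sup>+x. ennreal (2 * a) * (g x * indicator P x) + 4 * (W x * indicator U x) \<partial>lebesgue)"
    using UP by (intro nn_integral_cong) (auto simp: indicator_def)
  also have "\<dots> = ennreal (2 * a) * (\<integral>\<^sup>+x\<in>P. g x \<partial>lebesgue) + 4 * (\<integral>\<^sup>+x\<in>U. W x \<partial>lebesgue)"
    by (subst nn_integral_add) (auto simp: nn_integral_cmult)
  finally have bound: "(\<integral>\<^sup>+x\<in>P - (\<Union>i. Z i). h x \<partial>lebesgue)
      \<le> ennreal (2 * a) * (\<integral>\<^sup>+x\<in>P. g x \<partial>lebesgue) + 4 * (\<integral>\<^sup>+x\<in>U. W x \<partial>lebesgue)"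
    by (simp add: add_left_mono)
  define I where "I = (\<integral>\<^sup>+x\<in>P. g x \<partial>lebesgue)"
  define m where "m = measure lebesgue P"
  have m: "0 < m" "emeasure lebesgue P = ennreal m" using Ppos Pl by (auto simp: m_def emeasure_eq_measure2)
  have half: "ennreal (m / 2) \<le> emeasure lebesgue (P - U)"
  proof -
    have Ul: "U \<in> lmeasurable" by (rule fmeasurableI2[OF Pl UP]) measurable
    have PUl: "P - U \<in> lmeasurable" by (rule fmeasurableI2[OF Pl]) auto
    have "measure lebesgue U \<le> m / 2"
      using R(5) m(1) unfolding U_def[symmetric] emeasure_eq_measure2[OF Ul] m_def[symmetric] by simp
    moreover have "measure lebesgue (P - U) = m - measure lebesgue U"
      unfolding m_def by (rule measurable_measure_Diff[OF Pl _ UP]) measurable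
    ultimately show ?thesis unfolding emeasure_eq_measure2[OF PUl] by (intro ennreal_leI) simp
  qed
  have "ennreal a * I * ennreal (m / 2) \<le> ennreal a * I * emeasure lebesgue (P - U)"
    using half by (rule mult_left_mono) simp
  also have "\<dots> = (\<integral>\<^sup>+x\<in>P - U. ennreal a * I \<partial>lebesgue)"
    by (subst nn_integral_cmult_indicator) auto
  also have "\<dots> \<le> (\<integral>\<^sup>+x. W x * indicator (P - U) x * ennreal m \<partial>lebesgue)"
    using dom m by (intro nn_integral_mono) (auto simp: indicator_def I_def)
  also have "\<dots> = (\<integral>\<^sup>+x\<in>P - U. W x \<partial>lebesgue) * ennreal m"
    by (rule nn_integral_multc) measurable
  finally have "ennreal a * I * ennreal (m / 2) * ennreal (4 / m) \<le> (\<integral>\<^sup>+x\<in>P - U. W x \<partial>lebesgue) * ennreal m * ennreal (4 / m)"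
    by (rule mult_right_mono) simp
  moreover have "ennreal (m / 2) * ennreal (4 / m) = ennreal 2" "ennreal m * ennreal (4 / m) = ennreal 4"
    using m(1) by (simp_all flip: ennreal_mult)
  ultimately have "ennreal 2 * (ennreal a * I) \<le> ennreal 4 * (\<integral>\<^sup>+x\<in>P - U. W x \<partial>lebesgue)"
    by (simp only: mult.assoc) (simp only: mult.commute[of "ennreal 2"] mult.commute[of "ennreal 4"] mult.assoc)
  then have "ennreal (2 * a) * I \<le> 4 * (\<integral>\<^sup>+x\<in>P - U. W x \<partial>lebesgue)"
    using a by (simp add: ennreal_mult mult.assoc)
  then have "(\<integral>\<^sup>+x\<in>P - (\<Union>i. Z i). h x \<partial>lebesgue)
      \<le> 4 * (\<integral>\<^sup>+x\<in>P - U. W x \<partial>lebesgue) + 4 * (\<integral>\<^sup>+x\<in>U. W x \<partial>lebesgue)"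
    using bound unfolding I_def[symmetric] by (rule order_trans[OF _ add_right_mono, rotated])
  also have "\<dots> = 4 * ((\<integral>\<^sup>+x\<in>P - U. W x \<partial>lebesgue) + (\<integral>\<^sup>+x\<in>U. W x \<partial>lebesgue))"
    by (simp add: distrib_left)
  also have "\<dots> = 4 * (\<integral>\<^sup>+x\<in>(P - U) \<union> U. W x \<partial>lebesgue)"
    by (subst nn_integral_disjoint_pair) auto
  also have "(P - U) \<union> U = P" using UP by blast
  finally have fin: "(\<integral>\<^sup>+x\<in>P - (\<Union>i. Z i). h x \<partial>lebesgue) \<le> 4 * (\<integral>\<^sup>+x\<in>P. W x \<partial>lebesgue)" .
  show ?case
  proof (intro exI[of _ "\<Union>i. Z i"] conjI)
    show "(\<Union>i. Z i) \<in> sets lebesgue" by measurable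
    show "(\<Union>i. Z i) \<subseteq> P" using Z(2) R(2) by blast
  qed (use sizeZ fin in \<open>auto simp: h_def\<close>)
qed

text \<open>
  The exceptional sets of the successive rounds have summable measures.  By the Borel--Cantelli lemma
  almost every point avoids all but finitely many of them, and Fatou's lemma removes them.
\<close>

theorem oscillation_domination:
  assumes F[measurable]: "F \<in> borel_measurable lebesgue"
    and g[measurable]: "g \<in> borel_measurable lebesgue" and W[measurable]: "W \<in> borel_measurable lebesgue"
    and all: "\<And>P. P \<in> cubes \<Longrightarrow> \<exists>a c. admissible F g W P a c"
    and P: "P \<in> cubes" "admissible F g W P a c"
  shows "(\<integral>\<^sup>+x\<in>P. ennreal (norm (F x - c)) * g x \<partial>lebesgue) \<le> 4 * (\<integral>\<^sup>+x\<in>P. W x \<partial>lebesgue)"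
proof -
  have "0 \<le> a" using P(2) by (simp add: admissible_def)
  have Pl: "P \<in> lmeasurable" using P(1) by (rule cubes_lmeasurable)
  then have [measurable]: "P \<in> sets lebesgue" by auto
  have "\<exists>Z. Z \<in> sets lebesgue \<and> Z \<subseteq> P \<and> emeasure lebesgue Z \<le> ennreal ((1/2) ^ j) * emeasure lebesgue P
      \<and> (\<integral>\<^sup>+x\<in>P - Z. ennreal (norm (F x - c) + a) * g x \<partial>lebesgue) \<le> 4 * (\<integral>\<^sup>+x\<in>P. W x \<partial>lebesgue)" for j
    by (rule oscillation_stage[OF F g W all P])
  note ex = this
  from choice[OF allI[OF ex]] obtain Z where Zall: "\<forall>j. Z j \<in> sets lebesgue \<and> Z j \<subseteq> P
      \<and> emeasure lebesgue (Z j) \<le> ennreal ((1/2) ^ j) * emeasure lebesgue P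
      \<and> (\<integral>\<^sup>+x\<in>P - Z j. ennreal (norm (F x - c) + a) * g x \<partial>lebesgue) \<le> 4 * (\<integral>\<^sup>+x\<in>P. W x \<partial>lebesgue)"
    by (rule exE)
  then have Z: "Z j \<in> sets lebesgue" "Z j \<subseteq> P" "emeasure lebesgue (Z j) \<le> ennreal ((1/2) ^ j) * emeasure lebesgue P"
    "(\<integral>\<^sup>+x\<in>P - Z j. ennreal (norm (F x - c) + a) * g x \<partial>lebesgue) \<le> 4 * (\<integral>\<^sup>+x\<in>P. W x \<partial>lebesgue)" for j
    by blast+
  note Z(1)[measurable]
  have Zl: "Z j \<in> lmeasurable" for j using Z(1,2) Pl fmeasurableI2 by metis
  have le: "measure lebesgue (Z j) \<le> (1/2) ^ j * measure lebesgue P" for j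
    using Z(3)[of j] Zl[of j] Pl by (simp add: emeasure_eq_measure2 flip: ennreal_mult)
  have sm: "summable (\<lambda>j. (1/2) ^ j * measure lebesgue P)"
    by (intro summable_mult2 summable_geometric) simp
  have sZ: "summable (\<lambda>j. measure lebesgue (Z j))"
    by (rule summable_comparison_test'[OF sm, of 0]) (simp only: real_norm_def abs_of_nonneg[OF measure_nonneg] le)
  have AE: "AE x in lebesgue. eventually (\<lambda>j. x \<in> space lebesgue - Z j) sequentially"
  proof (rule borel_cantelli_AE1)
    show "emeasure lebesgue (Z j) < \<infinity>" for j
      using fmeasurableD2[OF Zl[of j]] by (simp add: less_top del: emeasure_completion)
  qed (use Z(1) sZ in auto)
  define h where "h j x = ennreal (norm (F x - c)) * g x * indicator (P - Z j) x" for j x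
  have [measurable]: "h j \<in> borel_measurable lebesgue" for j unfolding h_def by measurable
  have hle: "(\<integral>\<^sup>+x. h j x \<partial>lebesgue) \<le> 4 * (\<integral>\<^sup>+x\<in>P. W x \<partial>lebesgue)" for j
  proof -
    have "(\<integral>\<^sup>+x. h j x \<partial>lebesgue) \<le> (\<integral>\<^sup>+x\<in>P - Z j. ennreal (norm (F x - c) + a) * g x \<partial>lebesgue)"
      unfolding h_def using \<open>0 \<le> a\<close> by (intro nn_integral_mono mult_right_mono ennreal_leI) auto
    then show ?thesis using Z(4) by (rule order_trans)
  qed
  have "(\<integral>\<^sup>+x\<in>P. ennreal (norm (F x - c)) * g x \<partial>lebesgue) \<le> (\<integral>\<^sup>+x. liminf (\<lambda>j. h j x) \<partial>lebesgue)"
  proof (rule nn_integral_mono_AE)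
    show "AE x in lebesgue. ennreal (norm (F x - c)) * g x * indicator P x \<le> liminf (\<lambda>j. h j x)"
      using AE
    proof eventually_elim
      case (elim x)
      then have "eventually (\<lambda>j. h j x = ennreal (norm (F x - c)) * g x * indicator P x) sequentially"
        by eventually_elim (auto simp: h_def indicator_def)
      then show ?case by (intro Liminf_bounded) (auto elim: eventually_mono)
    qed
  qed
  also have "\<dots> \<le> liminf (\<lambda>j. \<integral>\<^sup>+x. h j x \<partial>lebesgue)" by (rule nn_integral_liminf) simp
  also have "\<dots> \<le> 4 * (\<integral>\<^sup>+x\<in>P. W x \<partial>lebesgue)"
    using hle by (intro order_trans[OF Liminf_le_Limsup] Limsup_bounded) auto
  finally show ?thesis .
qed

end

section \<open>Dyadic cubes\<close>

text \<open>
  The half-open cube of side \<open>L / 2\<^sup>k\<close> around \<open>x\<close>, in a grid with corner \<open>a\<close>.  As the class of an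
  equivalence relation it is determined by any of its points.
\<close>

definition dyadic_cube :: "real \<Rightarrow> real ^ 'n \<Rightarrow> nat \<Rightarrow> real ^ 'n \<Rightarrow> (real ^ 'n) set" where
  "dyadic_cube L a k x = {y. \<forall>i. \<lfloor>(y $ i - a $ i) * 2 ^ k / L\<rfloor> = \<lfloor>(x $ i - a $ i) * 2 ^ k / L\<rfloor>}"

lemma dyadic_cube_component:
  assumes "0 < L" "y \<in> dyadic_cube L a k x"
  shows "\<bar>y $ i - x $ i\<bar> < L / 2 ^ k"
proof -
  have "\<lfloor>(y $ i - a $ i) * 2 ^ k / L\<rfloor> = \<lfloor>(x $ i - a $ i) * 2 ^ k / L\<rfloor>"
    using assms by (simp add: dyadic_cube_def)
  then have "\<bar>(y $ i - a $ i) * 2 ^ k / L - (x $ i - a $ i) * 2 ^ k / L\<bar> < 1" by linarith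
  also have "(y $ i - a $ i) * 2 ^ k / L - (x $ i - a $ i) * 2 ^ k / L = (y $ i - x $ i) * (2 ^ k / L)"
    by (simp add: field_simps flip: diff_divide_distrib)
  finally have "\<bar>y $ i - x $ i\<bar> * (2 ^ k / L) < 1"
    using \<open>0 < L\<close> by (simp add: abs_mult)
  then show ?thesis using \<open>0 < L\<close> by (simp add: field_simps)
qed

lemma dyadic_cube_subset_ball:
  fixes x :: "real ^ 'n"
  assumes "0 < L"
  shows "dyadic_cube L a k x \<subseteq> ball x (real CARD('n) * L / 2 ^ k)"
proof
  fix y assume y: "y \<in> dyadic_cube L a k x"
  have "norm (y - x) \<le> (\<Sum>i\<in>UNIV. \<bar>(y - x) $ i\<bar>)" by (rule norm_le_l1_cart)
  also have "\<dots> < (\<Sum>i\<in>(UNIV::'n set). L / 2 ^ k)"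
    using dyadic_cube_component[OF assms y] by (intro sum_strict_mono) auto
  finally show "y \<in> ball x (real CARD('n) * L / 2 ^ k)" by (simp add: dist_norm norm_minus_commute)
qed

lemma dyadic_cube_measure:
  fixes x :: "real ^ 'n"
  assumes "0 < L"
  shows "dyadic_cube L a k x \<in> lmeasurable" "measure lebesgue (dyadic_cube L a k x) = (L / 2 ^ k) ^ CARD('n)"
proof -
  define h where "h = L / 2 ^ k"
  have "0 < h" using assms by (simp add: h_def)
  define l :: "real ^ 'n" where "l = (\<chi> i. a $ i + h * of_int \<lfloor>(x $ i - a $ i) * 2 ^ k / L\<rfloor>)"
  define u :: "real ^ 'n" where "u = (\<chi> i. l $ i + h)"
  have u: "u $ i = l $ i + h" for i by (simp add: u_def)
  have D: "dyadic_cube L a k x = {y. \<forall>i. l $ i \<le> y $ i \<and> y $ i < u $ i}"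
  proof -
    have "\<lfloor>(y - a $ i) * 2 ^ k / L\<rfloor> = \<lfloor>(x $ i - a $ i) * 2 ^ k / L\<rfloor> \<longleftrightarrow> l $ i \<le> y \<and> y < u $ i" for y i
      using assms unfolding u l_def floor_eq_iff by (simp add: h_def field_simps)
    then show ?thesis by (simp add: dyadic_cube_def)
  qed
  have "{y. \<forall>i. l $ i \<le> y $ i \<and> y $ i < u $ i} = (\<Inter>i. {y. l $ i \<le> y $ i}) \<inter> (\<Inter>i. {y. y $ i < u $ i})" by auto
  moreover have "closed (\<Inter>i. {y. l $ i \<le> y $ i})" by (intro closed_INT ballI closed_halfspace_component_ge_cart)
  moreover have "open (\<Inter>i. {y. y $ i < u $ i})" by (intro open_INT ballI open_halfspace_component_lt_cart) simp
  ultimately have sets: "dyadic_cube L a k x \<in> sets borel" unfolding D by (simp add: borel_closed borel_open)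
  have sub: "box l u \<subseteq> dyadic_cube L a k x" "dyadic_cube L a k x \<subseteq> cbox l u"
    unfolding D by (auto simp: mem_box_cart less_imp_le)
  have inner: "(u - l) \<bullet> b = h" if "b \<in> Basis" for b
    using that by (auto simp: Basis_vec_def inner_axis u_def)
  have le: "l \<bullet> b \<le> u \<bullet> b" if "b \<in> Basis" for b using inner[OF that] \<open>0 < h\<close> by (simp add: inner_diff_left)
  have "(\<Prod>b\<in>(Basis :: (real ^ 'n) set). (u - l) \<bullet> b) = (\<Prod>b\<in>(Basis :: (real ^ 'n) set). h)"
    using inner by (rule prod.cong[OF refl])
  also have "\<dots> = h ^ CARD('n)" by simp
  finally have pr: "(\<Prod>b\<in>(Basis :: (real ^ 'n) set). (u - l) \<bullet> b) = h ^ CARD('n)" .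
  have "emeasure lborel (box l u) = ennreal (h ^ CARD('n))" "emeasure lborel (cbox l u) = ennreal (h ^ CARD('n))"
    using emeasure_lborel_box[of l u] emeasure_lborel_cbox[of l u] le unfolding pr by auto
  moreover have "emeasure lborel (box l u) \<le> emeasure lborel (dyadic_cube L a k x)"
    "emeasure lborel (dyadic_cube L a k x) \<le> emeasure lborel (cbox l u)"
    using sub sets by (auto intro: emeasure_mono)
  ultimately have "emeasure lborel (dyadic_cube L a k x) = ennreal (h ^ CARD('n))" by simp
  then have em: "emeasure lebesgue (dyadic_cube L a k x) = ennreal (h ^ CARD('n))" using sets by simp
  then show "dyadic_cube L a k x \<in> lmeasurable" using sets by (intro fmeasurableI) auto
  show "measure lebesgue (dyadic_cube L a k x) = (L / 2 ^ k) ^ CARD('n)"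
    using em \<open>0 < h\<close> by (simp only: measure_def) (simp add: h_def)
qed

lemma nested_grid_dyadic_cube:
  fixes a :: "real ^ 'n"
  assumes "0 < L"
  shows "nested_grid (dyadic_cube L a) (2 ^ CARD('n))"
proof
  fix k and x :: "real ^ 'n"
  show "x \<in> dyadic_cube L a k x" by (simp add: dyadic_cube_def)
  show "dyadic_cube L a k y = dyadic_cube L a k x" if "y \<in> dyadic_cube L a k x" for y
    using that by (simp add: dyadic_cube_def)
  show "dyadic_cube L a (Suc k) x \<subseteq> dyadic_cube L a k x"
  proof -
    have "\<lfloor>t * 2 ^ k / L\<rfloor> = \<lfloor>t * 2 ^ Suc k / L\<rfloor> div 2" for t
      using floor_divide_real_eq_div[of 2 "t * 2 ^ Suc k / L"] by (simp add: field_simps)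
    then show ?thesis unfolding dyadic_cube_def by auto
  qed
  show "dyadic_cube L a k x \<in> lmeasurable" by (rule dyadic_cube_measure[OF assms])
  show "0 < measure lebesgue (dyadic_cube L a k x)" using assms by (simp add: dyadic_cube_measure)
  show "measure lebesgue (dyadic_cube L a k x) \<le> 2 ^ CARD('n) * measure lebesgue (dyadic_cube L a (Suc k) x)"
    using assms by (simp add: dyadic_cube_measure flip: power_mult_distrib)
  show "countable (range (dyadic_cube L a k))"
  proof -
    have "range (dyadic_cube L a k) \<subseteq> range (\<lambda>z :: 'n \<Rightarrow> int. {y. \<forall>i. \<lfloor>(y $ i - a $ i) * 2 ^ k / L\<rfloor> = z i})"
    proof
      fix D assume "D \<in> range (dyadic_cube L a k)"
      then obtain x where "D = dyadic_cube L a k x" by auto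
      then show "D \<in> range (\<lambda>z :: 'n \<Rightarrow> int. {y. \<forall>i. \<lfloor>(y $ i - a $ i) * 2 ^ k / L\<rfloor> = z i})"
        by (intro image_eqI[of _ _ "\<lambda>i. \<lfloor>(x $ i - a $ i) * 2 ^ k / L\<rfloor>"]) (auto simp: dyadic_cube_def)
    qed
    then show ?thesis by (rule countable_subset) (intro countable_image countableI_type)
  qed
  show "\<exists>k. dyadic_cube L a k x \<subseteq> U" if U: "open U" "x \<in> U" for U
  proof -
    obtain e where e: "0 < e" "ball x e \<subseteq> U" using \<open>open U\<close> \<open>x \<in> U\<close> by (meson openE)
    obtain k where "real CARD('n) * L / e < 2 ^ k" using real_arch_pow[of 2] by fastforce
    then have "real CARD('n) * L / 2 ^ k < e" using e(1) by (simp add: field_simps)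
    then have "ball x (real CARD('n) * L / 2 ^ k) \<subseteq> ball x e" by (intro subset_ball) simp
    then show ?thesis using dyadic_cube_subset_ball[OF assms, of a k x] e(2) by blast
  qed
qed

section \<open>Oscillation of Calderon--Zygmund operators\<close>

context
  fixes K :: "real ^ 'n \<Rightarrow> real ^ 'n \<Rightarrow> complex" and T
  assumes cz: "calderon_zygmund_operator K T"
begin

lemma cz_weak_type:
  obtains B :: real where "0 < B"
    "\<And>f. f \<in> L1 \<Longrightarrow> T f \<in> borel_measurable lebesgue"
    "\<And>f s. f \<in> L1 \<Longrightarrow> 0 < s \<Longrightarrow> emeasure lebesgue {x. s < norm (T f x)} \<le> ennreal (B * L1_norm f / s)"
proof -
  have "\<exists>A. \<forall>f\<in>L1. T f \<in> borel_measurable lebesgue \<and>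
        (\<forall>s>0. emeasure lebesgue {x. norm (T f x) > s} \<le> ennreal (A * L1_norm f / s))"
    using cz unfolding calderon_zygmund_operator_def by (elim conjE)
  then obtain A :: real where A: "\<forall>f\<in>L1. T f \<in> borel_measurable lebesgue \<and>
        (\<forall>s>0. emeasure lebesgue {x. norm (T f x) > s} \<le> ennreal (A * L1_norm f / s))"
    by (rule exE)
  show thesis
  proof (rule that[of "max A 1"])
    fix f :: "real ^ 'n \<Rightarrow> complex" and s :: real assume f: "f \<in> L1" and s: "0 < s"
    have "0 \<le> L1_norm f" by (simp add: L1_norm_def)
    then have "A * L1_norm f / s \<le> max A 1 * L1_norm f / s"
      using s by (intro divide_right_mono mult_right_mono) auto
    then show "emeasure lebesgue {x. s < norm (T f x)} \<le> ennreal (max A 1 * L1_norm f / s)"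
      using A[rule_format, OF f] s by (meson ennreal_leI order_trans)
  qed (use A in auto)
qed

lemma cz_add:
  assumes "f \<in> L1" "g \<in> L1"
  shows "AE x in lebesgue. T (\<lambda>y. f y + g y) x = T f x + T g x"
proof -
  have "\<forall>f\<in>L1. \<forall>g\<in>L1. \<forall>a b. AE x in lebesgue. T (\<lambda>y. a * f y + b * g y) x = a * T f x + b * T g x"
    using cz by (simp add: calderon_zygmund_operator_def ae_linear_on_def)
  from this[rule_format, OF assms, of 1 1] show ?thesis by simp
qed

lemma cz_scale:
  assumes "f \<in> L1"
  shows "AE x in lebesgue. T (\<lambda>y. a * f y) x = a * T f x"
proof -
  have "\<forall>f\<in>L1. \<forall>g\<in>L1. \<forall>a b. AE x in lebesgue. T (\<lambda>y. a * f y + b * g y) x = a * T f x + b * T g x"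
    using cz by (simp add: calderon_zygmund_operator_def ae_linear_on_def)
  from this[rule_format, OF assms assms, of a 0] show ?thesis by simp
qed

lemma kernel_bounds:
  obtains C \<sigma> :: real where "0 < C" "0 < \<sigma>"
    "\<And>x y. x \<noteq> y \<Longrightarrow> norm (K x y) \<le> C * norm (x - y) powr (- real CARD('n))"
    "\<And>x \<xi> y. norm (x - y) > 2 * norm (x - \<xi>) \<Longrightarrow>
           norm (K x y - K \<xi> y) \<le> C * norm (x - \<xi>) powr \<sigma> / norm (x - y) powr (real CARD('n) + \<sigma>)"
proof -
  have "standard_kernel K" using cz by (simp add: calderon_zygmund_operator_def)
  then show thesis unfolding standard_kernel_def using that by blast
qed

lemma kernel_measurable: "(\<lambda>y. K x y) \<in> borel_measurable lebesgue"
proof -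
  have "continuous_on {(x, y). x \<noteq> y} (\<lambda>(x, y). K x y)"
    using cz by (simp add: calderon_zygmund_operator_def standard_kernel_def)
  then have "continuous_on (- {x}) (\<lambda>y. (\<lambda>(x, y). K x y) (x, y))"
    by (rule continuous_on_compose2) (auto intro!: continuous_intros)
  then have "continuous_on (- {x}) (\<lambda>y. K x y)" by simp
  then have "(\<lambda>y. if y \<in> - {x} then K x y else 0) \<in> borel_measurable borel"
    using borel_measurable_continuous_on_indicator[of "- {x}" "\<lambda>y. K x y"]
    by (simp add: indicator_def of_bool_def if_distrib[of "\<lambda>c. c *\<^sub>R _"] cong: if_cong)
  then have "(\<lambda>y. K x y) \<in> borel_measurable borel"
    by (rule measurable_discrete_difference[of _ borel borel "{x}"]) auto
  then show ?thesis by (intro measurable_completion) simp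
qed

text \<open>
  On the support of \<open>f\<close> the kernel is at most as large as at distance \<open>\<delta>\<close>.
\<close>

lemma kernel_times_integrable:
  assumes f: "f \<in> L1" and "0 < \<delta>" and off: "\<And>y. norm (x - y) < \<delta> \<Longrightarrow> f y = 0"
    and C: "0 < C" "\<And>x y. x \<noteq> y \<Longrightarrow> norm (K x y) \<le> C * norm (x - y) powr (- real CARD('n))"
  shows "integrable lebesgue (\<lambda>y. K x y * f y)"
    and "norm (\<integral>y. K x y * f y \<partial>lebesgue) \<le> C * \<delta> powr (- real CARD('n)) * L1_norm f"
proof -
  have fi: "integrable lebesgue f" using f by (simp add: L1_def)
  let ?c = "C * \<delta> powr (- real CARD('n))"
  have pw: "norm (K x y * f y) \<le> ?c * norm (f y)" for y
  proof (cases "norm (x - y) < \<delta>")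
    case False
    then have "x \<noteq> y" using \<open>0 < \<delta>\<close> by auto
    then have "norm (K x y) \<le> C * norm (x - y) powr (- real CARD('n))" by (rule C(2))
    also have "\<dots> \<le> ?c" using False C(1) \<open>0 < \<delta>\<close> by (intro mult_left_mono powr_mono2') auto
    finally show ?thesis by (simp add: norm_mult mult_right_mono)
  qed (use off C(1) in auto)
  have gi: "integrable lebesgue (\<lambda>y. ?c * norm (f y))" using fi by simp
  show i: "integrable lebesgue (\<lambda>y. K x y * f y)"
    using kernel_measurable[of x] fi pw C(1)
    by (intro Bochner_Integration.integrable_bound[OF gi]) auto
  have "norm (\<integral>y. K x y * f y \<partial>lebesgue) \<le> (\<integral>y. norm (K x y * f y) \<partial>lebesgue)" by (rule integral_norm_bound)
  also have "\<dots> \<le> (\<integral>y. ?c * norm (f y) \<partial>lebesgue)"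
    using i gi pw by (intro integral_mono) auto
  also have "\<dots> = ?c * L1_norm f" by (simp add: L1_norm_def)
  finally show "norm (\<integral>y. K x y * f y \<partial>lebesgue) \<le> ?c * L1_norm f" .
qed

text \<open>
  By definition the kernel representation holds for square integrable functions.  The truncations of
  \<open>f\<close> are bounded and integrable, hence square integrable, and they converge to \<open>f\<close> in the mean.  By
  the weak type bound and the Borel--Cantelli lemma their images converge to \<open>T f\<close> almost everywhere
  along a subsequence, and away from the support of \<open>f\<close> the integrals against the kernel converge as well.
\<close>

lemma L1_representation:
  assumes f: "f \<in> L1" and "0 < \<rho>" and off: "\<And>y. y \<in> ball z (2 * \<rho>) \<Longrightarrow> f y = 0"
  shows "AE x in lebesgue. x \<in> ball z \<rho> \<longrightarrow> T f x = (\<integral>y. K x y * f y \<partial>lebesgue)"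
proof -
  obtain B where B: "0 < B" "\<And>f. f \<in> L1 \<Longrightarrow> T f \<in> borel_measurable lebesgue"
    "\<And>f s. f \<in> L1 \<Longrightarrow> 0 < s \<Longrightarrow> emeasure lebesgue {x. s < norm (T f x)} \<le> ennreal (B * L1_norm f / s)"
    by (rule cz_weak_type) (rule that, assumption+)
  obtain C \<sigma> where C: "0 < C" "\<And>x y. x \<noteq> y \<Longrightarrow> norm (K x y) \<le> C * norm (x - y) powr (- real CARD('n))"
    by (rule kernel_bounds) (rule that, assumption+)
  have fi[simp, intro]: "integrable lebesgue f" using f by (simp add: L1_def)
  then have [measurable]: "f \<in> borel_measurable lebesgue" by (rule borel_measurable_integrable)
  define cut where "cut k y = (if norm (f y) \<le> real k then f y else 0)" for k y
  define d where "d k y = f y - cut k y" for k y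
  have [measurable]: "cut k \<in> borel_measurable lebesgue" for k unfolding cut_def by measurable
  have cut_i: "integrable lebesgue (cut k)" for k
    by (rule Bochner_Integration.integrable_bound[OF fi]) (auto simp: cut_def)
  then have cutL1: "cut k \<in> L1" for k by (simp add: L1_def)
  have dL1: "d k \<in> L1" for k unfolding L1_def d_def using cut_i by auto
  have cutL2: "cut k \<in> L2" for k
  proof -
    have "integrable lebesgue (\<lambda>y. real k * norm (f y))" by simp
    then have "integrable lebesgue (\<lambda>y. (norm (cut k y))\<^sup>2)"
      by (rule Bochner_Integration.integrable_bound)
         (auto simp: cut_def power2_eq_square intro!: mult_right_mono)
    then show ?thesis by (simp add: L2_def)
  qed
  have "(\<lambda>k. L1_norm (d k)) \<longlonglongrightarrow> (\<integral>y. 0 \<partial>(lebesgue :: (real ^ 'n) measure))"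
    unfolding L1_norm_def
  proof (rule integral_dominated_convergence[where w = "\<lambda>y. norm (f y)"])
    show "AE y in lebesgue. (\<lambda>k. norm (d k y)) \<longlonglongrightarrow> 0"
    proof (intro AE_I2)
      fix y
      obtain N :: nat where "norm (f y) \<le> real N" using real_arch_simple by blast
      then have "eventually (\<lambda>k. norm (d k y) = 0) sequentially"
        by (intro eventually_sequentiallyI[of N]) (auto simp: d_def cut_def)
      then show "(\<lambda>k. norm (d k y)) \<longlonglongrightarrow> 0" by (rule tendsto_eventually)
    qed
  qed (auto simp: d_def cut_def)
  then have d0: "(\<lambda>k. L1_norm (d k)) \<longlonglongrightarrow> 0" by simp
  have "\<exists>k. L1_norm (d k) \<le> (1/4) ^ j" for j
  proof -
    have "eventually (\<lambda>k. L1_norm (d k) < (1/4) ^ j) sequentially"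
      using d0 by (rule order_tendstoD) simp
    then show ?thesis by (meson eventually_happens less_imp_le sequentially_bot)
  qed
  then obtain k where k: "\<And>j. L1_norm (d (k j)) \<le> (1/4) ^ j" by metis
  define S where "S j = {x. (1/2) ^ j < norm (T (d (k j)) x)}" for j
  have [measurable]: "T (d j) \<in> borel_measurable lebesgue" for j using B(2)[OF dL1] .
  have S[measurable]: "S j \<in> sets lebesgue" for j
  proof -
    have "{x \<in> space lebesgue. (1/2) ^ j < norm (T (d (k j)) x)} \<in> sets lebesgue" by measurable
    then show ?thesis by (simp add: S_def)
  qed
  have emS: "emeasure lebesgue (S j) \<le> ennreal (B * (1/2) ^ j)" for j
  proof -
    have "emeasure lebesgue (S j) \<le> ennreal (B * L1_norm (d (k j)) / (1/2) ^ j)"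
      unfolding S_def by (rule B(3)[OF dL1]) simp
    also have "\<dots> \<le> ennreal (B * (1/4) ^ j / (1/2) ^ j)"
      using k B(1) by (intro ennreal_leI divide_right_mono mult_left_mono) auto
    also have "B * (1/4) ^ j / (1/2) ^ j = B * (1/2) ^ j"
      by (simp add: field_simps flip: power_mult_distrib)
    finally show ?thesis .
  qed
  have finS: "emeasure lebesgue (S j) < \<infinity>" for j
    using emS[of j] by (rule order_le_less_trans) simp
  have leS: "measure lebesgue (S j) \<le> B * (1/2) ^ j" for j
    using emS[of j] B(1) unfolding measure_def by (intro enn2real_leI) auto
  have sm: "summable (\<lambda>j. B * (1/2) ^ j)" by (intro summable_mult summable_geometric) simp
  have sS: "summable (\<lambda>j. measure lebesgue (S j))"
    by (rule summable_comparison_test'[OF sm, of 0]) (simp only: real_norm_def abs_of_nonneg[OF measure_nonneg] leS)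
  have AE1: "AE x in lebesgue. eventually (\<lambda>j. x \<in> space lebesgue - S j) sequentially"
    by (rule borel_cantelli_AE1[OF S finS sS])
  have AE2: "AE x in lebesgue. \<forall>j. T f x = T (cut (k j)) x + T (d (k j)) x"
  proof (subst AE_all_countable, intro allI)
    fix j
    have "(\<lambda>y. cut (k j) y + d (k j) y) = f" by (simp add: d_def)
    then show "AE x in lebesgue. T f x = T (cut (k j)) x + T (d (k j)) x"
      using cz_add[OF cutL1 dL1, of "k j" "k j"] by simp
  qed
  have AE3: "AE x in lebesgue. \<forall>j. x \<in> ball z \<rho> \<longrightarrow> T (cut (k j)) x = (\<integral>y. K x y * cut (k j) y \<partial>lebesgue)"
  proof (subst AE_all_countable, intro allI)
    fix j
    have "{y. cut (k j) y \<noteq> 0} \<subseteq> - ball z (2 * \<rho>)" using off by (auto simp: cut_def)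
    then have "closure {y. cut (k j) y \<noteq> 0} \<subseteq> - ball z (2 * \<rho>)" by (intro closure_minimal) auto
    moreover have "ball z \<rho> \<subseteq> ball z (2 * \<rho>)" using \<open>0 < \<rho>\<close> by (intro subset_ball) simp
    ultimately have out: "x \<in> ball z \<rho> \<Longrightarrow> x \<notin> closure {y. cut (k j) y \<noteq> 0}" for x by blast
    have "AE x in lebesgue. x \<notin> closure {y. cut (k j) y \<noteq> 0} \<longrightarrow> T (cut (k j)) x = (\<integral>y. K x y * cut (k j) y \<partial>lebesgue)"
      using cz cutL2 by (simp add: calderon_zygmund_operator_def)
    then show "AE x in lebesgue. x \<in> ball z \<rho> \<longrightarrow> T (cut (k j)) x = (\<integral>y. K x y * cut (k j) y \<partial>lebesgue)"
      by eventually_elim (use out in blast)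
  qed
  show ?thesis using AE1 AE2 AE3
  proof eventually_elim
    case (elim x)
    note split = elim(2) and rep = elim(3)
    show ?case
    proof
      assume x: "x \<in> ball z \<rho>"
      have near: "y \<in> ball z (2 * \<rho>)" if "norm (x - y) < \<rho>" for y
        using x that dist_triangle[of z y x] by (simp add: dist_norm)
      have i: "integrable lebesgue (\<lambda>y. K x y * g y)" "norm (\<integral>y. K x y * g y \<partial>lebesgue) \<le> C * \<rho> powr (- real CARD('n)) * L1_norm g"
        if "g \<in> L1" "\<And>y. f y = 0 \<Longrightarrow> g y = 0" for g
        using kernel_times_integrable[of g \<rho> x C] that near off \<open>0 < \<rho>\<close> C by auto
      define c where "c = C * \<rho> powr (- real CARD('n))"
      have "0 \<le> c" using C by (simp add: c_def)
      have ev: "eventually (\<lambda>j. norm (T f x - (\<integral>y. K x y * f y \<partial>lebesgue)) \<le> (1/2) ^ j + c * (1/4) ^ j) sequentially"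
        using elim(1)
      proof eventually_elim
        case (elim j)
        have "(\<integral>y. K x y * f y \<partial>lebesgue) = (\<integral>y. K x y * cut (k j) y + K x y * d (k j) y \<partial>lebesgue)"
          by (simp add: d_def flip: distrib_left)
        also have "\<dots> = (\<integral>y. K x y * cut (k j) y \<partial>lebesgue) + (\<integral>y. K x y * d (k j) y \<partial>lebesgue)"
          by (intro Bochner_Integration.integral_add i cutL1 dL1) (auto simp: d_def cut_def)
        finally have "T f x - (\<integral>y. K x y * f y \<partial>lebesgue) = T (d (k j)) x - (\<integral>y. K x y * d (k j) y \<partial>lebesgue)"
          using split[rule_format, of j] rep[rule_format, OF x, of j] by simp
        also have "norm \<dots> \<le> norm (T (d (k j)) x) + norm (\<integral>y. K x y * d (k j) y \<partial>lebesgue)" by (rule norm_triangle_ineq4)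
        also have "\<dots> \<le> (1/2) ^ j + c * L1_norm (d (k j))"
          unfolding c_def using elim by (intro add_mono i dL1) (auto simp: S_def d_def cut_def)
        also have "\<dots> \<le> (1/2) ^ j + c * (1/4) ^ j" using k \<open>0 \<le> c\<close> by (intro add_left_mono mult_left_mono)
        finally show ?case .
      qed
      have lim: "(\<lambda>j. (1/2) ^ j + c * (1/4) ^ j) \<longlonglongrightarrow> 0 + c * 0"
        by (intro tendsto_intros) (auto intro: LIMSEQ_power_zero)
      have "norm (T f x - (\<integral>y. K x y * f y \<partial>lebesgue)) \<le> 0"
        using tendsto_lowerbound[OF lim ev] by simp
      then show "T f x = (\<integral>y. K x y * f y \<partial>lebesgue)" by simp
    qed
  qed
qed

text \<open>
  The image of the part of \<open>f\<close> in the fourfold ball is controlled by the weak type bound.  For the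
  remaining part, \<open>c\<close> is the value of its image at the centre \<open>z\<close>.  On the \<open>j\<close>-th dyadic annulus
  about \<open>z\<close> the smoothness of the kernel gains a factor \<open>2\<^bsup>-j\<sigma>\<^esup>\<close> over its size, while the average of \<open>|f|\<close>
  is at most \<open>\<beta>\<close>, and the resulting series is geometric.
\<close>

lemma cz_oscillation:
  assumes "0 < \<epsilon>"
  obtains A :: real where "0 < A"
    "\<And>f z \<rho> \<beta>. f \<in> L1 \<Longrightarrow> 0 < \<rho> \<Longrightarrow> 0 < \<beta> \<Longrightarrow>
       (\<And>m::nat. (\<integral>\<^sup>+y\<in>ball z (2 ^ m * \<rho>). ennreal (norm (f y)) \<partial>lebesgue)
                   \<le> ennreal \<beta> * emeasure lebesgue (ball z (2 ^ m * \<rho>))) \<Longrightarrow>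
       \<exists>c. measure lebesgue {x\<in>ball z \<rho>. A * \<beta> < norm (T f x - c)} \<le> \<epsilon> * measure lebesgue (ball z \<rho>)"
proof -
  obtain B where B: "0 < B" "\<And>f. f \<in> L1 \<Longrightarrow> T f \<in> borel_measurable lebesgue"
    "\<And>f s. f \<in> L1 \<Longrightarrow> 0 < s \<Longrightarrow> emeasure lebesgue {x. s < norm (T f x)} \<le> ennreal (B * L1_norm f / s)"
    by (rule cz_weak_type) (rule that, assumption+)
  obtain C \<sigma> where C: "0 < C" "0 < \<sigma>"
    and size: "\<And>x y. x \<noteq> y \<Longrightarrow> norm (K x y) \<le> C * norm (x - y) powr (- real CARD('n))"
    and smooth: "\<And>x \<xi> y. norm (x - y) > 2 * norm (x - \<xi>) \<Longrightarrow>
           norm (K x y - K \<xi> y) \<le> C * norm (x - \<xi>) powr \<sigma> / norm (x - y) powr (real CARD('n) + \<sigma>)"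
    by (rule kernel_bounds) (rule that, assumption+)
  define n where "n = CARD('n)"
  define v where "v = unit_ball_vol (real n)"
  have "0 < v" by (simp add: v_def)
  have vol: "emeasure lebesgue (ball z r) = ennreal (v * r ^ n)" "measure lebesgue (ball z r) = v * r ^ n"
    if "0 \<le> r" for z :: "real ^ 'n" and r
    using that by (simp_all add: emeasure_ball content_ball v_def n_def)
  define q where "q = 2 powr (- \<sigma>)"
  have q: "0 < q" "q < 1" using C(2) by (auto simp: q_def powr_less_one)
  define A1 where "A1 = B * 4 ^ n / \<epsilon>"
  define A2 where "A2 = C * v * 4 ^ n * (1 / (1 - q))"
  have "0 < A1" "0 < A2" using B(1) C(1) \<open>0 < v\<close> q \<open>0 < \<epsilon>\<close> by (auto simp: A1_def A2_def)
  show thesis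
  proof (rule that[of "A1 + A2"])
    show "0 < A1 + A2" using \<open>0 < A1\<close> \<open>0 < A2\<close> by simp
    fix f :: "real ^ 'n \<Rightarrow> complex" and z \<rho> \<beta>
    assume f: "f \<in> L1" and \<rho>: "0 < \<rho>" and \<beta>: "0 < \<beta>"
      and avg: "\<And>m::nat. (\<integral>\<^sup>+y\<in>ball z (2 ^ m * \<rho>). ennreal (norm (f y)) \<partial>lebesgue)
                   \<le> ennreal \<beta> * emeasure lebesgue (ball z (2 ^ m * \<rho>))"
    have fi: "integrable lebesgue f" using f by (simp add: L1_def)
    then have [measurable]: "f \<in> borel_measurable lebesgue" by (rule borel_measurable_integrable)
    have [measurable]: "ball z r \<in> sets lebesgue" for r by simp
    define f1 where "f1 y = (if y \<in> ball z (4 * \<rho>) then f y else 0)" for y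
    define f2 where "f2 y = f y - f1 y" for y
    have [measurable]: "f1 \<in> borel_measurable lebesgue" unfolding f1_def by measurable
    have f1i: "integrable lebesgue f1" by (rule Bochner_Integration.integrable_bound[OF fi]) (auto simp: f1_def)
    then have f1L1: "f1 \<in> L1" by (simp add: L1_def)
    have f2L1: "f2 \<in> L1" unfolding L1_def f2_def using fi f1i by auto
    have f2i: "integrable lebesgue f2" using f2L1 by (simp add: L1_def)
    then have [measurable]: "f2 \<in> borel_measurable lebesgue" by (rule borel_measurable_integrable)
    have f2_eq: "f2 y = (if y \<in> ball z (4 * \<rho>) then 0 else f y)" for y by (simp add: f2_def f1_def)
    have norm1: "L1_norm f1 \<le> \<beta> * (v * (4 * \<rho>) ^ n)"
    proof -
      have "ennreal (L1_norm f1) = (\<integral>\<^sup>+y. ennreal (norm (f1 y)) \<partial>lebesgue)"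
        unfolding L1_norm_def using f1i by (intro nn_integral_eq_integral[symmetric]) auto
      also have "\<dots> = (\<integral>\<^sup>+y\<in>ball z (2 ^ 2 * \<rho>). ennreal (norm (f y)) \<partial>lebesgue)"
        by (intro nn_integral_cong) (simp add: f1_def indicator_def)
      also have "\<dots> \<le> ennreal \<beta> * emeasure lebesgue (ball z (2 ^ 2 * \<rho>))" by (rule avg)
      also have "\<dots> = ennreal (\<beta> * (v * (4 * \<rho>) ^ n))"
        using \<rho> \<beta> \<open>0 < v\<close> by (subst vol) (auto simp: ennreal_mult)
      finally show ?thesis using \<rho> \<beta> \<open>0 < v\<close> by (subst (asm) ennreal_le_iff) auto
    qed
    define c where "c = (\<integral>y. K z y * f2 y \<partial>lebesgue)"
    have far: "norm ((\<integral>y. K x y * f2 y \<partial>lebesgue) - c) \<le> A2 * \<beta>" if x: "x \<in> ball z \<rho>" for x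
    proof -
      have zx: "norm (x - z) < \<rho>" using x by (simp add: dist_norm norm_minus_commute)
      have i: "integrable lebesgue (\<lambda>y. K w y * f2 y)" if "w \<in> ball z \<rho>" for w
      proof (rule kernel_times_integrable(1)[OF f2L1 \<rho> _ C(1) size])
        fix y assume "norm (w - y) < \<rho>"
        then have "y \<in> ball z (4 * \<rho>)"
          using that dist_triangle[of z y w] \<rho> by (simp add: dist_norm)
        then show "f2 y = 0" by (simp add: f2_eq)
      qed
      define k where "k j = C * \<rho> powr \<sigma> / (2 ^ j * \<rho>) powr (real n + \<sigma>)" for j :: nat
      have k0: "0 \<le> k j" for j using C by (simp add: k_def)
      have pw: "ennreal (norm (K x y * f2 y - K z y * f2 y))
          \<le> (\<Sum>j. ennreal (k j) * (ennreal (norm (f y)) * indicator (ball z (2 ^ (j + 2) * \<rho>)) y))" for y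
      proof (cases "y \<in> ball z (4 * \<rho>)")
        case False
        then have y4: "4 * \<rho> \<le> norm (y - z)" by (simp add: dist_norm norm_minus_commute)
        obtain j where j: "2 ^ j * (2 * \<rho>) \<le> norm (y - z)" "norm (y - z) < 2 ^ Suc j * (2 * \<rho>)"
          using dyadic_scale_right[of "2 * \<rho>" "norm (y - z)"] y4 \<rho> by auto
        then have j1: "norm (y - z) < 2 ^ (j + 2) * \<rho>" and j2: "2 ^ (j + 1) * \<rho> \<le> norm (y - z)" by auto
        have "norm (y - z) \<le> norm (x - y) + norm (x - z)"
          using norm_triangle_ineq4[of "x - z" "x - y"] by simp
        then have tri: "norm (y - z) - \<rho> < norm (x - y)" using zx by simp
        have "1 \<le> (2::real) ^ j" by simp
        then have "1 * \<rho> \<le> 2 ^ j * \<rho>" using \<rho> by (intro mult_right_mono) auto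
        then have dist: "2 ^ j * \<rho> \<le> norm (x - y)" using tri j2 by simp
        have "norm (K x y - K z y) \<le> C * norm (x - z) powr \<sigma> / norm (x - y) powr (real n + \<sigma>)"
          unfolding n_def using tri y4 zx \<rho> by (intro smooth) linarith
        also have "\<dots> \<le> C * \<rho> powr \<sigma> / (2 ^ j * \<rho>) powr (real n + \<sigma>)"
          using C zx \<rho> dist by (intro frac_le mult_left_mono powr_mono2) auto
        finally have "norm (K x y - K z y) \<le> k j" by (simp add: k_def)
        then have "norm (K x y * f2 y - K z y * f2 y) \<le> k j * norm (f y)"
          using False by (simp add: f2_eq mult_right_mono norm_mult flip: left_diff_distrib)
        then have "ennreal (norm (K x y * f2 y - K z y * f2 y)) \<le> ennreal (k j) * ennreal (norm (f y))"
          using k0 by (simp add: ennreal_leI flip: ennreal_mult)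
        also have "\<dots> = (\<Sum>i\<in>{j}. ennreal (k i) * (ennreal (norm (f y)) * indicator (ball z (2 ^ (i + 2) * \<rho>)) y))"
          using j1 by (simp add: dist_norm norm_minus_commute)
        also have "\<dots> \<le> (\<Sum>j. ennreal (k j) * (ennreal (norm (f y)) * indicator (ball z (2 ^ (j + 2) * \<rho>)) y))"
          by (rule sum_le_suminf) auto
        finally show ?thesis .
      qed (simp add: f2_eq)
      have ii: "integrable lebesgue (\<lambda>y. K x y * f2 y - K z y * f2 y)"
        using i[OF x] i[of z] \<rho> by auto
      have "(\<integral>y. K x y * f2 y \<partial>lebesgue) - c = (\<integral>y. K x y * f2 y - K z y * f2 y \<partial>lebesgue)"
        unfolding c_def using i[OF x] i[of z] \<rho> by (intro Bochner_Integration.integral_diff[symmetric]) auto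
      then have "ennreal (norm ((\<integral>y. K x y * f2 y \<partial>lebesgue) - c))
          \<le> (\<integral>\<^sup>+y. ennreal (norm (K x y * f2 y - K z y * f2 y)) \<partial>lebesgue)"
        using integral_norm_bound_ennreal[OF ii] by simp
      also have "\<dots> \<le> (\<integral>\<^sup>+y. (\<Sum>j. ennreal (k j) * (ennreal (norm (f y)) * indicator (ball z (2 ^ (j + 2) * \<rho>)) y)) \<partial>lebesgue)"
        by (intro nn_integral_mono pw)
      also have "\<dots> = (\<Sum>j. ennreal (k j) * (\<integral>\<^sup>+y\<in>ball z (2 ^ (j + 2) * \<rho>). ennreal (norm (f y)) \<partial>lebesgue))"
        by (simp add: nn_integral_suminf nn_integral_cmult)
      also have "\<dots> \<le> (\<Sum>j. ennreal (C * v * 4 ^ n * \<beta> * q ^ j))"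
      proof (intro suminf_le)
        fix j
        have "ennreal (k j) * (\<integral>\<^sup>+y\<in>ball z (2 ^ (j + 2) * \<rho>). ennreal (norm (f y)) \<partial>lebesgue)
          \<le> ennreal (k j) * (ennreal \<beta> * emeasure lebesgue (ball z (2 ^ (j + 2) * \<rho>)))"
          by (intro mult_left_mono avg) simp
        also have "\<dots> = ennreal (k j * (\<beta> * (v * (2 ^ (j + 2) * \<rho>) ^ n)))"
          using k0[of j] \<beta> \<rho> \<open>0 < v\<close> by (subst vol) (auto simp: ennreal_mult)
        also have "k j * (\<beta> * (v * (2 ^ (j + 2) * \<rho>) ^ n)) = C * v * 4 ^ n * \<beta> * q ^ j"
        proof -
          have "(2 ^ j * \<rho>) powr (real n + \<sigma>) = (2 ^ j * \<rho>) ^ n * ((2 ^ j) powr \<sigma> * \<rho> powr \<sigma>)"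
            using \<rho> by (simp add: powr_add powr_realpow powr_mult power_mult_distrib)
          moreover have "(2 ^ j) powr \<sigma> = 1 / q ^ j"
            by (simp add: q_def powr_powr powr_minus power_inverse divide_inverse mult.commute
                flip: powr_realpow)
          ultimately have kj: "k j = C * q ^ j / (2 ^ j * \<rho>) ^ n"
            using \<rho> q by (simp add: k_def)
          have "2 ^ (j + 2) * \<rho> = 4 * (2 ^ j * \<rho>)" by simp
          then have Y: "(2 ^ (j + 2) * \<rho>) ^ n = 4 ^ n * (2 ^ j * \<rho>) ^ n"
            by (simp only: power_mult_distrib)
          define X where "X = (2 ^ j * \<rho>) ^ n"
          have "0 < X" using \<rho> by (simp add: X_def)
          then show ?thesis unfolding kj Y X_def[symmetric] by simp
        qed
        finally show "ennreal (k j) * (\<integral>\<^sup>+y\<in>ball z (2 ^ (j + 2) * \<rho>). ennreal (norm (f y)) \<partial>lebesgue)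
          \<le> ennreal (C * v * 4 ^ n * \<beta> * q ^ j)" .
      qed auto
      also have "\<dots> = ennreal (C * v * 4 ^ n * \<beta> * (1 / (1 - q)))"
        using q C \<open>0 < v\<close> \<beta> by (intro suminf_ennreal_eq sums_mult geometric_sums) auto
      also have "C * v * 4 ^ n * \<beta> * (1 / (1 - q)) = A2 * \<beta>" by (simp add: A2_def)
      finally show ?thesis using \<open>0 < A2\<close> \<beta> by (subst (asm) ennreal_le_iff) auto
    qed
    have "AE x in lebesgue. x \<in> {x\<in>ball z \<rho>. (A1 + A2) * \<beta> < norm (T f x - c)} \<longrightarrow> x \<in> {x. A1 * \<beta> < norm (T f1 x)}"
    proof -
      have "f = (\<lambda>y. f1 y + f2 y)" by (simp add: f2_def)
      then have "AE x in lebesgue. T f x = T f1 x + T f2 x" using cz_add[OF f1L1 f2L1] by simp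
      moreover have "AE x in lebesgue. x \<in> ball z \<rho> \<longrightarrow> T f2 x = (\<integral>y. K x y * f2 y \<partial>lebesgue)"
        by (rule L1_representation[OF f2L1 \<rho>]) (use \<rho> in \<open>simp add: f2_eq\<close>)
      ultimately show ?thesis
      proof eventually_elim
        case (elim x)
        show ?case
        proof
          assume "x \<in> {x\<in>ball z \<rho>. (A1 + A2) * \<beta> < norm (T f x - c)}"
          then have x: "x \<in> ball z \<rho>" and big: "(A1 + A2) * \<beta> < norm (T f x - c)" by auto
          have "norm (T f x - c) \<le> norm (T f1 x) + norm (T f2 x - c)"
            using elim norm_triangle_ineq[of "T f1 x" "T f2 x - c"] by (simp add: add_diff_eq)
          also have "norm (T f2 x - c) \<le> A2 * \<beta>" using far[OF x] elim x by simp
          finally show "x \<in> {x. A1 * \<beta> < norm (T f1 x)}" using big by (simp add: distrib_right)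
        qed
      qed
    qed
    moreover have "{x. A1 * \<beta> < norm (T f1 x)} \<in> sets lebesgue"
    proof -
      have [measurable]: "T f1 \<in> borel_measurable lebesgue" by (rule B(2)[OF f1L1])
      have "{x \<in> space lebesgue. A1 * \<beta> < norm (T f1 x)} \<in> sets lebesgue" by measurable
      then show ?thesis by simp
    qed
    ultimately have "emeasure lebesgue {x\<in>ball z \<rho>. (A1 + A2) * \<beta> < norm (T f x - c)}
        \<le> emeasure lebesgue {x. A1 * \<beta> < norm (T f1 x)}"
      by (rule emeasure_mono_AE)
    also have "\<dots> \<le> ennreal (B * L1_norm f1 / (A1 * \<beta>))"
      using \<open>0 < A1\<close> \<beta> by (intro B(3)[OF f1L1]) simp
    also have "\<dots> \<le> ennreal (B * (\<beta> * (v * (4 * \<rho>) ^ n)) / (A1 * \<beta>))"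
      using norm1 B(1) \<open>0 < A1\<close> \<beta> by (intro ennreal_leI divide_right_mono mult_left_mono) auto
    also have "B * (\<beta> * (v * (4 * \<rho>) ^ n)) / (A1 * \<beta>) = \<epsilon> * (v * \<rho> ^ n)"
      using \<beta> B(1) \<open>0 < \<epsilon>\<close> by (simp add: A1_def power_mult_distrib)
    finally have em: "emeasure lebesgue {x\<in>ball z \<rho>. (A1 + A2) * \<beta> < norm (T f x - c)} \<le> ennreal (\<epsilon> * (v * \<rho> ^ n))" .
    have "0 \<le> \<epsilon> * (v * \<rho> ^ n)" using \<open>0 < \<epsilon>\<close> \<open>0 < v\<close> \<rho> by simp
    then have "measure lebesgue {x\<in>ball z \<rho>. (A1 + A2) * \<beta> < norm (T f x - c)} \<le> \<epsilon> * (v * \<rho> ^ n)"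
      unfolding measure_def using em by (rule enn2real_leI)
    then show "\<exists>c. measure lebesgue {x\<in>ball z \<rho>. (A1 + A2) * \<beta> < norm (T f x - c)} \<le> \<epsilon> * measure lebesgue (ball z \<rho>)"
      unfolding vol(2)[OF less_imp_le[OF \<rho>]] by (rule exI)
  qed
qed

end

section \<open>Calderon--Zygmund operators on variable exponent spaces\<close>

text \<open>
  According to whether \<open>b\<close> is smaller or larger than \<open>a\<^bsup>s-1\<^esup>\<close>, the product is at most the first or the
  second summand.
\<close>

lemma crude_young:
  fixes a b s :: real
  assumes "0 \<le> a" "0 \<le> b" "1 < s"
  shows "a * b \<le> a powr s + b powr (s / (s - 1))"
proof (cases "b \<le> a powr (s - 1)")
  case True
  then have "a * b \<le> a * a powr (s - 1)" using assms by (intro mult_left_mono)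
  also have "\<dots> = a powr s" using assms by (cases "a = 0") (auto simp: powr_mult_base)
  also have "\<dots> \<le> a powr s + b powr (s / (s - 1))" by simp
  finally show ?thesis .
next
  case False
  have "a = (a powr (s - 1)) powr (1 / (s - 1))" using assms by (simp add: powr_powr)
  also have "\<dots> \<le> b powr (1 / (s - 1))" using False assms by (intro powr_mono2) auto
  finally have "a * b \<le> b powr (1 / (s - 1)) * b" using assms by (intro mult_right_mono)
  also have "\<dots> = b powr (s / (s - 1))"
  proof -
    have "s / (s - 1) = 1 / (s - 1) + 1" using assms by (simp add: field_simps)
    then show ?thesis using assms by (cases "b = 0") (auto simp: powr_add)
  qed
  also have "\<dots> \<le> a powr s + b powr (s / (s - 1))" by simp
  finally show ?thesis .
qed

context log_holder_exponent
begin

text \<open>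
  Since \<open>u/(u-1) = 1 + 1/(u-1)\<close> and \<open>u - 1\<close> is bounded below by \<open>um - 1 > 0\<close>, the modulus of
  continuity changes by the factor \<open>1/(um-1)\<^sup>2\<close> at most.
\<close>

lemma conjugate_log_holder_exponent:
  assumes "\<Omega> \<noteq> {}"
  shows "log_holder_exponent \<Omega> (\<lambda>x. u x / (u x - 1)) (up / (up - 1)) (um / (um - 1)) (A / (um - 1)\<^sup>2)"
proof
  obtain x0 where "x0 \<in> \<Omega>" using assms by blast
  then have up: "um \<le> up" using exponent_ge exponent_le by (meson order_trans)
  show "\<Omega> \<in> sets lebesgue" "bounded \<Omega>" by (fact Omega_sets Omega_bounded)+
  have [measurable]: "u \<in> borel_measurable (lebesgue_on \<Omega>)" by (fact exponent_measurable)
  show "(\<lambda>x. u x / (u x - 1)) \<in> borel_measurable (lebesgue_on \<Omega>)" by measurable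
  show "1 < up / (up - 1)" using up exponent_gt_1 by (simp add: field_simps)
  show "0 < A / (um - 1)\<^sup>2" using log_holder_const exponent_gt_1 by simp
  fix x assume x: "x \<in> \<Omega>"
  note bx = exponent_gt_1'[OF x] exponent_ge[OF x] exponent_le[OF x]
  show "up / (up - 1) \<le> u x / (u x - 1)" using bx by (simp add: field_simps)
  show "u x / (u x - 1) \<le> um / (um - 1)" using bx exponent_gt_1 by (simp add: field_simps)
  fix y assume y: "y \<in> \<Omega>" and xy: "norm (x - y) \<le> 1/2"
  note by' = exponent_gt_1'[OF y] exponent_ge[OF y] exponent_le[OF y]
  have "u x / (u x - 1) - u y / (u y - 1) = (u y - u x) / ((u x - 1) * (u y - 1))"
    using bx by' by (simp add: field_simps)
  then have "\<bar>u x / (u x - 1) - u y / (u y - 1)\<bar> = \<bar>u x - u y\<bar> / ((u x - 1) * (u y - 1))"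
    using bx by' by (simp add: abs_mult abs_minus_commute)
  also have "\<dots> \<le> \<bar>u x - u y\<bar> / ((um - 1) * (um - 1))"
    using bx by' exponent_gt_1 by (intro divide_left_mono mult_mono) auto
  also have "\<dots> \<le> (A / (- ln (norm (x - y)))) / ((um - 1) * (um - 1))"
    using log_holder[OF x y xy] exponent_gt_1 by (intro divide_right_mono) auto
  finally show "\<bar>u x / (u x - 1) - u y / (u y - 1)\<bar> \<le> A / (um - 1)\<^sup>2 / (- ln (norm (x - y)))"
    by (simp add: power2_eq_square ac_simps)
qed

end

lemma log_holder_L1:
  fixes f :: "real ^ 'n \<Rightarrow> complex"
  assumes "log_holder_exponent \<Omega> u um up A" and f: "f \<in> borel_measurable lebesgue"
    and off: "\<And>x. x \<notin> \<Omega> \<Longrightarrow> f x = 0" and mod: "(\<integral>\<^sup>+x. ennreal (norm (f x) powr u x) \<partial>lebesgue) \<le> 1"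
  shows "f \<in> L1" "L1_norm f \<le> 1 + measure lebesgue \<Omega>"
    "(\<integral>\<^sup>+x. ennreal (norm (f x)) \<partial>lebesgue) \<le> ennreal (1 + measure lebesgue \<Omega>)"
proof -
  interpret log_holder_exponent \<Omega> u um up A by fact
  have [measurable]: "f \<in> borel_measurable lebesgue" by (fact f)
  have e: "emeasure lebesgue \<Omega> = ennreal (measure lebesgue \<Omega>)"
    using emeasure_Omega_finite by (intro emeasure_eq_ennreal_measure) auto
  have "(\<integral>\<^sup>+x. ennreal (norm (f x)) \<partial>lebesgue) \<le> (\<integral>\<^sup>+x. ennreal (norm (f x) powr u x) \<partial>lebesgue) + emeasure lebesgue \<Omega>"
    by (rule L1_le_modular) (use off in auto)
  also have "\<dots> \<le> 1 + ennreal (measure lebesgue \<Omega>)" unfolding e using mod by (rule add_right_mono)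
  also have "\<dots> = ennreal (1 + measure lebesgue \<Omega>)" by simp
  finally show le: "(\<integral>\<^sup>+x. ennreal (norm (f x)) \<partial>lebesgue) \<le> ennreal (1 + measure lebesgue \<Omega>)" .
  then have i: "integrable lebesgue f"
    by (intro integrableI_bounded) (auto simp: order_le_less_trans)
  then show "f \<in> L1" by (simp add: L1_def)
  have "ennreal (L1_norm f) = (\<integral>\<^sup>+x. ennreal (norm (f x)) \<partial>lebesgue)"
    unfolding L1_norm_def using i by (intro nn_integral_eq_integral[symmetric]) auto
  then have "ennreal (L1_norm f) \<le> ennreal (1 + measure lebesgue \<Omega>)" using le by simp
  then show "L1_norm f \<le> 1 + measure lebesgue \<Omega>"
    by (simp add: ennreal_le_iff add_nonneg_nonneg del: ennreal_plus)
qed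

text \<open>
  The domination theorem is applied on a dyadic grid whose top cube contains \<open>\<Omega>\<close>.  On a cube \<open>Q\<close> the
  oscillation of \<open>T f\<close> is measured by the largest average of \<open>|f|\<close> over the balls about \<open>Q\<close>.  If \<open>Q\<close> meets
  \<open>\<Omega>\<close> in a point \<open>y\<close>, Young's inequality with the exponents at \<open>y\<close> and the variable maximal inequality,
  for \<open>f\<close> with \<open>u\<close> and for \<open>g\<close> with the conjugate exponent, bound the product of the averages of \<open>|f|\<close> and
  \<open>g\<close>.  If \<open>Q\<close> does not meet \<open>\<Omega>\<close>, then \<open>g\<close> vanishes on it.  On the top cube the weak type bound makes 0
  an admissible constant, so that the conclusion concerns \<open>T f\<close> itself.
\<close>

theorem cz_pairing_bound:
  fixes T :: "(real ^ 'n \<Rightarrow> complex) \<Rightarrow> real ^ 'n \<Rightarrow> complex"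
  assumes cz: "calderon_zygmund_operator K T" and lh: "log_holder_exponent \<Omega> u um up A" and "\<Omega> \<noteq> {}"
  obtains D :: real where "0 < D"
    "\<And>f g. f \<in> borel_measurable lebesgue \<Longrightarrow> (\<And>x. x \<notin> \<Omega> \<Longrightarrow> f x = 0) \<Longrightarrow>
       (\<integral>\<^sup>+x. ennreal (norm (f x) powr u x) \<partial>lebesgue) \<le> 1 \<Longrightarrow>
       g \<in> borel_measurable lebesgue \<Longrightarrow> (\<And>x. 0 \<le> g x) \<Longrightarrow> (\<And>x. x \<notin> \<Omega> \<Longrightarrow> g x = 0) \<Longrightarrow>
       (\<integral>\<^sup>+x. ennreal (g x powr (u x / (u x - 1))) \<partial>lebesgue) \<le> 1 \<Longrightarrow>
       (\<integral>\<^sup>+x. ennreal (norm (T f x)) * ennreal (g x) \<partial>lebesgue) \<le> ennreal D"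
proof -
  interpret u: log_holder_exponent \<Omega> u um up A by fact
  define u' where "u' x = u x / (u x - 1)" for x
  define um' where "um' = up / (up - 1)"
  define up' where "up' = um / (um - 1)"
  define A' where "A' = A / (um - 1)\<^sup>2"
  have lh': "log_holder_exponent \<Omega> u' um' up' A'"
    using u.conjugate_log_holder_exponent[OF \<open>\<Omega> \<noteq> {}\<close>] by (simp add: u'_def[abs_def] um'_def up'_def A'_def)
  interpret u': log_holder_exponent \<Omega> u' um' up' A' by (fact lh')
  obtain x0 where x0: "x0 \<in> \<Omega>" using \<open>\<Omega> \<noteq> {}\<close> by blast
  define n where "n = CARD('n)"
  define v where "v = unit_ball_vol (real n)"
  have "0 < v" by (simp add: v_def)
  have "0 < n" by (simp add: n_def)
  have vol: "emeasure lebesgue (ball z r) = ennreal (v * r ^ n)" "measure lebesgue (ball z r) = v * r ^ n"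
    if "0 \<le> r" for z :: "real ^ 'n" and r
    using that by (simp_all add: emeasure_ball content_ball v_def n_def)
  obtain R where R: "0 < R" "\<And>x. x \<in> \<Omega> \<Longrightarrow> norm x < R"
    using u.Omega_bounded by (meson bounded_pos_less)
  define L where "L = 2 * R"
  have "0 < L" using R by (simp add: L_def)
  define a :: "real ^ 'n" where "a = (\<chi> i. - R)"
  define Q where "Q = dyadic_cube L a"
  define M :: real where "M = 2 ^ n"
  interpret G: nested_grid Q M
    unfolding Q_def M_def n_def by (rule nested_grid_dyadic_cube[OF \<open>0 < L\<close>])
  define P0 where "P0 = Q 0 x0"
  have P0: "P0 \<in> G.cubes" by (auto simp: P0_def G.cubes_def)
  have sub: "\<Omega> \<subseteq> P0"
  proof
    fix x assume x: "x \<in> \<Omega>"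
    have zero: "\<lfloor>(w $ i - a $ i) * 2 ^ 0 / L\<rfloor> = 0" if "w \<in> \<Omega>" for w i
    proof -
      have "\<bar>w $ i\<bar> \<le> norm w" by (rule component_le_norm_cart)
      then have "\<bar>w $ i\<bar> < R" using R(2)[OF that] by linarith
      then show ?thesis unfolding floor_eq_iff using \<open>0 < L\<close> by (simp add: a_def L_def field_simps) linarith
    qed
    show "x \<in> P0" unfolding P0_def Q_def dyadic_cube_def using zero[OF x] zero[OF x0] by simp
  qed
  define \<rho> where "\<rho> k = real n * (L / 2 ^ k)" for k :: nat
  have \<rho>: "0 < \<rho> k" for k using \<open>0 < L\<close> \<open>0 < n\<close> by (simp add: \<rho>_def)
  have Qball: "Q k x \<subseteq> ball x (\<rho> k)" for k x
    using dyadic_cube_subset_ball[OF \<open>0 < L\<close>, of a k x] by (simp add: Q_def \<rho>_def n_def)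
  have Qm: "measure lebesgue (Q k x) = (L / 2 ^ k) ^ n" for k x
    unfolding Q_def n_def by (rule dyadic_cube_measure[OF \<open>0 < L\<close>])
  have Qe: "emeasure lebesgue (Q k x) = ennreal ((L / 2 ^ k) ^ n)" for k x
    unfolding Qm[of k x, symmetric] by (rule emeasure_eq_measure2[OF G.cube_lmeasurable])
  define \<kappa> where "\<kappa> = v * real n ^ n"
  have "0 < \<kappa>" using \<open>0 < v\<close> \<open>0 < n\<close> by (simp add: \<kappa>_def)
  have volQ: "v * \<rho> k ^ n = \<kappa> * (L / 2 ^ k) ^ n" for k
    by (simp add: \<rho>_def \<kappa>_def power_mult_distrib power_divide)
  (* A cube is contained in a ball of kappa times its measure, which turns the fraction epsilon
     of the ball into the fraction 1/(8M) of the cube. *)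
  define \<epsilon> where "\<epsilon> = 1 / (8 * M * \<kappa>)"
  have "0 < M" by (simp add: M_def)
  have "0 < \<epsilon>" using \<open>0 < M\<close> \<open>0 < \<kappa>\<close> by (simp add: \<epsilon>_def)
  obtain c :: real where c: "0 < c" and osc:
    "\<And>f z \<rho> \<beta>. f \<in> L1 \<Longrightarrow> 0 < \<rho> \<Longrightarrow> 0 < \<beta> \<Longrightarrow>
       (\<And>m::nat. (\<integral>\<^sup>+y\<in>ball z (2 ^ m * \<rho>). ennreal (norm (f y)) \<partial>lebesgue)
                   \<le> ennreal \<beta> * emeasure lebesgue (ball z (2 ^ m * \<rho>))) \<Longrightarrow>
       \<exists>b. measure lebesgue {x\<in>ball z \<rho>. c * \<beta> < norm (T f x - b)} \<le> \<epsilon> * measure lebesgue (ball z \<rho>)"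
    by (rule cz_oscillation[OF cz \<open>0 < \<epsilon>\<close>]) blast
  obtain B where B: "0 < B" "\<And>f. f \<in> L1 \<Longrightarrow> T f \<in> borel_measurable lebesgue"
    "\<And>f s. f \<in> L1 \<Longrightarrow> 0 < s \<Longrightarrow> emeasure lebesgue {x. s < norm (T f x)} \<le> ennreal (B * L1_norm f / s)"
    by (rule cz_weak_type[OF cz]) (rule that, assumption+)
  obtain C1 :: real where C1: "0 < C1" and max1:
    "\<And>f. f \<in> borel_measurable lebesgue \<Longrightarrow> (\<And>x. 0 \<le> f x) \<Longrightarrow> (\<And>x. x \<notin> \<Omega> \<Longrightarrow> f x = 0) \<Longrightarrow>
      (\<integral>\<^sup>+x. ennreal (f x powr u x) \<partial>lebesgue) \<le> 1 \<Longrightarrow>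
      \<exists>W. u.dominates_averages C1 f W"
    by (rule u.variable_maximal_bound) blast
  obtain C2 :: real where C2: "0 < C2" and max2:
    "\<And>f. f \<in> borel_measurable lebesgue \<Longrightarrow> (\<And>x. 0 \<le> f x) \<Longrightarrow> (\<And>x. x \<notin> \<Omega> \<Longrightarrow> f x = 0) \<Longrightarrow>
      (\<integral>\<^sup>+x. ennreal (f x powr u' x) \<partial>lebesgue) \<le> 1 \<Longrightarrow>
      \<exists>W. u'.dominates_averages C2 f W"
    by (rule u'.variable_maximal_bound) blast
  define C0 where "C0 = 1 + measure lebesgue \<Omega>"
  have C0: "1 \<le> C0" by (simp add: C0_def)
  define m0 where "m0 = L ^ n"
  have m0: "0 < m0" "measure lebesgue P0 = m0" "emeasure lebesgue P0 = ennreal m0"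
    using \<open>0 < L\<close> Qm[of 0 x0] Qe[of 0 x0] by (auto simp: m0_def P0_def)
  (* By the weak type bound |T f| exceeds s on at most the fraction 1/(8M) of the top cube. *)
  define s where "s = 8 * M * B * C0 / m0"
  have "0 < s" using \<open>0 < M\<close> B(1) C0 m0(1) by (simp add: s_def)
  (* The integral of g is at most C0, so that k0 |P0| pays for s times this integral. *)
  define k0 where "k0 = s * C0 / m0"
  have "0 \<le> k0" using \<open>0 < s\<close> C0 m0(1) by (simp add: k0_def)
  define ck where "ck = c * \<kappa>"
  have "0 < ck" using c \<open>0 < \<kappa>\<close> by (simp add: ck_def)
  define D where "D = 4 * (ck * (C1 * (m0 + C1) + C2 * (m0 + C2)) + (1 + k0) * m0)"
  show thesis
  proof (rule that[of D])
    show "0 < D" using \<open>0 < ck\<close> C1 C2 m0(1) \<open>0 \<le> k0\<close> by (simp add: D_def add_pos_pos)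
    fix f :: "real ^ 'n \<Rightarrow> complex" and g :: "real ^ 'n \<Rightarrow> real"
    assume f[measurable]: "f \<in> borel_measurable lebesgue" and f_off: "\<And>x. x \<notin> \<Omega> \<Longrightarrow> f x = 0"
      and f_mod: "(\<integral>\<^sup>+x. ennreal (norm (f x) powr u x) \<partial>lebesgue) \<le> 1"
      and g[measurable]: "g \<in> borel_measurable lebesgue" and g0: "\<And>x. 0 \<le> g x" and g_off: "\<And>x. x \<notin> \<Omega> \<Longrightarrow> g x = 0"
      and g_mod: "(\<integral>\<^sup>+x. ennreal (g x powr (u x / (u x - 1))) \<partial>lebesgue) \<le> 1"
    have fL1: "f \<in> L1" and f_norm: "L1_norm f \<le> C0"
      and f_int: "(\<integral>\<^sup>+x. ennreal (norm (f x)) \<partial>lebesgue) \<le> ennreal C0"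
      using log_holder_L1[OF lh f f_off f_mod] by (auto simp: C0_def)
    have [measurable]: "T f \<in> borel_measurable lebesgue" by (rule B(2)[OF fL1])
    have g_int: "(\<integral>\<^sup>+x. ennreal (g x) \<partial>lebesgue) \<le> ennreal C0"
      using log_holder_L1(3)[OF lh', of "\<lambda>x. complex_of_real (g x)"] g_off g_mod g0
      by (simp add: C0_def u'_def)
    obtain W1 where W1[measurable]: "W1 \<in> borel_measurable lebesgue" and W1i: "(\<integral>\<^sup>+x. W1 x \<partial>lebesgue) \<le> ennreal C1"
      and W1: "\<And>z r b x y. x \<in> ball z r \<Longrightarrow> y \<in> ball z r \<inter> \<Omega> \<Longrightarrow> 0 \<le> b \<Longrightarrow>
             ennreal b * emeasure lebesgue (ball z r) \<le> (\<integral>\<^sup>+x\<in>ball z r. ennreal (norm (f x)) \<partial>lebesgue) \<Longrightarrow>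
             ennreal (b powr u y) \<le> ennreal C1 * (1 + W1 x)"
      using max1[of "\<lambda>x. norm (f x)"] f_off f_mod unfolding u.dominates_averages_def by auto
    obtain W2 where W2[measurable]: "W2 \<in> borel_measurable lebesgue" and W2i: "(\<integral>\<^sup>+x. W2 x \<partial>lebesgue) \<le> ennreal C2"
      and W2: "\<And>z r b x y. x \<in> ball z r \<Longrightarrow> y \<in> ball z r \<inter> \<Omega> \<Longrightarrow> 0 \<le> b \<Longrightarrow>
             ennreal b * emeasure lebesgue (ball z r) \<le> (\<integral>\<^sup>+x\<in>ball z r. ennreal (g x) \<partial>lebesgue) \<Longrightarrow>
             ennreal (b powr u' y) \<le> ennreal C2 * (1 + W2 x)"
      using max2[of g] g0 g_off g_mod unfolding u'.dominates_averages_def u'_def by auto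
    define W0 where "W0 x = ennreal C1 * (1 + W1 x) + ennreal C2 * (1 + W2 x)" for x
    define W where "W x = ennreal ck * W0 x + ennreal (1 + k0)" for x
    have [measurable]: "W0 \<in> borel_measurable lebesgue" "W \<in> borel_measurable lebesgue"
      unfolding W_def W0_def by measurable
    define J where "J P = (\<integral>\<^sup>+y\<in>P. ennreal (g y) \<partial>lebesgue)" for P
    have J_le: "J P \<le> ennreal C0" for P
      unfolding J_def by (rule order_trans[OF nn_integral_mono g_int]) (simp add: indicator_def)
    define avg where "avg k x m = (\<integral>\<^sup>+y\<in>ball x (2 ^ m * \<rho> k). ennreal (norm (f y)) \<partial>lebesgue) / ennreal (v * (2 ^ m * \<rho> k) ^ n)" for k x m
    have int_le: "(\<integral>\<^sup>+y\<in>S. ennreal (norm (f y)) \<partial>lebesgue) \<le> ennreal C0" for S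
      by (rule order_trans[OF nn_integral_mono f_int]) (simp add: indicator_def)
    have avg_mult: "avg k x m * ennreal (v * (2 ^ m * \<rho> k) ^ n) = (\<integral>\<^sup>+y\<in>ball x (2 ^ m * \<rho> k). ennreal (norm (f y)) \<partial>lebesgue)" for k x m
      unfolding avg_def ennreal_divide_times using \<open>0 < v\<close> \<rho>[of k] by (subst ennreal_divide_self) auto
    have avg_le: "avg k x m \<le> ennreal (C0 / (v * \<rho> k ^ n))" for k x m
    proof -
      have "1 * \<rho> k \<le> 2 ^ m * \<rho> k" using \<rho>[of k] by (intro mult_right_mono) auto
      then have "v * \<rho> k ^ n \<le> v * (2 ^ m * \<rho> k) ^ n"
        using \<open>0 < v\<close> \<rho>[of k] by (intro mult_left_mono power_mono) auto
      then have "C0 / (v * (2 ^ m * \<rho> k) ^ n) \<le> C0 / (v * \<rho> k ^ n)"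
        using \<open>0 < v\<close> \<rho>[of k] C0 by (intro divide_left_mono) auto
      moreover have "avg k x m \<le> ennreal C0 / ennreal (v * (2 ^ m * \<rho> k) ^ n)"
        unfolding avg_def by (intro divide_right_mono_ennreal int_le)
      moreover have "ennreal C0 / ennreal (v * (2 ^ m * \<rho> k) ^ n) = ennreal (C0 / (v * (2 ^ m * \<rho> k) ^ n))"
        using \<open>0 < v\<close> \<rho>[of k] C0 by (intro divide_ennreal) auto
      ultimately show ?thesis by (metis ennreal_leI order_trans)
    qed
    have key: "avg k x m * J (Q k x) \<le> ennreal \<kappa> * W0 w * emeasure lebesgue (Q k x)"
      if w: "w \<in> Q k x" for k x m w
    proof (cases "Q k x \<inter> \<Omega> = {}")
      case True
      then have "g y = 0" if "y \<in> Q k x" for y using g_off that by blast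
      then have "J (Q k x) = (\<integral>\<^sup>+y. 0 \<partial>(lebesgue :: (real ^ 'n) measure))"
        unfolding J_def by (intro nn_integral_cong) (auto simp: indicator_def)
      then show ?thesis by simp
    next
      case False
      then obtain y where y: "y \<in> Q k x" "y \<in> \<Omega>" by blast
      define r where "r = \<rho> k"
      have "0 < r" using \<rho> by (simp add: r_def)
      have "ball x r \<subseteq> ball x (2 ^ m * r)" using \<open>0 < r\<close> by (intro subset_ball) simp
      then have big: "w \<in> ball x (2 ^ m * r)" "y \<in> ball x (2 ^ m * r)" and small: "w \<in> ball x r" "y \<in> ball x r"
        using Qball[of k x] w y by (auto simp: r_def)
      obtain \<alpha> where \<alpha>: "0 \<le> \<alpha>" "avg k x m = ennreal \<alpha>"
        using avg_le[of k x m] by (cases "avg k x m") (auto simp: top_unique)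
      obtain j where j: "0 \<le> j" "J (ball x r) = ennreal j"
        using J_le[of "ball x r"] by (cases "J (ball x r)") (auto simp: top_unique)
      define \<gamma> where "\<gamma> = j / (v * r ^ n)"
      have \<gamma>: "0 \<le> \<gamma>" "ennreal \<gamma> * ennreal (v * r ^ n) = J (ball x r)"
        using j \<open>0 < r\<close> \<open>0 < v\<close> by (auto simp: \<gamma>_def simp flip: ennreal_mult)
      have "ennreal (\<alpha> powr u y) \<le> ennreal C1 * (1 + W1 w)"
        by (rule W1[OF big(1), of y]) (use big y \<alpha> avg_mult[of k x m] vol(1)[of "2 ^ m * r" x] \<open>0 < r\<close> in \<open>auto simp: r_def\<close>)
      moreover have "ennreal (\<gamma> powr u' y) \<le> ennreal C2 * (1 + W2 w)"
        by (rule W2[OF small(1), of y]) (use small y \<gamma> vol(1)[of r x] \<open>0 < r\<close> in \<open>auto simp: J_def\<close>)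
      moreover have "\<alpha> * \<gamma> \<le> \<alpha> powr u y + \<gamma> powr u' y"
        unfolding u'_def by (rule crude_young) (use \<alpha> \<gamma> u.exponent_gt_1'[OF y(2)] in auto)
      then have "ennreal (\<alpha> * \<gamma>) \<le> ennreal (\<alpha> powr u y) + ennreal (\<gamma> powr u' y)"
        by (simp add: ennreal_leI flip: ennreal_plus)
      ultimately have ag: "ennreal \<alpha> * ennreal \<gamma> \<le> W0 w"
        unfolding W0_def using \<alpha> \<gamma> by (simp add: ennreal_mult) (meson add_mono order_trans)
      have "J (Q k x) \<le> J (ball x r)"
        unfolding J_def r_def using Qball[of k x] by (intro nn_integral_mono) (auto simp: indicator_def)
      also have "\<dots> = ennreal \<gamma> * ennreal (\<kappa> * (L / 2 ^ k) ^ n)"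
        using \<gamma>(2) by (simp only: r_def volQ)
      also have "ennreal (\<kappa> * (L / 2 ^ k) ^ n) = ennreal \<kappa> * emeasure lebesgue (Q k x)"
        unfolding Qe using \<open>0 < \<kappa>\<close> \<open>0 < L\<close> by (intro ennreal_mult) auto
      finally have "avg k x m * J (Q k x) \<le> ennreal \<alpha> * (ennreal \<gamma> * (ennreal \<kappa> * emeasure lebesgue (Q k x)))"
        unfolding \<alpha>(2) by (rule mult_left_mono) simp
      also have "\<dots> = (ennreal \<alpha> * ennreal \<gamma>) * (ennreal \<kappa> * emeasure lebesgue (Q k x))" by (simp only: mult.assoc)
      also have "\<dots> \<le> W0 w * (ennreal \<kappa> * emeasure lebesgue (Q k x))" using ag by (rule mult_right_mono) simp
      finally show ?thesis by (simp only: ac_simps)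
    qed
    have dom_add: "ennreal (x + y) * J P \<le> W w * e"
      if "ennreal x * J P \<le> ennreal ck * W0 w * e" "ennreal y * J P \<le> ennreal (1 + k0) * e" "0 \<le> x" "0 \<le> y" for x y P w e
      using add_mono[OF that(1,2)] that(3,4) by (simp add: W_def distrib_right)
    have adm: "\<exists>a b. G.admissible (T f) (\<lambda>x. ennreal (g x)) W P a b" if Pc: "P \<in> G.cubes" for P
    proof -
      obtain k x where P: "P = Q k x" using Pc by (rule G.cubesE)
      define be where "be = (SUP m. avg k x m)"
      have "be \<le> ennreal (C0 / (v * \<rho> k ^ n))" unfolding be_def by (intro SUP_least avg_le)
      then obtain b0 where b0: "0 \<le> b0" "be = ennreal b0" by (cases be) (auto simp: top_unique)
      define mP where "mP = (L / 2 ^ k) ^ n"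
      have mP: "0 < mP" "measure lebesgue P = mP" "emeasure lebesgue P = ennreal mP"
        using \<open>0 < L\<close> by (auto simp: mP_def P Qm Qe)
      (* The oscillation bound needs a positive beta, but all averages of f may vanish.
         The cost of adding eta is at most |P|, which the constant part of W pays for. *)
      define \<eta> where "\<eta> = mP / (c * C0)"
      have "0 < \<eta>" using mP c C0 by (simp add: \<eta>_def)
      define \<beta> where "\<beta> = b0 + \<eta>"
      have "0 < \<beta>" using b0 \<open>0 < \<eta>\<close> by (simp add: \<beta>_def)
      have "\<exists>b. measure lebesgue {y\<in>ball x (\<rho> k). c * \<beta> < norm (T f y - b)} \<le> \<epsilon> * measure lebesgue (ball x (\<rho> k))"
      proof (rule osc[OF fL1 \<rho> \<open>0 < \<beta>\<close>])
        fix m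
        have "avg k x m \<le> ennreal \<beta>"
        proof -
          have "avg k x m \<le> ennreal b0" unfolding b0(2)[symmetric] be_def by (rule SUP_upper) simp
          also have "\<dots> \<le> ennreal \<beta>" using \<open>0 < \<eta>\<close> by (simp add: \<beta>_def ennreal_leI)
          finally show ?thesis .
        qed
        then show "(\<integral>\<^sup>+y\<in>ball x (2 ^ m * \<rho> k). ennreal (norm (f y)) \<partial>lebesgue)
            \<le> ennreal \<beta> * emeasure lebesgue (ball x (2 ^ m * \<rho> k))"
          unfolding avg_mult[symmetric] using \<rho>[of k] by (subst vol) (auto intro: mult_right_mono)
      qed
      then obtain b where b: "measure lebesgue {y\<in>ball x (\<rho> k). c * \<beta> < norm (T f y - b)} \<le> \<epsilon> * measure lebesgue (ball x (\<rho> k))"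
        by blast
      have "G.admissible (T f) (\<lambda>x. ennreal (g x)) W P (c * \<beta>) b"
        unfolding G.admissible_def
      proof (intro conjI ballI)
        show "0 \<le> c * \<beta>" using c \<open>0 < \<beta>\<close> by simp
        have bl: "ball x (\<rho> k) \<in> lmeasurable" by simp
        have [measurable]: "ball x (\<rho> k) \<in> sets lebesgue" "P \<in> sets lebesgue"
          using G.cubes_lmeasurable[OF Pc] by auto
        have S: "{y\<in>P. c * \<beta> < norm (T f y - b)} \<in> sets lebesgue" by measurable
        have S': "{y\<in>ball x (\<rho> k). c * \<beta> < norm (T f y - b)} \<in> sets lebesgue" by measurable
        have "{y\<in>ball x (\<rho> k). c * \<beta> < norm (T f y - b)} \<in> lmeasurable"
          by (rule fmeasurableI2[OF bl _ S']) blast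
        moreover have "{y\<in>P. c * \<beta> < norm (T f y - b)} \<subseteq> {y\<in>ball x (\<rho> k). c * \<beta> < norm (T f y - b)}"
          using Qball[of k x] P by blast
        ultimately have "measure lebesgue {y\<in>P. c * \<beta> < norm (T f y - b)} \<le> measure lebesgue {y\<in>ball x (\<rho> k). c * \<beta> < norm (T f y - b)}"
          using S by (intro measure_mono_fmeasurable)
        also note b
        also have "\<epsilon> * measure lebesgue (ball x (\<rho> k)) = measure lebesgue P / (8 * M)"
          using \<rho>[of k] \<open>0 < \<kappa>\<close> by (subst vol) (auto simp: volQ mP(2) mP_def \<epsilon>_def)
        finally show "measure lebesgue {y\<in>P. c * \<beta> < norm (T f y - b)} \<le> measure lebesgue P / (8 * M)" .
        fix w assume w: "w \<in> P"
        have "be * J P \<le> ennreal \<kappa> * W0 w * emeasure lebesgue P"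
          unfolding be_def SUP_mult_right_ennreal P using w by (intro SUP_least key) (simp add: P)
        then have "ennreal c * (ennreal b0 * J P) \<le> ennreal c * (ennreal \<kappa> * W0 w * emeasure lebesgue P)"
          unfolding b0(2) by (rule mult_left_mono) simp
        then have 1: "ennreal (c * b0) * J P \<le> ennreal ck * W0 w * emeasure lebesgue P"
          using c b0 \<open>0 < \<kappa>\<close> by (simp add: ck_def ennreal_mult mult.assoc)
        have "ennreal (c * \<eta>) * J P \<le> ennreal (c * \<eta>) * ennreal C0" by (intro mult_left_mono J_le) simp
        also have "\<dots> = ennreal mP" using c C0 mP(1) by (simp add: \<eta>_def flip: ennreal_mult)
        also have "\<dots> \<le> ennreal (1 + k0) * emeasure lebesgue P"
        proof -
          have "ennreal 1 * ennreal mP \<le> ennreal (1 + k0) * ennreal mP"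
            using \<open>0 \<le> k0\<close> by (intro mult_right_mono ennreal_leI) auto
          then show ?thesis unfolding mP(3) by simp
        qed
        finally have 2: "ennreal (c * \<eta>) * J P \<le> ennreal (1 + k0) * emeasure lebesgue P" .
        have "ennreal (c * \<beta>) * J P \<le> W w * emeasure lebesgue P"
          using dom_add[OF 1 2] c b0 \<open>0 < \<eta>\<close> by (simp add: \<beta>_def distrib_left)
        then show "ennreal (c * \<beta>) * (\<integral>\<^sup>+y\<in>P. ennreal (g y) \<partial>lebesgue) \<le> W w * emeasure lebesgue P"
          by (simp add: J_def)
      qed
      then show ?thesis by blast
    qed
    have adm0: "G.admissible (T f) (\<lambda>x. ennreal (g x)) W P0 s 0"
      unfolding G.admissible_def
    proof (intro conjI ballI)
      show "0 \<le> s" using \<open>0 < s\<close> by simp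
      have [measurable]: "P0 \<in> sets lebesgue" using G.cubes_lmeasurable[OF P0] by auto
      have "{x \<in> space lebesgue. s < norm (T f x)} \<in> sets lebesgue" by measurable
      then have "emeasure lebesgue {x\<in>P0. s < norm (T f x - 0)} \<le> emeasure lebesgue {x. s < norm (T f x)}"
        by (intro emeasure_mono) auto
      also have "\<dots> \<le> ennreal (B * L1_norm f / s)" by (rule B(3)[OF fL1 \<open>0 < s\<close>])
      also have "\<dots> \<le> ennreal (B * C0 / s)"
        using f_norm B(1) \<open>0 < s\<close> by (intro ennreal_leI divide_right_mono mult_left_mono) auto
      also have "B * C0 / s = measure lebesgue P0 / (8 * M)"
        using B(1) C0 m0(1) by (simp add: s_def m0(2))
      finally show "measure lebesgue {x\<in>P0. s < norm (T f x - 0)} \<le> measure lebesgue P0 / (8 * M)"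
        unfolding measure_def[of _ "{x\<in>P0. s < norm (T f x - 0)}"] using \<open>0 < M\<close> by (intro enn2real_leI) auto
      fix w assume w: "w \<in> P0"
      have "ennreal s * J P0 \<le> ennreal s * ennreal C0" by (intro mult_left_mono J_le) simp
      also have "\<dots> = ennreal (k0 * m0)" using \<open>0 < s\<close> C0 m0(1) by (simp add: k0_def flip: ennreal_mult)
      also have "\<dots> \<le> ennreal ((1 + k0) * m0)" using m0(1) by (intro ennreal_leI mult_right_mono) auto
      also have "\<dots> = ennreal (1 + k0) * emeasure lebesgue P0" unfolding m0(3) using m0(1) \<open>0 \<le> k0\<close> by (intro ennreal_mult) auto
      finally have 2: "ennreal s * J P0 \<le> ennreal (1 + k0) * emeasure lebesgue P0" .
      show "ennreal s * (\<integral>\<^sup>+y\<in>P0. ennreal (g y) \<partial>lebesgue) \<le> W w * emeasure lebesgue P0"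
        using dom_add[of 0 P0 w "emeasure lebesgue P0" s] 2 \<open>0 < s\<close> by (simp add: J_def)
    qed
    have gP: "g x = 0" if "x \<notin> P0" for x using sub g_off that by blast
    have "(\<integral>\<^sup>+x. ennreal (norm (T f x)) * ennreal (g x) \<partial>lebesgue)
        = (\<integral>\<^sup>+x\<in>P0. ennreal (norm (T f x - 0)) * ennreal (g x) \<partial>lebesgue)"
      by (intro nn_integral_cong) (auto simp: indicator_def gP)
    also have "\<dots> \<le> 4 * (\<integral>\<^sup>+x\<in>P0. W x \<partial>lebesgue)"
      by (rule G.oscillation_domination[OF _ _ _ adm P0 adm0]) measurable
    also have "(\<integral>\<^sup>+x\<in>P0. W x \<partial>lebesgue) \<le> ennreal (ck * (C1 * (m0 + C1) + C2 * (m0 + C2)) + (1 + k0) * m0)"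
    proof -
      have [measurable]: "P0 \<in> sets lebesgue" using G.cubes_lmeasurable[OF P0] by auto
      have V: "(\<integral>\<^sup>+x\<in>P0. 1 + V x \<partial>lebesgue) \<le> ennreal (m0 + d)"
        if [measurable]: "V \<in> borel_measurable lebesgue" and d: "(\<integral>\<^sup>+x. V x \<partial>lebesgue) \<le> ennreal d" "0 < d" for V d
      proof -
        have "(\<integral>\<^sup>+x\<in>P0. 1 + V x \<partial>lebesgue) \<le> (\<integral>\<^sup>+x. indicator P0 x + V x \<partial>lebesgue)"
          by (intro nn_integral_mono) (auto simp: indicator_def)
        also have "\<dots> = ennreal m0 + (\<integral>\<^sup>+x. V x \<partial>lebesgue)" by (subst nn_integral_add) (auto simp flip: m0(3))
        also have "\<dots> \<le> ennreal m0 + ennreal d" using d(1) by (rule add_left_mono)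
        finally show ?thesis using m0(1) d(2) by simp
      qed
      have "(\<integral>\<^sup>+x\<in>P0. W x \<partial>lebesgue) = (\<integral>\<^sup>+x. ennreal ck * (ennreal C1 * ((1 + W1 x) * indicator P0 x) + ennreal C2 * ((1 + W2 x) * indicator P0 x))
           + ennreal (1 + k0) * indicator P0 x \<partial>lebesgue)"
        by (intro nn_integral_cong) (simp add: W_def W0_def indicator_def)
      also have "\<dots> = ennreal ck * (ennreal C1 * (\<integral>\<^sup>+x\<in>P0. 1 + W1 x \<partial>lebesgue) + ennreal C2 * (\<integral>\<^sup>+x\<in>P0. 1 + W2 x \<partial>lebesgue))
           + ennreal (1 + k0) * ennreal m0"
      proof -
        define w1 where "w1 x = (1 + W1 x) * indicator P0 x" for x
        define w2 where "w2 x = (1 + W2 x) * indicator P0 x" for x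
        have [measurable]: "w1 \<in> borel_measurable lebesgue" "w2 \<in> borel_measurable lebesgue"
          unfolding w1_def w2_def by measurable
        have 1: "(\<integral>\<^sup>+x. ennreal ck * (ennreal C1 * w1 x + ennreal C2 * w2 x) + ennreal (1 + k0) * indicator P0 x \<partial>lebesgue)
            = (\<integral>\<^sup>+x. ennreal ck * (ennreal C1 * w1 x + ennreal C2 * w2 x) \<partial>lebesgue) + (\<integral>\<^sup>+x. ennreal (1 + k0) * indicator P0 x \<partial>lebesgue)"
          by (rule nn_integral_add) measurable
        have 2: "(\<integral>\<^sup>+x. ennreal ck * (ennreal C1 * w1 x + ennreal C2 * w2 x) \<partial>lebesgue)
            = ennreal ck * (\<integral>\<^sup>+x. ennreal C1 * w1 x + ennreal C2 * w2 x \<partial>lebesgue)"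
          by (rule nn_integral_cmult) measurable
        have 3: "(\<integral>\<^sup>+x. ennreal C1 * w1 x + ennreal C2 * w2 x \<partial>lebesgue)
            = (\<integral>\<^sup>+x. ennreal C1 * w1 x \<partial>lebesgue) + (\<integral>\<^sup>+x. ennreal C2 * w2 x \<partial>lebesgue)"
          by (rule nn_integral_add) measurable
        have 4: "(\<integral>\<^sup>+x. ennreal C1 * w1 x \<partial>lebesgue) = ennreal C1 * (\<integral>\<^sup>+x. w1 x \<partial>lebesgue)"
          "(\<integral>\<^sup>+x. ennreal C2 * w2 x \<partial>lebesgue) = ennreal C2 * (\<integral>\<^sup>+x. w2 x \<partial>lebesgue)"
          by (rule nn_integral_cmult; measurable)+
        have 5: "(\<integral>\<^sup>+x. ennreal (1 + k0) * indicator P0 x \<partial>lebesgue) = ennreal (1 + k0) * emeasure lebesgue P0"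
          by (rule nn_integral_cmult_indicator) measurable
        show ?thesis unfolding w1_def[symmetric] w2_def[symmetric] 1 2 3 4 5 m0(3) ..
      qed
      also have "\<dots> \<le> ennreal ck * (ennreal C1 * ennreal (m0 + C1) + ennreal C2 * ennreal (m0 + C2)) + ennreal (1 + k0) * ennreal m0"
        by (intro add_mono mult_left_mono V W1i W2i C1 C2 order_refl W1 W2) auto
      also have "\<dots> = ennreal (ck * (C1 * (m0 + C1) + C2 * (m0 + C2)) + (1 + k0) * m0)"
        using C1 C2 m0(1) \<open>0 < ck\<close> \<open>0 \<le> k0\<close>
        by (simp add: ennreal_mult[symmetric] ennreal_plus[symmetric] del: ennreal_plus)
      finally show ?thesis .
    qed
    also have "4 * ennreal (ck * (C1 * (m0 + C1) + C2 * (m0 + C2)) + (1 + k0) * m0) = ennreal D"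
      unfolding D_def using C1 C2 m0(1) \<open>0 < ck\<close> \<open>0 \<le> k0\<close>
      by (subst ennreal_mult) auto
    finally show "(\<integral>\<^sup>+x. ennreal (norm (T f x)) * ennreal (g x) \<partial>lebesgue) \<le> ennreal D"
      by (simp add: mult_left_mono)
  qed
qed

text \<open>
  Let \<open>h\<close> be a bounded truncation of \<open>|T f|\<close> and \<open>R > 1\<close> its modular, which is finite.  The function
  \<open>g = h\<^bsup>u-1\<^esup> R\<^bsup>-(u-1)/u\<^esup>\<close> has conjugate modular one, and \<open>h g\<close> is at least \<open>h\<^sup>u\<close> times
  \<open>R\<^bsup>-(up-1)/up\<^esup>\<close>.  So the pairing bound reads \<open>R\<^bsup>1/up\<^esup> \<le> D\<close>.  Fatou's lemma removes the truncation.
\<close>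

theorem cz_modular_bound:
  fixes T :: "(real ^ 'n \<Rightarrow> complex) \<Rightarrow> real ^ 'n \<Rightarrow> complex"
  assumes cz: "calderon_zygmund_operator K T" and lh: "log_holder_exponent \<Omega> u um up A" and "\<Omega> \<noteq> {}"
  obtains C :: real where "0 < C"
    "\<And>f. f \<in> borel_measurable lebesgue \<Longrightarrow> (\<And>x. x \<notin> \<Omega> \<Longrightarrow> f x = 0) \<Longrightarrow>
       (\<integral>\<^sup>+x. ennreal (norm (f x) powr u x) \<partial>lebesgue) \<le> 1 \<Longrightarrow>
       (\<integral>\<^sup>+x\<in>\<Omega>. ennreal (norm (T f x) powr u x) \<partial>lebesgue) \<le> ennreal C"
proof -
  interpret log_holder_exponent \<Omega> u um up A by fact
  obtain D :: real where D: "0 < D" and pairing: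
    "\<And>f g. f \<in> borel_measurable lebesgue \<Longrightarrow> (\<And>x. x \<notin> \<Omega> \<Longrightarrow> f x = 0) \<Longrightarrow>
       (\<integral>\<^sup>+x. ennreal (norm (f x) powr u x) \<partial>lebesgue) \<le> 1 \<Longrightarrow>
       g \<in> borel_measurable lebesgue \<Longrightarrow> (\<And>x. 0 \<le> g x) \<Longrightarrow> (\<And>x. x \<notin> \<Omega> \<Longrightarrow> g x = 0) \<Longrightarrow>
       (\<integral>\<^sup>+x. ennreal (g x powr (u x / (u x - 1))) \<partial>lebesgue) \<le> 1 \<Longrightarrow>
       (\<integral>\<^sup>+x. ennreal (norm (T f x)) * ennreal (g x) \<partial>lebesgue) \<le> ennreal D"
    by (rule cz_pairing_bound[OF cz lh \<open>\<Omega> \<noteq> {}\<close>]) blast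
  obtain B where B: "\<And>f. f \<in> L1 \<Longrightarrow> T f \<in> borel_measurable lebesgue"
    by (rule cz_weak_type[OF cz]) blast
  obtain x0 where x0: "x0 \<in> \<Omega>" using \<open>\<Omega> \<noteq> {}\<close> by blast
  have up: "1 < up" using exponent_gt_1'[OF x0] exponent_le[OF x0] by linarith
  define C where "C = max 1 (D powr up)"
  show thesis
  proof (rule that[of C])
    show "0 < C" by (simp add: C_def)
    fix f :: "real ^ 'n \<Rightarrow> complex"
    assume f[measurable]: "f \<in> borel_measurable lebesgue" and off: "\<And>x. x \<notin> \<Omega> \<Longrightarrow> f x = 0"
      and mod: "(\<integral>\<^sup>+x. ennreal (norm (f x) powr u x) \<partial>lebesgue) \<le> 1"
    have [measurable]: "T f \<in> borel_measurable lebesgue" using log_holder_L1[OF lh f off mod] B by auto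
    have [measurable]: "\<Omega> \<in> sets lebesgue" by (rule Omega_sets)
    define h where "h k x = (if x \<in> \<Omega> \<and> norm (T f x) \<le> real k then norm (T f x) else 0)" for k x
    have hm[measurable]: "h k \<in> borel_measurable lebesgue" for k unfolding h_def by measurable
    have h_off: "h k x = 0" if "x \<notin> \<Omega>" for k x using that by (simp add: h_def)
    have h0: "0 \<le> h k x" for k x by (simp add: h_def)
    have hu[measurable]: "(\<lambda>x. h k x powr u x) \<in> borel_measurable lebesgue" for k
      using measurable_powr_exponent[OF hm h_off, of "\<lambda>x. x"] by simp
    have bound: "(\<integral>\<^sup>+x. ennreal (h k x powr u x) \<partial>lebesgue) \<le> ennreal C" for k
    proof -
      have le: "h k x powr u x \<le> max 1 (real k) powr up * indicator \<Omega> x" for x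
      proof (cases "x \<in> \<Omega>")
        case True
        have "h k x powr u x \<le> max 1 (real k) powr u x"
          using h0 exponent_gt_1'[OF True] by (intro powr_mono2) (auto simp: h_def)
        also have "\<dots> \<le> max 1 (real k) powr up" using exponent_le[OF True] by (intro powr_mono) auto
        finally show ?thesis using True by simp
      qed (simp add: h_off)
      have "(\<integral>\<^sup>+x. ennreal (h k x powr u x) \<partial>lebesgue) \<le> (\<integral>\<^sup>+x. ennreal (max 1 (real k) powr up) * indicator \<Omega> x \<partial>lebesgue)"
      proof (intro nn_integral_mono)
        show "ennreal (h k x powr u x) \<le> ennreal (max 1 (real k) powr up) * indicator \<Omega> x" for x
          using ennreal_leI[OF le[of x]] by (cases "x \<in> \<Omega>") auto
      qed
      also have "\<dots> = ennreal (max 1 (real k) powr up) * emeasure lebesgue \<Omega>"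
        by (rule nn_integral_cmult_indicator) measurable
      also have "\<dots> < \<infinity>" using emeasure_Omega_finite by (simp add: ennreal_mult_less_top)
      finally obtain R where R: "0 \<le> R" "(\<integral>\<^sup>+x. ennreal (h k x powr u x) \<partial>lebesgue) = ennreal R"
        by (cases "(\<integral>\<^sup>+x. ennreal (h k x powr u x) \<partial>lebesgue)") auto
      have "R \<le> C"
      proof (cases "R \<le> 1")
        case False
        then have "1 < R" by simp
        define c where "c x = (indicator \<Omega> x * R) powr (- ((u x - 1) / u x))" for x
        define g where "g x = c x * h k x powr (u x - 1)" for x
        have "(\<lambda>x. indicator \<Omega> x * R) \<in> borel_measurable lebesgue" by measurable
        then have [measurable]: "c \<in> borel_measurable lebesgue"
          unfolding c_def by (rule measurable_powr_exponent[of _ "\<lambda>t. - ((t - 1) / t)"]) auto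
        have [measurable]: "(\<lambda>x. h k x powr (u x - 1)) \<in> borel_measurable lebesgue"
          by (rule measurable_powr_exponent[OF hm h_off, of "\<lambda>t. t - 1"]) auto
        have gm[measurable]: "g \<in> borel_measurable lebesgue" unfolding g_def by measurable
        have g_pow: "g x powr (u x / (u x - 1)) = h k x powr u x / R" for x
        proof (cases "x \<in> \<Omega>")
          case True
          have px: "1 < u x" by (rule exponent_gt_1'[OF True])
          have "g x powr (u x / (u x - 1)) = R powr (- ((u x - 1) / u x) * (u x / (u x - 1))) * h k x powr ((u x - 1) * (u x / (u x - 1)))"
            using True by (simp add: g_def c_def powr_mult powr_powr)
          also have "- ((u x - 1) / u x) * (u x / (u x - 1)) = -1" using px by (simp add: field_simps)
          also have "(u x - 1) * (u x / (u x - 1)) = u x" using px by simp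
          finally show ?thesis using \<open>1 < R\<close> by (simp add: powr_minus divide_inverse)
        qed (simp add: g_def c_def h_off)
        have g_mod: "(\<integral>\<^sup>+x. ennreal (g x powr (u x / (u x - 1))) \<partial>lebesgue) \<le> 1"
        proof -
          have "(\<integral>\<^sup>+x. ennreal (g x powr (u x / (u x - 1))) \<partial>lebesgue) = (\<integral>\<^sup>+x. ennreal (1 / R) * ennreal (h k x powr u x) \<partial>lebesgue)"
            unfolding g_pow using \<open>1 < R\<close> by (intro nn_integral_cong) (simp flip: ennreal_mult)
          also have "\<dots> = ennreal (1 / R) * ennreal R" unfolding R(2)[symmetric] by (rule nn_integral_cmult) measurable
          also have "\<dots> = 1" using \<open>1 < R\<close> by (simp flip: ennreal_mult)
          finally show ?thesis by simp
        qed
        have pw: "R powr (- ((up - 1) / up)) * h k x powr u x \<le> norm (T f x) * g x" for x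
        proof (cases "h k x = 0")
          case True
          then show ?thesis by (simp add: g_def c_def)
        next
          case False
          then have x: "x \<in> \<Omega>" and hT: "h k x = norm (T f x)" by (auto simp: h_def split: if_splits)
          have px: "1 < u x" "u x \<le> up" using exponent_gt_1'[OF x] exponent_le[OF x] by auto
          have "(u x - 1) / u x \<le> (up - 1) / up" using px up by (simp add: field_simps)
          then have "R powr (- ((up - 1) / up)) \<le> R powr (- ((u x - 1) / u x))" using \<open>1 < R\<close> by (intro powr_mono) auto
          also have "\<dots> = c x" using x by (simp add: c_def)
          finally have "R powr (- ((up - 1) / up)) * h k x powr u x \<le> c x * h k x powr u x" by (rule mult_right_mono) simp
          also have "\<dots> = h k x * g x"
          proof -
            have eq: "h k x powr u x = h k x * h k x powr (u x - 1)"
              using h0[of k x] False by (simp add: powr_mult_base)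
            show ?thesis unfolding g_def eq by (simp only: ac_simps)
          qed
          finally show ?thesis unfolding hT .
        qed
        have "ennreal (R powr (1 / up)) = ennreal (R powr (- ((up - 1) / up))) * ennreal R"
        proof -
          have "R powr (- ((up - 1) / up)) * R = R powr (- ((up - 1) / up) + 1)" unfolding powr_add using \<open>1 < R\<close> by simp
          also have "- ((up - 1) / up) + 1 = 1 / up" using up by (simp add: field_simps)
          finally show ?thesis using \<open>1 < R\<close> by (simp flip: ennreal_mult)
        qed
        also have "\<dots> = (\<integral>\<^sup>+x. ennreal (R powr (- ((up - 1) / up))) * ennreal (h k x powr u x) \<partial>lebesgue)"
          unfolding R(2)[symmetric] by (rule nn_integral_cmult[symmetric]) measurable
        also have "\<dots> \<le> (\<integral>\<^sup>+x. ennreal (norm (T f x)) * ennreal (g x) \<partial>lebesgue)"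
          using pw by (intro nn_integral_mono) (simp add: ennreal_leI g_def c_def flip: ennreal_mult)
        also have "\<dots> \<le> ennreal D"
          by (rule pairing[OF f off mod gm _ _ g_mod]) (auto simp: g_def c_def h_off)
        finally have "R powr (1 / up) \<le> D" using D by (simp add: ennreal_le_iff)
        then have "(R powr (1 / up)) powr up \<le> D powr up" using up by (intro powr_mono2) auto
        then show ?thesis using up \<open>1 < R\<close> by (simp add: powr_powr C_def)
      qed (simp add: C_def)
      then show ?thesis unfolding R(2) by (rule ennreal_leI)
    qed
    have "(\<integral>\<^sup>+x\<in>\<Omega>. ennreal (norm (T f x) powr u x) \<partial>lebesgue) \<le> (\<integral>\<^sup>+x. liminf (\<lambda>k. ennreal (h k x powr u x)) \<partial>lebesgue)"
    proof (intro nn_integral_mono)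
      fix x
      obtain N :: nat where N: "norm (T f x) \<le> real N" using real_arch_simple by blast
      have "eventually (\<lambda>k. ennreal (norm (T f x) powr u x) * indicator \<Omega> x \<le> ennreal (h k x powr u x)) sequentially"
        by (intro eventually_sequentiallyI[of N]) (use N in \<open>auto simp: h_def indicator_def\<close>)
      then show "ennreal (norm (T f x) powr u x) * indicator \<Omega> x \<le> liminf (\<lambda>k. ennreal (h k x powr u x))"
        by (rule Liminf_bounded)
    qed
    also have "\<dots> \<le> liminf (\<lambda>k. \<integral>\<^sup>+x. ennreal (h k x powr u x) \<partial>lebesgue)" by (rule nn_integral_liminf) measurable
    also have "\<dots> \<le> ennreal C"
      using bound by (intro order_trans[OF Liminf_le_Limsup] Limsup_bounded) auto
    finally show "(\<integral>\<^sup>+x\<in>\<Omega>. ennreal (norm (T f x) powr u x) \<partial>lebesgue) \<le> ennreal C" .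
  qed
qed

section \<open>Variable exponent estimates around a point\<close>

context log_holder_exponent
begin

text \<open>
  For \<open>t \<le> 1\<close> this is log-Hoelder continuity, for \<open>t \<ge> 1\<close> only the bounds of the exponent matter.
\<close>

lemma powr_exponent_diff_bounded:
  assumes "x \<in> \<Omega>" "y \<in> \<Omega>" "norm (x - y) \<le> t" "0 < t" "t \<le> S" "1 \<le> S" "\<bar>e\<bar> \<le> m"
  shows "t powr (e * (u x - u y)) \<le> osc_const powr m * S powr (m * (up - um))"
proof -
  define d where "d = u x - u y"
  have "0 \<le> m" using assms by linarith
  have d: "\<bar>d\<bar> \<le> up - um" using exponent_diff_le[OF assms(1,2)] by (simp add: d_def)
  have ed: "\<bar>e * d\<bar> \<le> m * \<bar>d\<bar>" using assms by (simp add: abs_mult mult_right_mono)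
  have o1: "1 \<le> osc_const powr m" using osc_const_ge_1 \<open>0 \<le> m\<close> by (simp add: ge_one_powr_ge_zero)
  have "0 \<le> m * (up - um)" using d \<open>0 \<le> m\<close> by simp
  then have s1: "1 \<le> S powr (m * (up - um))" using \<open>1 \<le> S\<close> by (simp add: ge_one_powr_ge_zero)
  have "t powr (e * d) \<le> osc_const powr m * S powr (m * (up - um))"
  proof (cases "t \<le> 1")
    case True
    have "t powr (e * d) \<le> t powr (- \<bar>d\<bar> * m)"
      using True \<open>0 < t\<close> ed by (intro powr_mono') (auto simp: mult.commute abs_le_iff)
    also have "\<dots> = (t powr (- \<bar>d\<bar>)) powr m" by (simp add: powr_powr)
    also have "\<dots> \<le> osc_const powr m"
      using powr_oscillation_le[OF assms(1-4)] \<open>0 \<le> m\<close> unfolding d_def by (intro powr_mono2) auto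
    also have "\<dots> = osc_const powr m * 1" by simp
    also have "\<dots> \<le> osc_const powr m * S powr (m * (up - um))" using s1 by (intro mult_left_mono) auto
    finally show ?thesis .
  next
    case False
    have "e * d \<le> m * \<bar>d\<bar>" using ed by linarith
    also have "\<dots> \<le> m * (up - um)" using d \<open>0 \<le> m\<close> by (intro mult_left_mono)
    finally have "t powr (e * d) \<le> t powr (m * (up - um))" using False by (intro powr_mono) auto
    also have "\<dots> \<le> S powr (m * (up - um))" using assms \<open>0 \<le> m * (up - um)\<close> by (intro powr_mono2) auto
    also have "\<dots> = 1 * S powr (m * (up - um))" by simp
    also have "\<dots> \<le> osc_const powr m * S powr (m * (up - um))" using o1 by (intro mult_right_mono) auto
    finally show ?thesis .
  qed
  then show ?thesis by (simp add: d_def)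
qed

text \<open>
  Put \<open>\<kappa> = n (1 - 1/u(x0))\<close> and \<open>s = |x - x0| \<ge> r\<close>.  The integrand equals
  \<open>(r/s)\<^bsup>\<kappa> u(x)\<^esup> s\<^bsup>-n u(x)/u(x0)\<^esup>\<close>.  Log-Hoelder continuity replaces the second factor by \<open>s\<^bsup>-n\<^esup>\<close>, whose
  integral over each dyadic annulus is bounded, and the first factor decays geometrically from annulus to annulus.
\<close>

lemma tail_modular_bounded:
  fixes x0 :: 'a
  assumes x0: "x0 \<in> \<Omega>"
  obtains C :: real where "0 < C"
    "\<And>r. 0 < r \<Longrightarrow> (\<integral>\<^sup>+x\<in>\<Omega> - ball x0 r. ennreal ((r powr (real DIM('a) * (1 - 1 / u x0))
        * norm (x - x0) powr (- real DIM('a))) powr u x) \<partial>lebesgue) \<le> ennreal C"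
proof -
  define n where "n = DIM('a)"
  define v where "v = unit_ball_vol (real n)"
  have "0 < v" by (simp add: v_def)
  have "0 < n" by (simp add: n_def)
  define \<kappa> where "\<kappa> = real n * (1 - 1 / u x0)"
  have p0: "1 < u x0" by (rule exponent_gt_1'[OF x0])
  have "0 < \<kappa>" using p0 \<open>0 < n\<close> by (simp add: \<kappa>_def)
  obtain S0 where S0: "\<And>x. x \<in> \<Omega> \<Longrightarrow> norm (x - x0) \<le> S0"
    using Omega_bounded x0 by (metis bounded_any_center dist_norm norm_minus_commute)
  define S where "S = max 1 S0"
  define K1 where "K1 = osc_const powr real n * S powr (real n * (up - um))"
  have "0 < K1" using osc_const_ge_1 by (simp add: K1_def S_def)
  have [measurable]: "ball x0 t \<in> sets lebesgue" for t by simp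
  define q where "q = 2 powr (- \<kappa>)"
  have q: "0 < q" "q < 1" using \<open>0 < \<kappa>\<close> by (auto simp: q_def powr_less_one)
  show thesis
  proof (rule that[of "K1 * v * 2 ^ n * (1 / (1 - q))"])
    show "0 < K1 * v * 2 ^ n * (1 / (1 - q))" using \<open>0 < K1\<close> \<open>0 < v\<close> q by simp
    fix r :: real assume r: "0 < r"
    define k where "k j = K1 * q ^ j / (2 ^ j * r) ^ n" for j :: nat
    have k0: "0 \<le> k j" for j using \<open>0 < K1\<close> q r by (simp add: k_def)
    have pw: "ennreal ((r powr \<kappa> * norm (x - x0) powr (- real n)) powr u x) * indicator (\<Omega> - ball x0 r) x
        \<le> (\<Sum>j. ennreal (k j) * indicator (ball x0 (2 ^ (j + 1) * r)) x)" for x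
    proof (cases "x \<in> \<Omega> - ball x0 r")
      case True
      define s where "s = norm (x - x0)"
      have x: "x \<in> \<Omega>" and s: "r \<le> s" using True by (auto simp: s_def dist_norm norm_minus_commute)
      obtain j where j2: "2 ^ j * r \<le> s" and "s < 2 ^ Suc j * r" using dyadic_scale_right[OF r s] by blast
      then have j1: "s < 2 ^ (j + 1) * r" by simp
      have "0 < s" using s r by simp
      have "r powr \<kappa> * s powr (- real n) = (r / s) powr \<kappa> * s powr (- (real n / u x0))"
      proof -
        have "s powr (- real n) = s powr (- \<kappa>) * s powr (- (real n / u x0))"
          unfolding powr_add[symmetric] by (simp add: \<kappa>_def algebra_simps)
        moreover have "(r / s) powr \<kappa> = r powr \<kappa> * s powr (- \<kappa>)"
          unfolding powr_divide powr_minus_divide by simp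
        ultimately show ?thesis by simp
      qed
      then have "(r powr \<kappa> * s powr (- real n)) powr u x
          = (r / s) powr (\<kappa> * u x) * s powr (- (real n / u x0) * u x)"
        using r \<open>0 < s\<close> by (simp add: powr_mult powr_powr)
      also have "s powr (- (real n / u x0) * u x) = s powr (- real n) * s powr (- (real n / u x0) * (u x - u x0))"
      proof -
        have e: "- (real n / u x0) * u x = - real n + - (real n / u x0) * (u x - u x0)"
          using p0 by (simp add: field_simps)
        show ?thesis by (subst e) (simp only: powr_add)
      qed
      also have "(r / s) powr (\<kappa> * u x) * (s powr (- real n) * s powr (- (real n / u x0) * (u x - u x0)))
          \<le> q ^ j * (1 / (2 ^ j * r) ^ n * K1)"
      proof (intro mult_mono)
        have "r / s \<le> 1" using s r \<open>0 < s\<close> by simp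
        moreover have "\<kappa> * 1 \<le> \<kappa> * u x" using exponent_gt_1'[OF x] \<open>0 < \<kappa>\<close> by (intro mult_left_mono) auto
        ultimately have "(r / s) powr (\<kappa> * u x) \<le> (r / s) powr \<kappa>"
          using r \<open>0 < s\<close> by (intro powr_mono') auto
        also have "\<dots> \<le> (1 / 2 ^ j) powr \<kappa>"
          using j2 r \<open>0 < s\<close> \<open>0 < \<kappa>\<close> by (intro powr_mono2) (auto simp: field_simps)
        also have "\<dots> = q ^ j"
        proof -
          have "(2 ^ j) powr \<kappa> = (2 powr \<kappa>) ^ j"
            by (simp add: powr_powr powr_power mult.commute flip: powr_realpow)
          then show ?thesis by (simp add: powr_divide q_def powr_minus_divide power_divide)
        qed
        finally show "(r / s) powr (\<kappa> * u x) \<le> q ^ j" .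
        have "s powr (- real n) = 1 / s ^ n" using \<open>0 < s\<close> by (simp add: powr_minus powr_realpow divide_inverse)
        also have "\<dots> \<le> 1 / (2 ^ j * r) ^ n"
          using j2 r \<open>0 < s\<close> by (intro divide_left_mono power_mono) auto
        finally show "s powr (- real n) \<le> 1 / (2 ^ j * r) ^ n" .
        show "s powr (- (real n / u x0) * (u x - u x0)) \<le> K1"
          unfolding K1_def
        proof (rule powr_exponent_diff_bounded[OF x x0])
          show "\<bar>- (real n / u x0)\<bar> \<le> real n"
            using p0 mult_left_mono[of 1 "u x0" "real n"] by (simp add: field_simps)
        qed (use S0[OF x] \<open>0 < s\<close> in \<open>auto simp: s_def S_def\<close>)
      qed (use q r in auto)
      also have "q ^ j * (1 / (2 ^ j * r) ^ n * K1) = k j" by (simp add: k_def)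
      finally have "ennreal ((r powr \<kappa> * norm (x - x0) powr (- real n)) powr u x) \<le> ennreal (k j)"
        unfolding s_def by (rule ennreal_leI)
      also have "\<dots> = (\<Sum>i\<in>{j}. ennreal (k i) * indicator (ball x0 (2 ^ (i + 1) * r)) x)"
        using j1 by (simp add: s_def dist_norm norm_minus_commute)
      also have "\<dots> \<le> (\<Sum>j. ennreal (k j) * indicator (ball x0 (2 ^ (j + 1) * r)) x)"
        by (rule sum_le_suminf) auto
      finally show ?thesis using True by simp
    qed simp
    have "(\<integral>\<^sup>+x\<in>\<Omega> - ball x0 r. ennreal ((r powr \<kappa> * norm (x - x0) powr (- real n)) powr u x) \<partial>lebesgue)
        \<le> (\<integral>\<^sup>+x. (\<Sum>j. ennreal (k j) * indicator (ball x0 (2 ^ (j + 1) * r)) x) \<partial>lebesgue)"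
      by (intro nn_integral_mono pw)
    also have "\<dots> = (\<Sum>j. ennreal (k j) * emeasure lebesgue (ball x0 (2 ^ (j + 1) * r)))"
      by (subst nn_integral_suminf) (auto simp: nn_integral_cmult_indicator)
    also have "\<dots> = (\<Sum>j. ennreal (K1 * v * 2 ^ n * q ^ j))"
    proof (intro suminf_cong)
      fix j
      define X where "X = (2 ^ j * r) ^ n"
      have "0 < X" using r by (simp add: X_def)
      have "2 ^ (j + 1) * r = 2 * (2 ^ j * r)" by simp
      then have Y: "(2 ^ (j + 1) * r) ^ n = 2 ^ n * X" unfolding X_def by (simp only: power_mult_distrib)
      have "emeasure lebesgue (ball x0 (2 ^ (j + 1) * r)) = ennreal (v * (2 ^ (j + 1) * r) ^ n)"
        using r by (simp add: emeasure_ball v_def n_def)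
      then have "ennreal (k j) * emeasure lebesgue (ball x0 (2 ^ (j + 1) * r)) = ennreal (k j * (v * (2 ^ n * X)))"
        unfolding Y using k0 \<open>0 < v\<close> \<open>0 < X\<close> by (simp add: ennreal_mult)
      also have "k j * (v * (2 ^ n * X)) = K1 * v * 2 ^ n * q ^ j"
        unfolding k_def X_def[symmetric] using \<open>0 < X\<close> by simp
      finally show "ennreal (k j) * emeasure lebesgue (ball x0 (2 ^ (j + 1) * r)) = ennreal (K1 * v * 2 ^ n * q ^ j)" .
    qed
    also have "\<dots> = ennreal (K1 * v * 2 ^ n * (1 / (1 - q)))"
      using q \<open>0 < K1\<close> \<open>0 < v\<close> by (intro suminf_ennreal_eq sums_mult geometric_sums) auto
    finally show "(\<integral>\<^sup>+x\<in>\<Omega> - ball x0 r. ennreal ((r powr (real DIM('a) * (1 - 1 / u x0))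
        * norm (x - x0) powr (- real DIM('a))) powr u x) \<partial>lebesgue) \<le> ennreal (K1 * v * 2 ^ n * (1 / (1 - q)))"
      by (simp add: \<kappa>_def n_def)
  qed
qed

text \<open>
  This is Hoelder's inequality against the indicator of a ball, in modular form: by log-Hoelder
  continuity of the conjugate exponent, the norm of that indicator in the dual space is of the order
  of \<open>t\<close> to the power \<open>n (1 - 1/u(x0))\<close>, which is the power that a constant exponent would give.
\<close>

lemma local_L1_bound:
  fixes x0 :: 'a and S :: real
  assumes x0: "x0 \<in> \<Omega>"
  obtains C :: real where "0 < C"
    "\<And>f E t \<mu>. f \<in> borel_measurable lebesgue \<Longrightarrow> (\<And>x. 0 \<le> f x) \<Longrightarrow> E \<in> sets lebesgue \<Longrightarrow>
       E \<subseteq> \<Omega> \<inter> ball x0 t \<Longrightarrow> 0 < t \<Longrightarrow> t \<le> S \<Longrightarrow> 0 < \<mu> \<Longrightarrow>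
       (\<integral>\<^sup>+x\<in>E. ennreal ((f x / \<mu>) powr u x) \<partial>lebesgue) \<le> 1 \<Longrightarrow>
       (\<integral>\<^sup>+x\<in>E. ennreal (f x) \<partial>lebesgue) \<le> ennreal (C * \<mu> * t powr (real DIM('a) * (1 - 1 / u x0)))"
proof -
  define n where "n = DIM('a)"
  define v where "v = unit_ball_vol (real n)"
  have "0 < v" by (simp add: v_def)
  define \<kappa> where "\<kappa> = real n * (1 - 1 / u x0)"
  have p0: "1 < u x0" by (rule exponent_gt_1'[OF x0])
  interpret u': log_holder_exponent \<Omega> "\<lambda>x. u x / (u x - 1)" "up / (up - 1)" "um / (um - 1)" "A / (um - 1)\<^sup>2"
    by (rule conjugate_log_holder_exponent) (use x0 in auto)
  define S' where "S' = max 1 S"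
  define K1 where "K1 = u'.osc_const powr real n * S' powr (real n * (um / (um - 1) - up / (up - 1)))"
  have "0 < K1" using u'.osc_const_ge_1 by (simp add: K1_def S'_def)
  show thesis
  proof (rule that[of "1 + K1 * v"])
    show "0 < 1 + K1 * v" using \<open>0 < K1\<close> \<open>0 < v\<close> by (simp add: add_pos_pos)
    fix f :: "'a \<Rightarrow> real" and E t \<mu>
    assume f[measurable]: "f \<in> borel_measurable lebesgue" and f0: "\<And>x. 0 \<le> f x" and E[measurable]: "E \<in> sets lebesgue"
      and sub: "E \<subseteq> \<Omega> \<inter> ball x0 t" and t: "0 < t" "t \<le> S" and \<mu>: "0 < \<mu>"
      and mod: "(\<integral>\<^sup>+x\<in>E. ennreal ((f x / \<mu>) powr u x) \<partial>lebesgue) \<le> 1"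
    define \<phi> where "\<phi> x = (if x \<in> E then f x / \<mu> else 0)" for x
    have \<phi>m[measurable]: "\<phi> \<in> borel_measurable lebesgue" unfolding \<phi>_def by measurable
    have \<phi>_off: "\<phi> x = 0" if "x \<notin> \<Omega>" for x using sub that by (auto simp: \<phi>_def)
    have [measurable]: "(\<lambda>x. \<phi> x powr u x) \<in> borel_measurable lebesgue"
      using measurable_powr_exponent[OF \<phi>m \<phi>_off, of "\<lambda>t. t"] by simp
    have pw: "ennreal (f x) * indicator E x \<le> ennreal (\<mu> * t powr \<kappa>) * (ennreal (\<phi> x powr u x) + ennreal (K1 / t ^ n) * indicator E x)" for x
    proof (cases "x \<in> E")
      case True
      then have x: "x \<in> \<Omega>" "norm (x - x0) \<le> t" using sub by (auto simp: dist_norm norm_minus_commute)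
      have px: "1 < u x" by (rule exponent_gt_1'[OF x(1)])
      have "(f x / \<mu>) * t powr (- \<kappa>) \<le> (f x / \<mu>) powr u x + (t powr (- \<kappa>)) powr (u x / (u x - 1))"
        using f0 \<mu> px by (intro crude_young) auto
      also have "(t powr (- \<kappa>)) powr (u x / (u x - 1))
          = t powr (- real n) * t powr (- \<kappa> * (u x / (u x - 1) - u x0 / (u x0 - 1)))"
      proof -
        have "(1 - 1 / u x0) * (u x0 / (u x0 - 1)) = 1" using p0 by (simp add: field_simps)
        then have \<kappa>_conj: "\<kappa> * (u x0 / (u x0 - 1)) = real n" by (simp only: \<kappa>_def mult.assoc mult_1_right)
        have "- a * y = - (a * y0) + - a * (y - y0)" for a y y0 :: real by (simp add: algebra_simps)
        from this[of \<kappa> "u x / (u x - 1)" "u x0 / (u x0 - 1)"]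
        have "- \<kappa> * (u x / (u x - 1)) = - real n + - \<kappa> * (u x / (u x - 1) - u x0 / (u x0 - 1))"
          unfolding \<kappa>_conj .
        then show ?thesis unfolding powr_powr powr_add[symmetric] by (rule arg_cong)
      qed
      also have "t powr (- real n) * t powr (- \<kappa> * (u x / (u x - 1) - u x0 / (u x0 - 1)))
          \<le> t powr (- real n) * K1"
      proof (intro mult_left_mono)
        have "0 \<le> 1 - 1 / u x0" "1 - 1 / u x0 \<le> 1" using p0 by auto
        then have "\<bar>- \<kappa>\<bar> \<le> real n" by (simp add: \<kappa>_def abs_mult mult_left_le)
        then show "t powr (- \<kappa> * (u x / (u x - 1) - u x0 / (u x0 - 1))) \<le> K1"
          unfolding K1_def using t x x0 by (intro u'.powr_exponent_diff_bounded) (auto simp: S'_def)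
      qed simp
      also have "t powr (- real n) * K1 = K1 / t ^ n" using t by (simp add: powr_minus powr_realpow divide_inverse)
      finally have "(f x / \<mu>) * t powr (- \<kappa>) \<le> (f x / \<mu>) powr u x + K1 / t ^ n" by simp
      then have "(\<mu> * t powr \<kappa>) * ((f x / \<mu>) * t powr (- \<kappa>)) \<le> (\<mu> * t powr \<kappa>) * ((f x / \<mu>) powr u x + K1 / t ^ n)"
        using \<mu> by (intro mult_left_mono) auto
      moreover have "(\<mu> * t powr \<kappa>) * ((f x / \<mu>) * t powr (- \<kappa>)) = f x"
        using \<mu> t by (simp add: powr_minus field_simps)
      ultimately have "f x \<le> (\<mu> * t powr \<kappa>) * (\<phi> x powr u x + K1 / t ^ n)" using True by (simp add: \<phi>_def)
      then have "ennreal (f x) \<le> ennreal ((\<mu> * t powr \<kappa>) * (\<phi> x powr u x + K1 / t ^ n))" by (rule ennreal_leI)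
      also have "\<dots> = ennreal (\<mu> * t powr \<kappa>) * (ennreal (\<phi> x powr u x) + ennreal (K1 / t ^ n))"
        using \<mu> \<open>0 < K1\<close> t by (subst ennreal_mult) auto
      finally show ?thesis using True by simp
    qed simp
    have "(\<integral>\<^sup>+x\<in>E. ennreal (f x) \<partial>lebesgue)
        \<le> (\<integral>\<^sup>+x. ennreal (\<mu> * t powr \<kappa>) * (ennreal (\<phi> x powr u x) + ennreal (K1 / t ^ n) * indicator E x) \<partial>lebesgue)"
      by (intro nn_integral_mono pw)
    also have "\<dots> = ennreal (\<mu> * t powr \<kappa>) * (\<integral>\<^sup>+x. ennreal (\<phi> x powr u x) + ennreal (K1 / t ^ n) * indicator E x \<partial>lebesgue)"
      by (rule nn_integral_cmult) measurable
    also have "(\<integral>\<^sup>+x. ennreal (\<phi> x powr u x) + ennreal (K1 / t ^ n) * indicator E x \<partial>lebesgue)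
        = (\<integral>\<^sup>+x. ennreal (\<phi> x powr u x) \<partial>lebesgue) + (\<integral>\<^sup>+x. ennreal (K1 / t ^ n) * indicator E x \<partial>lebesgue)"
      by (rule nn_integral_add) measurable
    also have "(\<integral>\<^sup>+x. ennreal (\<phi> x powr u x) \<partial>lebesgue) = (\<integral>\<^sup>+x\<in>E. ennreal ((f x / \<mu>) powr u x) \<partial>lebesgue)"
      by (intro nn_integral_cong) (simp add: \<phi>_def indicator_def)
    also have "(\<integral>\<^sup>+x. ennreal (K1 / t ^ n) * indicator E x \<partial>lebesgue) = ennreal (K1 / t ^ n) * emeasure lebesgue E"
      by (rule nn_integral_cmult_indicator) measurable
    also have "ennreal (\<mu> * t powr \<kappa>) * ((\<integral>\<^sup>+x\<in>E. ennreal ((f x / \<mu>) powr u x) \<partial>lebesgue) + ennreal (K1 / t ^ n) * emeasure lebesgue E)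
        \<le> ennreal (\<mu> * t powr \<kappa>) * (1 + ennreal (K1 / t ^ n) * ennreal (v * t ^ n))"
    proof (intro mult_left_mono add_mono mod)
      have "emeasure lebesgue E \<le> emeasure lebesgue (ball x0 t)" using sub by (intro emeasure_mono) auto
      also have "\<dots> = ennreal (v * t ^ n)" using t by (simp add: emeasure_ball v_def n_def)
      finally show "emeasure lebesgue E \<le> ennreal (v * t ^ n)" .
    qed auto
    also have "1 + ennreal (K1 / t ^ n) * ennreal (v * t ^ n) = ennreal (1 + K1 * v)"
      using \<open>0 < K1\<close> \<open>0 < v\<close> t by (simp flip: ennreal_mult)
    also have "ennreal (\<mu> * t powr \<kappa>) * ennreal (1 + K1 * v) = ennreal ((1 + K1 * v) * \<mu> * t powr \<kappa>)"
      using \<open>0 < K1\<close> \<open>0 < v\<close> \<mu> by (subst ennreal_mult[symmetric]) (auto simp: ac_simps)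
    finally show "(\<integral>\<^sup>+x\<in>E. ennreal (f x) \<partial>lebesgue) \<le> ennreal ((1 + K1 * v) * \<mu> * t powr (real DIM('a) * (1 - 1 / u x0)))"
      by (simp add: \<kappa>_def n_def)
  qed
qed

end

section \<open>Complementary Morrey spaces\<close>

text \<open>
  By Lindeloef's theorem countably many of the balls of radius \<open>r/4\<close> centred outside the ball of
  radius \<open>r\<close> cover all such centres, and on each of them the kernel representation holds almost everywhere.
\<close>

lemma cz_far_estimate:
  fixes T :: "(real ^ 'n \<Rightarrow> complex) \<Rightarrow> real ^ 'n \<Rightarrow> complex"
  assumes cz: "calderon_zygmund_operator K T"
  obtains C :: real where "0 < C"
    "\<And>f x0 r. f \<in> L1 \<Longrightarrow> 0 < r \<Longrightarrow> (\<And>y. y \<notin> ball x0 (r / 2) \<Longrightarrow> f y = 0) \<Longrightarrow>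
       AE x in lebesgue. x \<notin> ball x0 r \<longrightarrow> norm (T f x) \<le> C * L1_norm f * norm (x - x0) powr (- real CARD('n))"
proof -
  obtain C \<sigma> where C: "0 < C" "\<And>x y. x \<noteq> y \<Longrightarrow> norm (K x y) \<le> C * norm (x - y) powr (- real CARD('n))"
    by (rule kernel_bounds[OF cz]) (rule that, assumption+)
  show thesis
  proof (rule that[of "C * 2 ^ CARD('n)"])
    show "0 < C * 2 ^ CARD('n)" using C(1) by simp
    fix f :: "real ^ 'n \<Rightarrow> complex" and x0 and r :: real
    assume f: "f \<in> L1" and r: "0 < r" and off: "\<And>y. y \<notin> ball x0 (r / 2) \<Longrightarrow> f y = 0"
    (* A ball of radius 2 (r/4) about a point at distance at least r from x0 misses the support of f. *)
    define \<rho> where "\<rho> = r / 4"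
    have "0 < \<rho>" using r by (simp add: \<rho>_def)
    define \<F> where "\<F> = {ball z \<rho> | z. z \<notin> ball x0 r}"
    obtain \<F>' where \<F>': "\<F>' \<subseteq> \<F>" "countable \<F>'" "\<Union>\<F>' = \<Union>\<F>"
      by (rule Lindelof[of \<F>]) (auto simp: \<F>_def)
    have "AE x in lebesgue. \<forall>B\<in>\<F>'. x \<in> B \<longrightarrow> T f x = (\<integral>y. K x y * f y \<partial>lebesgue)"
    proof (subst AE_ball_countable[OF \<F>'(2)], intro ballI)
      fix B assume "B \<in> \<F>'"
      then obtain z where z: "B = ball z \<rho>" "z \<notin> ball x0 r" using \<F>'(1) by (auto simp: \<F>_def)
      have "f y = 0" if "y \<in> ball z (2 * \<rho>)" for y
      proof (rule off)
        show "y \<notin> ball x0 (r / 2)"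
          using that z(2) dist_triangle[of x0 z y] by (simp add: \<rho>_def dist_commute)
      qed
      then show "AE x in lebesgue. x \<in> B \<longrightarrow> T f x = (\<integral>y. K x y * f y \<partial>lebesgue)"
        unfolding z(1) by (rule L1_representation[OF cz f \<open>0 < \<rho>\<close>])
    qed
    then show "AE x in lebesgue. x \<notin> ball x0 r \<longrightarrow>
        norm (T f x) \<le> C * 2 ^ CARD('n) * L1_norm f * norm (x - x0) powr (- real CARD('n))"
    proof eventually_elim
      case (elim x)
      show ?case
      proof
        assume x: "x \<notin> ball x0 r"
        then have "x \<in> \<Union>\<F>'" unfolding \<F>'(3) \<F>_def using \<open>0 < \<rho>\<close> by (intro UnionI[of "ball x \<rho>"]) auto
        then have rep: "T f x = (\<integral>y. K x y * f y \<partial>lebesgue)" using elim by blast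
        define s where "s = norm (x - x0)"
        have s: "r \<le> s" "0 < s" using x r by (auto simp: s_def dist_norm norm_minus_commute)
        have near: "f y = 0" if "norm (x - y) < s / 2" for y
        proof (rule off)
          have "s \<le> norm (x - y) + norm (y - x0)" unfolding s_def using norm_triangle_ineq[of "x - y" "y - x0"] by simp
          then show "y \<notin> ball x0 (r / 2)" using that s by (simp add: dist_norm norm_minus_commute)
        qed
        have "norm (\<integral>y. K x y * f y \<partial>lebesgue) \<le> C * (s / 2) powr (- real CARD('n)) * L1_norm f"
          by (rule kernel_times_integrable(2)[OF cz f _ near C]) (use s in auto)
        also have "(s / 2) powr (- real CARD('n)) = 2 ^ CARD('n) * s powr (- real CARD('n))"
          unfolding powr_divide by (simp add: powr_minus powr_realpow divide_inverse)
        finally show "norm (T f x) \<le> C * 2 ^ CARD('n) * L1_norm f * norm (x - x0) powr (- real CARD('n))"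
          unfolding rep s_def by (simp add: ac_simps)
      qed
    qed
  qed
qed

text \<open>
  Otherwise the integral \<open>W\<close> would be at least \<open>2 W\<close>; the lower bound \<open>c\<close> excludes \<open>W = 0\<close>.
\<close>

lemma exists_below_twice_average:
  fixes q :: "real \<Rightarrow> real"
  assumes "a < b" "0 < c" and lower: "\<And>s. s \<in> {a<..<b} \<Longrightarrow> c \<le> q s"
    and W: "(\<integral>\<^sup>+s\<in>{a<..<b}. ennreal (q s) \<partial>lebesgue) = ennreal W" "0 \<le> W"
  shows "\<exists>s\<in>{a<..<b}. q s * (b - a) \<le> 2 * W"
proof (rule ccontr)
  assume "\<not> ?thesis"
  then have big: "2 * W / (b - a) \<le> q s" if "s \<in> {a<..<b}" for s
    using that \<open>a < b\<close> by (force simp: field_simps)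
  have le: "d * (b - a) \<le> W" if d: "0 \<le> d" "\<And>s. s \<in> {a<..<b} \<Longrightarrow> d \<le> q s" for d
  proof -
    have "ennreal (d * (b - a)) = ennreal d * emeasure lebesgue {a<..<b}"
      using \<open>a < b\<close> d(1) by (simp add: ennreal_mult)
    also have "\<dots> = (\<integral>\<^sup>+s. ennreal d * indicator {a<..<b} s \<partial>lebesgue)"
      by (rule nn_integral_cmult_indicator[symmetric]) simp
    also have "\<dots> \<le> (\<integral>\<^sup>+s\<in>{a<..<b}. ennreal (q s) \<partial>lebesgue)"
      using d(2) by (intro nn_integral_mono) (auto simp: indicator_def intro: ennreal_leI)
    finally show ?thesis unfolding W(1) using W(2) by simp
  qed
  have "0 < W" using le[of c] lower \<open>0 < c\<close> \<open>a < b\<close> by (smt (verit) mult_pos_pos)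
  moreover have "2 * W / (b - a) * (b - a) \<le> W" using big W(2) \<open>a < b\<close> by (intro le) auto
  ultimately show False using \<open>a < b\<close> by simp
qed

text \<open>
  The constant is the reciprocal of a bound for the finite supremum of \<open>r\<^bsup>n/p'(x\<^sub>0)\<^esup> / \<omega>(r)\<close>.
\<close>

lemma admissible_weight_lower:
  assumes "admissible_weight \<Omega> p x\<^sub>0 \<omega>"
  obtains c where "0 < c"
    "\<And>r. 0 < r \<Longrightarrow> r < diameter \<Omega> \<Longrightarrow> c * r powr (real CARD('n) / conjugate_exponent p (x\<^sub>0 :: real ^ 'n)) \<le> \<omega> r"
proof -
  define \<kappa> where "\<kappa> = real CARD('n) / conjugate_exponent p x\<^sub>0"
  have fin: "(SUP r\<in>{0<..<diameter \<Omega>}. morrey_factor p \<omega> x\<^sub>0 r) < \<infinity>"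
    using assms by (simp add: admissible_weight_def)
  then obtain m where m: "0 \<le> m" "(SUP r\<in>{0<..<diameter \<Omega>}. morrey_factor p \<omega> x\<^sub>0 r) = ennreal m"
    by (cases "SUP r\<in>{0<..<diameter \<Omega>}. morrey_factor p \<omega> x\<^sub>0 r") auto
  show thesis
  proof (rule that[of "1 / (m + 1)"])
    show "0 < 1 / (m + 1)" using m(1) by simp
    fix r :: real assume r: "0 < r" "r < diameter \<Omega>"
    have "morrey_factor p \<omega> x\<^sub>0 r \<le> (SUP r\<in>{0<..<diameter \<Omega>}. morrey_factor p \<omega> x\<^sub>0 r)"
      using r by (intro SUP_upper) simp
    then have le: "ennreal (r powr \<kappa>) / ennreal (\<omega> r) \<le> ennreal m"
      unfolding m(2) by (simp add: morrey_factor_def \<kappa>_def)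
    have "0 < \<omega> r"
    proof (rule ccontr)
      assume "\<not> 0 < \<omega> r"
      then have "ennreal (\<omega> r) = 0" by (simp add: ennreal_neg)
      with le r show False by (simp add: top_unique)
    qed
    then have "r powr \<kappa> / \<omega> r \<le> m" using le m(1) by (simp add: divide_ennreal)
    then have "r powr \<kappa> \<le> m * \<omega> r" using \<open>0 < \<omega> r\<close> by (simp add: field_simps)
    also have "\<dots> \<le> (m + 1) * \<omega> r" using \<open>0 < \<omega> r\<close> by simp
    finally have "1 / (m + 1) * r powr \<kappa> \<le> \<omega> r" using m(1) by (simp add: field_simps)
    then show "1 / (m + 1) * r powr (real CARD('n) / conjugate_exponent p x\<^sub>0) \<le> \<omega> r" by (simp add: \<kappa>_def)
  qed
qed

text \<open>
  A strict inequality provides an admissible parameter below \<open>t\<close>, whereas the infimum itself need not be attained.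
\<close>

lemma modular_le_1_of_luxemburg_less:
  assumes "luxemburg_norm p E f < ennreal t" and "\<And>x. x \<in> E \<Longrightarrow> 0 \<le> p x" and "0 < t"
  shows "(\<integral>\<^sup>+x\<in>E. ennreal ((norm (f x) / t) powr p x) \<partial>lebesgue) \<le> 1"
proof -
  obtain \<eta> where \<eta>: "0 < \<eta>" "ennreal \<eta> < ennreal t"
    "(\<integral>\<^sup>+x\<in>E. ennreal (norm (f x / of_real \<eta>) powr p x) \<partial>lebesgue) \<le> 1"
    using assms(1) unfolding luxemburg_norm_def Inf_less_iff by auto
  have "\<eta> < t" using \<eta> by (simp add: ennreal_less_iff)
  have "(\<integral>\<^sup>+x\<in>E. ennreal ((norm (f x) / t) powr p x) \<partial>lebesgue)
      \<le> (\<integral>\<^sup>+x\<in>E. ennreal (norm (f x / of_real \<eta>) powr p x) \<partial>lebesgue)"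
  proof (intro nn_integral_mono)
    fix x
    have "norm (f x) / t \<le> norm (f x) / \<eta>" using \<eta>(1) \<open>\<eta> < t\<close> by (intro divide_left_mono) auto
    then show "ennreal ((norm (f x) / t) powr p x) * indicator E x \<le> ennreal (norm (f x / of_real \<eta>) powr p x) * indicator E x"
      using assms(2)[of x] \<open>0 < t\<close> \<eta>(1)
      by (auto simp: indicator_def norm_divide intro!: ennreal_leI powr_mono2)
  qed
  then show ?thesis using \<eta>(3) by (rule order_trans)
qed

lemma luxemburg_le_of_modular:
  assumes "0 < \<eta>" "(\<integral>\<^sup>+x\<in>E. ennreal ((norm (f x) / \<eta>) powr p x) \<partial>lebesgue) \<le> 1"
  shows "luxemburg_norm p E f \<le> ennreal \<eta>"
proof -
  have "norm (f x / of_real \<eta>) = norm (f x) / \<eta>" for x using assms(1) by (simp add: norm_divide)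
  then show ?thesis unfolding luxemburg_norm_def using assms by (intro Inf_lower) auto
qed

lemma morrey_modular_le_1:
  fixes x\<^sub>0 :: "real ^ 'n"
  assumes r: "0 < r" "r < diameter \<Omega>" and "0 < \<omega> r" and "\<And>x. x \<in> \<Omega> \<Longrightarrow> 0 \<le> p x"
    and N: "compl_morrey_norm \<Omega> p \<omega> x\<^sub>0 f < ennreal N"
  shows "(\<integral>\<^sup>+x\<in>\<Omega> - ball x\<^sub>0 r. ennreal ((norm (f x) / (N * \<omega> r * r powr (- (real CARD('n) / conjugate_exponent p x\<^sub>0)))) powr p x) \<partial>lebesgue) \<le> 1"
proof (rule modular_le_1_of_luxemburg_less)
  define \<kappa> where "\<kappa> = real CARD('n) / conjugate_exponent p x\<^sub>0"
  have "0 < N" using N by (metis ennreal_neg not_le not_less_zero)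
  define c where "c = r powr \<kappa> / \<omega> r"
  have "0 < c" using assms by (simp add: c_def)
  have t: "N * \<omega> r * r powr (- \<kappa>) = N / c"
    by (simp add: c_def powr_minus divide_inverse)
  show "0 < N * \<omega> r * r powr (- (real CARD('n) / conjugate_exponent p x\<^sub>0))"
    using \<open>0 < N\<close> \<open>0 < c\<close> unfolding \<kappa>_def[symmetric] t by simp
  have "\<Omega> - (ball x\<^sub>0 r \<inter> \<Omega>) = \<Omega> - ball x\<^sub>0 r" by blast
  then have "morrey_factor p \<omega> x\<^sub>0 r * luxemburg_norm p (\<Omega> - ball x\<^sub>0 r) f \<le> compl_morrey_norm \<Omega> p \<omega> x\<^sub>0 f"
    unfolding compl_morrey_norm_def using r
    by (intro SUP_upper2[of r]) auto
  moreover have "morrey_factor p \<omega> x\<^sub>0 r = ennreal c"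
    unfolding morrey_factor_def \<kappa>_def[symmetric] c_def using assms by (intro divide_ennreal) auto
  ultimately have "ennreal c * luxemburg_norm p (\<Omega> - ball x\<^sub>0 r) f < ennreal N"
    using N by (metis order_le_less_trans)
  moreover have "ennreal N = ennreal c * ennreal (N / c)" using \<open>0 < c\<close> \<open>0 < N\<close> by (simp flip: ennreal_mult)
  ultimately have "luxemburg_norm p (\<Omega> - ball x\<^sub>0 r) f < ennreal (N / c)"
    by (metis linorder_not_le mult_left_mono zero_le)
  then show "luxemburg_norm p (\<Omega> - ball x\<^sub>0 r) f < ennreal (N * \<omega> r * r powr (- (real CARD('n) / conjugate_exponent p x\<^sub>0)))"
    unfolding \<kappa>_def[symmetric] t .
qed (use assms in auto)

lemma modular_mono:
  assumes "E \<subseteq> E'" "0 < a" "a \<le> b" "\<And>x. x \<in> E \<Longrightarrow> 0 \<le> p x" "\<And>x. 0 \<le> v x"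
  shows "(\<integral>\<^sup>+x\<in>E. ennreal ((v x / b) powr p x) \<partial>lebesgue) \<le> (\<integral>\<^sup>+x\<in>E'. ennreal ((v x / a) powr p x) \<partial>lebesgue)"
proof (intro nn_integral_mono)
  fix x
  have "v x / b \<le> v x / a" "0 \<le> v x / b" using assms by (auto intro: divide_left_mono)
  then show "ennreal ((v x / b) powr p x) * indicator E x \<le> ennreal ((v x / a) powr p x) * indicator E' x"
    using assms(1) assms(4)[of x] by (auto simp: indicator_def intro!: ennreal_leI powr_mono2)
qed

text \<open>
  The hypotheses of the main theorem with explicit constants.
\<close>

locale complementary_morrey = log_holder_exponent \<Omega> p pm pp A
  for \<Omega> :: "(real ^ 'n) set" and p :: "real ^ 'n \<Rightarrow> real" and pm pp A :: real +
  fixes x0 :: "real ^ 'n" and \<omega>\<^sub>1 \<omega>\<^sub>2 :: "real \<Rightarrow> real" and Cw :: real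
  assumes x0: "x0 \<in> \<Omega>" and weight1: "admissible_weight \<Omega> p x0 \<omega>\<^sub>1" and weight2: "admissible_weight \<Omega> p x0 \<omega>\<^sub>2"
    and Cw: "0 < Cw"
    and dini: "\<And>t. 0 < t \<Longrightarrow> t < diameter \<Omega> \<Longrightarrow>
           (\<integral>\<^sup>+ r\<in>{0<..<t}. ennreal (\<omega>\<^sub>1 r / r) \<partial>lebesgue) \<le> ennreal (Cw * \<omega>\<^sub>2 t)"
begin

text \<open>
  The power \<open>n/p'(x\<^sub>0)\<close> of the radius in the Morrey norm.
\<close>

definition \<kappa> :: real where "\<kappa> = real CARD('n) * (1 - 1 / p x0)"

lemma \<kappa>_eq: "real CARD('n) / conjugate_exponent p x0 = \<kappa>"
  using exponent_gt_1'[OF x0] by (simp add: \<kappa>_def conjugate_exponent_def field_simps)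

lemma \<kappa>_pos: "0 < \<kappa>"
  using exponent_gt_1'[OF x0] by (simp add: \<kappa>_def)

lemma exponent_nonneg: "x \<in> \<Omega> \<Longrightarrow> 0 \<le> p x"
  using exponent_gt_1'[of x] by linarith

lemma weight_pos:
  assumes "0 < r" "r < diameter \<Omega>" shows "0 < \<omega>\<^sub>1 r" "0 < \<omega>\<^sub>2 r"
proof -
  have pos: "0 < \<omega> r" if adm: "admissible_weight \<Omega> p x0 \<omega>" for \<omega>
  proof -
    obtain c where "0 < c" "c * r powr (real CARD('n) / conjugate_exponent p x0) \<le> \<omega> r"
      using admissible_weight_lower[OF adm] assms by metis
    moreover have "0 < c * r powr (real CARD('n) / conjugate_exponent p x0)" using \<open>0 < c\<close> assms by simp
    ultimately show ?thesis by linarith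
  qed
  show "0 < \<omega>\<^sub>1 r" "0 < \<omega>\<^sub>2 r" by (rule pos weight1 weight2)+
qed

text \<open>
  The part of the integral of \<open>\<omega>\<^sub>1(s)/s\<close> that belongs to the scale \<open>t\<close>: for the scales
  \<open>t, t/2, t/4, \<dots>\<close> the intervals \<open>(t/4, t/2)\<close> are disjoint.
\<close>

definition dini_share :: "real \<Rightarrow> real" where
  "dini_share t = enn2real (\<integral>\<^sup>+s\<in>{t/4<..<t/2}. ennreal (\<omega>\<^sub>1 s / s) \<partial>lebesgue)"

lemma dini_share:
  assumes t: "0 < t" "t < diameter \<Omega>"
  shows "(\<integral>\<^sup>+s\<in>{t/4<..<t/2}. ennreal (\<omega>\<^sub>1 s / s) \<partial>lebesgue) = ennreal (dini_share t)" "0 \<le> dini_share t" "dini_share t \<le> Cw * \<omega>\<^sub>2 t"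
proof -
  have "(\<integral>\<^sup>+s\<in>{t/4<..<t/2}. ennreal (\<omega>\<^sub>1 s / s) \<partial>lebesgue) \<le> (\<integral>\<^sup>+s\<in>{0<..<t}. ennreal (\<omega>\<^sub>1 s / s) \<partial>lebesgue)"
    using t by (intro nn_integral_mono) (auto simp: indicator_def)
  also have "\<dots> \<le> ennreal (Cw * \<omega>\<^sub>2 t)" by (rule dini[OF t])
  finally have le: "(\<integral>\<^sup>+s\<in>{t/4<..<t/2}. ennreal (\<omega>\<^sub>1 s / s) \<partial>lebesgue) \<le> ennreal (Cw * \<omega>\<^sub>2 t)" .
  then show eq: "(\<integral>\<^sup>+s\<in>{t/4<..<t/2}. ennreal (\<omega>\<^sub>1 s / s) \<partial>lebesgue) = ennreal (dini_share t)"
    unfolding dini_share_def by (intro ennreal_enn2real[symmetric]) (simp add: order_le_less_trans)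
  show "0 \<le> dini_share t" by (simp add: dini_share_def)
  have "0 \<le> Cw * \<omega>\<^sub>2 t" using Cw weight_pos(2)[OF t] by simp
  then show "dini_share t \<le> Cw * \<omega>\<^sub>2 t" unfolding dini_share_def using le by (rule enn2real_leI)
qed

text \<open>
  The Morrey norm controls \<open>f\<close> outside the ball of radius \<open>s\<close> in terms of \<open>\<omega>\<^sub>1(s)\<close>.  The complement of
  the ball of radius \<open>t/2\<close> is contained in that of every ball of radius \<open>s\<close> between \<open>t/4\<close> and \<open>t/2\<close>, so
  \<open>s\<close> may be chosen such that \<open>\<omega>\<^sub>1(s)/s\<close> is at most twice its average over this interval.
\<close>

lemma annular_modular:
  assumes t: "0 < t" "t < diameter \<Omega>" and N: "compl_morrey_norm \<Omega> p \<omega>\<^sub>1 x0 f < ennreal N"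
  shows "0 < dini_share t"
    "(\<integral>\<^sup>+x\<in>\<Omega> - ball x0 (t/2). ennreal ((norm (f x) / (4 * 4 powr \<kappa> * N * dini_share t * t powr (- \<kappa>))) powr p x) \<partial>lebesgue) \<le> 1"
proof -
  have "0 < N" using N by (metis ennreal_neg not_le not_less_zero)
  obtain c where c: "0 < c" "\<And>r. 0 < r \<Longrightarrow> r < diameter \<Omega> \<Longrightarrow> c * r powr \<kappa> \<le> \<omega>\<^sub>1 r"
    by (rule admissible_weight_lower[OF weight1, unfolded \<kappa>_eq]) (rule that, assumption+)
  have "\<exists>s\<in>{t/4<..<t/2}. \<omega>\<^sub>1 s / s * (t/2 - t/4) \<le> 2 * dini_share t"
  proof (rule exists_below_twice_average[where c = "c * (t/4) powr \<kappa> / (t/2)"])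
    fix s assume s: "s \<in> {t/4<..<t/2}"
    have "c * (t/4) powr \<kappa> \<le> c * s powr \<kappa>" using s t c(1) \<kappa>_pos by (intro mult_left_mono powr_mono2) auto
    also have "\<dots> \<le> \<omega>\<^sub>1 s" using s t by (intro c(2)) auto
    finally show "c * (t/4) powr \<kappa> / (t/2) \<le> \<omega>\<^sub>1 s / s"
      using s t c(1) weight_pos(1)[of s] by (intro frac_le) auto
  qed (use t c(1) dini_share[OF t] in auto)
  then obtain s where s: "t/4 < s" "s < t/2" "\<omega>\<^sub>1 s / s * (t/4) \<le> 2 * dini_share t" by auto
  have \<omega>s: "0 < \<omega>\<^sub>1 s" using s t by (intro weight_pos) auto
  have "0 < \<omega>\<^sub>1 s / s * (t/4)" using \<omega>s s t by simp
  then show "0 < dini_share t" using s(3) by linarith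
  have "\<omega>\<^sub>1 s \<le> 8 * dini_share t * s / t" using s t by (simp add: field_simps)
  also have "\<dots> \<le> 8 * dini_share t * (t/2) / t" using s t \<open>0 < dini_share t\<close> by (intro divide_right_mono mult_left_mono) auto
  finally have \<omega>dini_share: "\<omega>\<^sub>1 s \<le> 4 * dini_share t" using t by simp
  have "s powr (- \<kappa>) \<le> (t/4) powr (- \<kappa>)" using s t \<kappa>_pos by (intro powr_mono2') auto
  also have "\<dots> = 4 powr \<kappa> * t powr (- \<kappa>)"
    unfolding powr_divide by (simp add: powr_minus divide_inverse)
  finally have "N * \<omega>\<^sub>1 s * s powr (- \<kappa>) \<le> N * (4 * dini_share t) * (4 powr \<kappa> * t powr (- \<kappa>))"
    using \<omega>dini_share \<open>0 < N\<close> \<omega>s \<open>0 < dini_share t\<close> by (intro mult_mono) auto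
  then have le: "N * \<omega>\<^sub>1 s * s powr (- \<kappa>) \<le> 4 * 4 powr \<kappa> * N * dini_share t * t powr (- \<kappa>)" by (simp add: ac_simps)
  have "(\<integral>\<^sup>+x\<in>\<Omega> - ball x0 (t/2). ennreal ((norm (f x) / (4 * 4 powr \<kappa> * N * dini_share t * t powr (- \<kappa>))) powr p x) \<partial>lebesgue)
      \<le> (\<integral>\<^sup>+x\<in>\<Omega> - ball x0 s. ennreal ((norm (f x) / (N * \<omega>\<^sub>1 s * s powr (- \<kappa>))) powr p x) \<partial>lebesgue)"
    by (rule modular_mono[OF _ _ le]) (use s t \<open>0 < N\<close> \<omega>s exponent_nonneg in auto)
  also have "\<dots> \<le> 1"
    unfolding \<kappa>_eq[symmetric] by (rule morrey_modular_le_1) (use s t \<omega>s exponent_nonneg N in auto)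
  finally show "(\<integral>\<^sup>+x\<in>\<Omega> - ball x0 (t/2). ennreal ((norm (f x) / (4 * 4 powr \<kappa> * N * dini_share t * t powr (- \<kappa>))) powr p x) \<partial>lebesgue) \<le> 1" .
qed

lemma sum_dini_share_le:
  assumes t: "0 < t" "t < diameter \<Omega>"
  shows "(\<Sum>k. ennreal (dini_share (t / 2 ^ k))) \<le> ennreal (Cw * \<omega>\<^sub>2 t)"
proof -
  define B where "B k = {t / 2 ^ k / 4<..<t / 2 ^ k / 2}" for k :: nat
  have tk: "0 < t / 2 ^ k" "t / 2 ^ k \<le> t" for k :: nat
    using t by (auto simp: divide_le_eq mult_le_cancel_left1)
  define q where "q s = ennreal (\<omega>\<^sub>1 s / s) * indicator {0<..<diameter \<Omega>} s" for s
  have [measurable]: "q \<in> borel_measurable lebesgue"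
  proof -
    have [measurable]: "\<omega>\<^sub>1 \<in> borel_measurable (lebesgue_on {0<..<diameter \<Omega>})"
      using weight1 by (simp add: admissible_weight_def)
    have "(\<lambda>s. if s \<in> {0<..<diameter \<Omega>} then \<omega>\<^sub>1 s else 0) \<in> borel_measurable lebesgue"
      by (subst borel_measurable_if) (auto simp: \<open>\<omega>\<^sub>1 \<in> _\<close>)
    moreover have "(\<lambda>s::real. s) \<in> borel_measurable lebesgue" by (intro measurable_completion) simp
    ultimately have "(\<lambda>s. ennreal ((if s \<in> {0<..<diameter \<Omega>} then \<omega>\<^sub>1 s else 0) / s)) \<in> borel_measurable lebesgue"
      by measurable
    also have "(\<lambda>s. ennreal ((if s \<in> {0<..<diameter \<Omega>} then \<omega>\<^sub>1 s else 0) / s)) = q"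
      by (auto simp: q_def indicator_def fun_eq_iff)
    finally show ?thesis .
  qed
  have disj: "disjoint_family B"
  proof -
    have "B i \<inter> B j = {}" if "i < j" for i j
    proof -
      have "(2::real) ^ Suc i \<le> 2 ^ j" using that by (intro power_increasing) auto
      then have "t / 2 ^ j \<le> t / 2 ^ Suc i" using t by (intro divide_left_mono) auto
      then have "t / 2 ^ j / 2 \<le> t / 2 ^ i / 4" by simp
      then show ?thesis by (auto simp: B_def)
    qed
    then show ?thesis unfolding disjoint_family_on_def by (metis Int_commute linorder_neqE_nat)
  qed
  have "(\<Sum>k. ennreal (dini_share (t / 2 ^ k))) = (\<Sum>k. \<integral>\<^sup>+s\<in>B k. q s \<partial>lebesgue)"
  proof (intro suminf_cong)
    fix k
    have tl: "t / 2 ^ k < diameter \<Omega>" using tk(2)[of k] t by linarith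
    have "ennreal (dini_share (t / 2 ^ k)) = (\<integral>\<^sup>+s\<in>B k. ennreal (\<omega>\<^sub>1 s / s) \<partial>lebesgue)"
      using dini_share(1)[OF tk(1) tl] by (simp add: B_def)
    also have "\<dots> = (\<integral>\<^sup>+s\<in>B k. q s \<partial>lebesgue)"
    proof (intro nn_integral_cong)
      fix s
      have "s \<in> {0<..<diameter \<Omega>}" if "s \<in> B k" using that tk(1)[of k] tl by (simp add: B_def; linarith)
      then show "ennreal (\<omega>\<^sub>1 s / s) * indicator (B k) s = q s * indicator (B k) s"
        by (simp add: q_def indicator_def)
    qed
    finally show "ennreal (dini_share (t / 2 ^ k)) = (\<integral>\<^sup>+s\<in>B k. q s \<partial>lebesgue)" .
  qed
  also have "\<dots> = (\<integral>\<^sup>+s\<in>(\<Union>k. B k). q s \<partial>lebesgue)"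
    by (rule nn_integral_disjoint_family[OF _ _ disj, symmetric]) (auto simp: B_def)
  also have "\<dots> \<le> (\<integral>\<^sup>+s\<in>{0<..<t}. ennreal (\<omega>\<^sub>1 s / s) \<partial>lebesgue)"
  proof (intro nn_integral_mono)
    fix s
    have "s \<in> {0<..<t}" if "s \<in> B k" for k
      using that tk[of k] by (simp add: B_def; linarith)
    then show "q s * indicator (\<Union>k. B k) s \<le> ennreal (\<omega>\<^sub>1 s / s) * indicator {0<..<t} s"
      by (auto simp: q_def indicator_def)
  qed
  also have "\<dots> \<le> ennreal (Cw * \<omega>\<^sub>2 t)" by (rule dini[OF t])
  finally show ?thesis .
qed

lemma diameter_pos: "open \<Omega> \<Longrightarrow> 0 < diameter \<Omega>"
proof -
  assume "open \<Omega>"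
  then obtain e where e: "0 < e" "ball x0 e \<subseteq> \<Omega>" using x0 by (meson openE)
  have "ball x0 (e/2) \<subseteq> ball x0 e" using e by (intro subset_ball) simp
  then have "diameter (ball x0 (e/2)) \<le> diameter \<Omega>" using e Omega_bounded by (intro diameter_subset) auto
  then show ?thesis using e(1) by simp
qed

lemma in_ball_diameter: "\<Omega> \<subseteq> ball x0 (diameter \<Omega> + 1)"
proof
  fix x assume "x \<in> \<Omega>"
  then have "dist x0 x \<le> diameter \<Omega>" using Omega_bounded x0 by (intro diameter_bounded_bound)
  then show "x \<in> ball x0 (diameter \<Omega> + 1)" by simp
qed

text \<open>
  On the annulus between the radii \<open>t/2\<^bsup>k+1\<^esup>\<close> and \<open>t/2\<^sup>k\<close> Hoelder's inequality and the preceding modular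
  bound give the estimate \<open>C N dini_share (t/2\<^sup>k)\<close>, in which the powers of the radius cancel.  The sum over
  \<open>k\<close> is controlled by \<open>\<omega>\<^sub>2(t)\<close>.
\<close>

lemma ball_integral_bound:
  obtains C where "0 < C"
    "\<And>f N t. f \<in> borel_measurable lebesgue \<Longrightarrow> compl_morrey_norm \<Omega> p \<omega>\<^sub>1 x0 f < ennreal N \<Longrightarrow> 0 < t \<Longrightarrow> t < diameter \<Omega> \<Longrightarrow>
       (\<integral>\<^sup>+x\<in>\<Omega> \<inter> ball x0 t. ennreal (norm (f x)) \<partial>lebesgue) \<le> ennreal (C * N * \<omega>\<^sub>2 t)"
proof -
  obtain Cl :: real where Cl: "0 < Cl" and local_bound:
    "\<And>f E t \<mu>. f \<in> borel_measurable lebesgue \<Longrightarrow> (\<And>x. 0 \<le> f x) \<Longrightarrow> E \<in> sets lebesgue \<Longrightarrow>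
       E \<subseteq> \<Omega> \<inter> ball x0 t \<Longrightarrow> 0 < t \<Longrightarrow> t \<le> diameter \<Omega> + 1 \<Longrightarrow> 0 < \<mu> \<Longrightarrow>
       (\<integral>\<^sup>+x\<in>E. ennreal ((f x / \<mu>) powr p x) \<partial>lebesgue) \<le> 1 \<Longrightarrow>
       (\<integral>\<^sup>+x\<in>E. ennreal (f x) \<partial>lebesgue) \<le> ennreal (Cl * \<mu> * t powr (real DIM(real ^ 'n) * (1 - 1 / p x0)))"
    by (rule local_L1_bound[OF x0, of "diameter \<Omega> + 1"]) blast
  define a where "a = 4 * 4 powr \<kappa>"
  have "0 < a" by (simp add: a_def)
  show thesis
  proof (rule that[of "Cl * a * Cw"])
    show "0 < Cl * a * Cw" using Cl \<open>0 < a\<close> Cw by simp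
    fix f :: "real ^ 'n \<Rightarrow> complex" and N t
    assume f[measurable]: "f \<in> borel_measurable lebesgue" and N: "compl_morrey_norm \<Omega> p \<omega>\<^sub>1 x0 f < ennreal N"
      and t: "0 < t" "t < diameter \<Omega>"
    have "0 < N" using N by (metis ennreal_neg not_le not_less_zero)
    have [measurable]: "\<Omega> \<in> sets lebesgue" by (rule Omega_sets)
    have [measurable]: "ball x0 s \<in> sets lebesgue" for s by simp
    have tk: "0 < t / 2 ^ k" "t / 2 ^ k \<le> t" for k :: nat
      using t by (auto simp: divide_le_eq mult_le_cancel_left1)
    define D where "D k = \<Omega> \<inter> ball x0 (t / 2 ^ k) - ball x0 (t / 2 ^ k / 2)" for k :: nat
    have [measurable]: "D k \<in> sets lebesgue" for k unfolding D_def by measurable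
    have piece: "(\<integral>\<^sup>+x\<in>D k. ennreal (norm (f x)) \<partial>lebesgue) \<le> ennreal (Cl * a * N) * ennreal (dini_share (t / 2 ^ k))" for k
    proof -
      define s where "s = t / 2 ^ k"
      have s: "0 < s" "s < diameter \<Omega>" using tk[of k] t by (auto simp: s_def)
      define \<mu> where "\<mu> = 4 * 4 powr \<kappa> * N * dini_share s * s powr (- \<kappa>)"
      have Ws: "0 < dini_share s" by (rule annular_modular(1)[OF s N])
      have "0 < \<mu>" using Ws \<open>0 < N\<close> s by (simp add: \<mu>_def)
      have "(\<integral>\<^sup>+x\<in>D k. ennreal ((norm (f x) / \<mu>) powr p x) \<partial>lebesgue)
          \<le> (\<integral>\<^sup>+x\<in>\<Omega> - ball x0 (s/2). ennreal ((norm (f x) / \<mu>) powr p x) \<partial>lebesgue)"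
        using exponent_nonneg \<open>0 < \<mu>\<close> by (intro modular_mono) (auto simp: D_def s_def)
      also have "\<dots> \<le> 1" unfolding \<mu>_def by (rule annular_modular(2)[OF s N])
      finally have "(\<integral>\<^sup>+x\<in>D k. ennreal ((norm (f x) / \<mu>) powr p x) \<partial>lebesgue) \<le> 1" .
      then have "(\<integral>\<^sup>+x\<in>D k. ennreal (norm (f x)) \<partial>lebesgue) \<le> ennreal (Cl * \<mu> * s powr (real DIM(real ^ 'n) * (1 - 1 / p x0)))"
        using s \<open>0 < \<mu>\<close> by (intro local_bound) (auto simp: D_def s_def)
      also have "Cl * \<mu> * s powr (real DIM(real ^ 'n) * (1 - 1 / p x0)) = Cl * a * N * dini_share s"
        using s by (simp add: \<mu>_def a_def \<kappa>_def[symmetric] powr_minus)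
      also have "ennreal (Cl * a * N * dini_share s) = ennreal (Cl * a * N) * ennreal (dini_share s)"
        using Cl \<open>0 < a\<close> \<open>0 < N\<close> Ws by (intro ennreal_mult) auto
      finally show ?thesis by (simp add: s_def)
    qed
    have null: "{x0} \<in> null_sets (lebesgue :: (real ^ 'n) measure)"
      by (intro null_sets_completionI finite_imp_null_set_lborel) simp
    have "(\<integral>\<^sup>+x\<in>\<Omega> \<inter> ball x0 t. ennreal (norm (f x)) \<partial>lebesgue) \<le> (\<integral>\<^sup>+x. (\<Sum>k. ennreal (norm (f x)) * indicator (D k) x) \<partial>lebesgue)"
    proof (rule nn_integral_mono_AE)
      show "AE x in lebesgue. ennreal (norm (f x)) * indicator (\<Omega> \<inter> ball x0 t) x \<le> (\<Sum>k. ennreal (norm (f x)) * indicator (D k) x)"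
        using AE_not_in[OF null]
      proof eventually_elim
        case (elim x)
        show ?case
        proof (cases "x \<in> \<Omega> \<inter> ball x0 t")
          case True
          define s where "s = dist x0 x"
          have s: "0 < s" "s < t" using elim True by (auto simp: s_def)
          then obtain k where "2 ^ k < t / s" "t / s \<le> 2 ^ Suc k" using dyadic_scale_left[of "t / s"] by auto
          then have k1: "t / 2 ^ Suc k \<le> s" and k2: "s < t / 2 ^ k" using s by (simp_all add: field_simps)
          have "x \<in> D k" using True k1 k2 by (simp add: D_def s_def)
          then have "ennreal (norm (f x)) * indicator (\<Omega> \<inter> ball x0 t) x = (\<Sum>j\<in>{k}. ennreal (norm (f x)) * indicator (D j) x)"
            using True by simp
          also have "\<dots> \<le> (\<Sum>k. ennreal (norm (f x)) * indicator (D k) x)" by (rule sum_le_suminf) auto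
          finally show ?thesis .
        qed simp
      qed
    qed
    also have "\<dots> = (\<Sum>k. \<integral>\<^sup>+x\<in>D k. ennreal (norm (f x)) \<partial>lebesgue)" by (rule nn_integral_suminf) measurable
    also have "\<dots> \<le> (\<Sum>k. ennreal (Cl * a * N) * ennreal (dini_share (t / 2 ^ k)))"
      using piece by (intro suminf_le) auto
    also have "\<dots> = ennreal (Cl * a * N) * (\<Sum>k. ennreal (dini_share (t / 2 ^ k)))" by (rule ennreal_suminf_cmult)
    also have "\<dots> \<le> ennreal (Cl * a * N) * ennreal (Cw * \<omega>\<^sub>2 t)" by (intro mult_left_mono sum_dini_share_le t) simp
    also have "\<dots> = ennreal (Cl * a * Cw * N * \<omega>\<^sub>2 t)"
      using Cl \<open>0 < a\<close> \<open>0 < N\<close> Cw weight_pos(2)[OF t] by (subst ennreal_mult[symmetric]) (auto simp: ac_simps)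
    finally show "(\<integral>\<^sup>+x\<in>\<Omega> \<inter> ball x0 t. ennreal (norm (f x)) \<partial>lebesgue) \<le> ennreal (Cl * a * Cw * N * \<omega>\<^sub>2 t)" .
  qed
qed

end

context complementary_morrey
begin

text \<open>
  Near \<open>x0\<close> integrability follows from the bound on balls, and away from \<open>x0\<close> from the variable
  exponent on a bounded set.
\<close>

lemma morrey_function_in_L1:
  assumes "open \<Omega>" and f[measurable]: "f \<in> borel_measurable lebesgue" and off: "\<And>x. x \<notin> \<Omega> \<Longrightarrow> f x = 0"
    and N: "compl_morrey_norm \<Omega> p \<omega>\<^sub>1 x0 f < ennreal N"
  shows "f \<in> L1"
proof -
  have "0 < N" using N by (metis ennreal_neg not_le not_less_zero)
  have [measurable]: "\<Omega> \<in> sets lebesgue" by (rule Omega_sets)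
  have [measurable]: "ball x0 s \<in> sets lebesgue" for s by simp
  define t where "t = diameter \<Omega> / 2"
  have t: "0 < t" "t < diameter \<Omega>" using diameter_pos[OF \<open>open \<Omega>\<close>] by (auto simp: t_def)
  obtain C where C: "\<And>f N t. f \<in> borel_measurable lebesgue \<Longrightarrow> compl_morrey_norm \<Omega> p \<omega>\<^sub>1 x0 f < ennreal N \<Longrightarrow> 0 < t \<Longrightarrow> t < diameter \<Omega> \<Longrightarrow>
       (\<integral>\<^sup>+x\<in>\<Omega> \<inter> ball x0 t. ennreal (norm (f x)) \<partial>lebesgue) \<le> ennreal (C * N * \<omega>\<^sub>2 t)"
    by (rule ball_integral_bound) blast
  obtain Cl :: real where local_bound:
    "\<And>f E t \<mu>. f \<in> borel_measurable lebesgue \<Longrightarrow> (\<And>x. 0 \<le> f x) \<Longrightarrow> E \<in> sets lebesgue \<Longrightarrow>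
       E \<subseteq> \<Omega> \<inter> ball x0 t \<Longrightarrow> 0 < t \<Longrightarrow> t \<le> diameter \<Omega> + 1 \<Longrightarrow> 0 < \<mu> \<Longrightarrow>
       (\<integral>\<^sup>+x\<in>E. ennreal ((f x / \<mu>) powr p x) \<partial>lebesgue) \<le> 1 \<Longrightarrow>
       (\<integral>\<^sup>+x\<in>E. ennreal (f x) \<partial>lebesgue) \<le> ennreal (Cl * \<mu> * t powr (real DIM(real ^ 'n) * (1 - 1 / p x0)))"
    by (rule local_L1_bound[OF x0, of "diameter \<Omega> + 1"]) blast
  define \<mu> where "\<mu> = N * \<omega>\<^sub>1 t * t powr (- \<kappa>)"
  have "0 < \<mu>" using \<open>0 < N\<close> weight_pos[OF t] t by (simp add: \<mu>_def)
  have "(\<integral>\<^sup>+x\<in>\<Omega> - ball x0 t. ennreal ((norm (f x) / \<mu>) powr p x) \<partial>lebesgue) \<le> 1"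
    unfolding \<mu>_def \<kappa>_eq[symmetric] by (rule morrey_modular_le_1[OF t weight_pos(1)[OF t] exponent_nonneg N])
  then have out: "(\<integral>\<^sup>+x\<in>\<Omega> - ball x0 t. ennreal (norm (f x)) \<partial>lebesgue)
      \<le> ennreal (Cl * \<mu> * (diameter \<Omega> + 1) powr (real DIM(real ^ 'n) * (1 - 1 / p x0)))"
    using in_ball_diameter diameter_pos[OF \<open>open \<Omega>\<close>] \<open>0 < \<mu>\<close> by (intro local_bound) auto
  have inn: "(\<integral>\<^sup>+x\<in>\<Omega> \<inter> ball x0 t. ennreal (norm (f x)) \<partial>lebesgue) \<le> ennreal (C * N * \<omega>\<^sub>2 t)"
    by (rule C[OF f N t])
  have "(\<integral>\<^sup>+x. ennreal (norm (f x)) \<partial>lebesgue) = (\<integral>\<^sup>+x\<in>(\<Omega> \<inter> ball x0 t) \<union> (\<Omega> - ball x0 t). ennreal (norm (f x)) \<partial>lebesgue)"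
    using off by (intro nn_integral_cong) (auto simp: indicator_def)
  also have "\<dots> = (\<integral>\<^sup>+x\<in>\<Omega> \<inter> ball x0 t. ennreal (norm (f x)) \<partial>lebesgue) + (\<integral>\<^sup>+x\<in>\<Omega> - ball x0 t. ennreal (norm (f x)) \<partial>lebesgue)"
    by (rule nn_integral_disjoint_pair) (measurable, auto)
  also have "\<dots> \<le> ennreal (C * N * \<omega>\<^sub>2 t) + ennreal (Cl * \<mu> * (diameter \<Omega> + 1) powr (real DIM(real ^ 'n) * (1 - 1 / p x0)))"
    by (rule add_mono[OF inn out])
  also have "\<dots> < \<infinity>" by simp
  finally have "integrable lebesgue f" by (intro integrableI_bounded) auto
  then show ?thesis by (simp add: L1_def)
qed

text \<open>
  The splitting at radius \<open>r/2\<close>.  Up to the factor \<open>H = N \<omega>\<^sub>2(r) r\<^bsup>-\<kappa>\<^esup>\<close>, outside the ball of radius \<open>r\<close> the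
  image of \<open>f\<close> is bounded by \<open>c1 X + c2 Y\<close>: here \<open>X\<close> is the image of the normalised outer part, and
  \<open>Y = r\<^bsup>\<kappa>\<^esup> |x - x0|\<^bsup>-n\<^esup>\<close> comes from the inner part.  Both \<open>X\<close> and \<open>Y\<close> have bounded modulars.
\<close>

lemma truncated_modular_estimate:
  assumes cz: "calderon_zygmund_operator K T" and "open \<Omega>"
  obtains G :: real where "0 < G"
    "\<And>f N r. f \<in> borel_measurable lebesgue \<Longrightarrow> (\<And>x. x \<notin> \<Omega> \<Longrightarrow> f x = 0) \<Longrightarrow>
       compl_morrey_norm \<Omega> p \<omega>\<^sub>1 x0 f < ennreal N \<Longrightarrow> 0 < r \<Longrightarrow> r < diameter \<Omega> \<Longrightarrow>
       (\<integral>\<^sup>+x\<in>\<Omega> - ball x0 r. ennreal ((norm (T f x) / (G * (N * \<omega>\<^sub>2 r * r powr (- \<kappa>)))) powr p x) \<partial>lebesgue) \<le> 1"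
proof -
  have lh: "log_holder_exponent \<Omega> p pm pp A" by unfold_locales
  have "\<Omega> \<noteq> {}" using x0 by blast
  obtain Ec :: real where Ec: "0 < Ec" and modular:
    "\<And>f. f \<in> borel_measurable lebesgue \<Longrightarrow> (\<And>x. x \<notin> \<Omega> \<Longrightarrow> f x = 0) \<Longrightarrow>
       (\<integral>\<^sup>+x. ennreal (norm (f x) powr p x) \<partial>lebesgue) \<le> 1 \<Longrightarrow>
       (\<integral>\<^sup>+x\<in>\<Omega>. ennreal (norm (T f x) powr p x) \<partial>lebesgue) \<le> ennreal Ec"
    by (rule cz_modular_bound[OF cz lh \<open>\<Omega> \<noteq> {}\<close>]) blast
  obtain Cf :: real where Cf: "0 < Cf" and far:
    "\<And>f x0 r. f \<in> L1 \<Longrightarrow> 0 < r \<Longrightarrow> (\<And>y. y \<notin> ball x0 (r / 2) \<Longrightarrow> f y = 0) \<Longrightarrow>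
       AE x in lebesgue. x \<notin> ball x0 r \<longrightarrow> norm (T f x) \<le> Cf * L1_norm f * norm (x - x0) powr (- real CARD('n))"
    by (rule cz_far_estimate[OF cz]) blast
  obtain Ct :: real where Ct: "0 < Ct" and tail:
    "\<And>r. 0 < r \<Longrightarrow> (\<integral>\<^sup>+x\<in>\<Omega> - ball x0 r. ennreal ((r powr (real DIM(real ^ 'n) * (1 - 1 / p x0))
        * norm (x - x0) powr (- real DIM(real ^ 'n))) powr p x) \<partial>lebesgue) \<le> ennreal Ct"
    by (rule tail_modular_bounded[OF x0]) blast
  obtain Cb where Cb: "0 < Cb" and near:
    "\<And>f N t. f \<in> borel_measurable lebesgue \<Longrightarrow> compl_morrey_norm \<Omega> p \<omega>\<^sub>1 x0 f < ennreal N \<Longrightarrow> 0 < t \<Longrightarrow> t < diameter \<Omega> \<Longrightarrow>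
       (\<integral>\<^sup>+x\<in>\<Omega> \<inter> ball x0 t. ennreal (norm (f x)) \<partial>lebesgue) \<le> ennreal (Cb * N * \<omega>\<^sub>2 t)"
    by (rule ball_integral_bound) blast
  obtain B where B: "\<And>f. f \<in> L1 \<Longrightarrow> T f \<in> borel_measurable lebesgue"
    by (rule cz_weak_type[OF cz]) blast
  define c1 where "c1 = 4 * 4 powr \<kappa> * Cw"
  define c2 where "c2 = Cf * Cb"
  have c: "0 < c1" "0 < c2" using Cw Cf Cb by (auto simp: c1_def c2_def)
  (* Dividing by Gm divides the modular by at least Gm, since the exponent exceeds 1. *)
  define Gm where "Gm = max 1 (Ec + Ct)"
  have Gm: "1 \<le> Gm" "Ec + Ct \<le> Gm" by (auto simp: Gm_def)
  define G where "G = (c1 + c2) * Gm"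
  show thesis
  proof (rule that[of G])
    show "0 < G" using c Gm by (simp add: G_def)
    fix f :: "real ^ 'n \<Rightarrow> complex" and N r
    assume f[measurable]: "f \<in> borel_measurable lebesgue" and off: "\<And>x. x \<notin> \<Omega> \<Longrightarrow> f x = 0"
      and N: "compl_morrey_norm \<Omega> p \<omega>\<^sub>1 x0 f < ennreal N" and r: "0 < r" "r < diameter \<Omega>"
    have "0 < N" using N by (metis ennreal_neg not_le not_less_zero)
    have [measurable]: "\<Omega> \<in> sets lebesgue" by (rule Omega_sets)
    have [measurable]: "ball x0 s \<in> sets lebesgue" for s by simp
    define H where "H = N * \<omega>\<^sub>2 r * r powr (- \<kappa>)"
    have "0 < H" using \<open>0 < N\<close> weight_pos[OF r] r by (simp add: H_def)
    define \<mu> where "\<mu> = 4 * 4 powr \<kappa> * N * dini_share r * r powr (- \<kappa>)"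
    have Wr: "0 < dini_share r" by (rule annular_modular(1)[OF r N])
    have "0 < \<mu>" using Wr \<open>0 < N\<close> r by (simp add: \<mu>_def)
    have "\<mu> \<le> 4 * 4 powr \<kappa> * N * (Cw * \<omega>\<^sub>2 r) * r powr (- \<kappa>)"
      unfolding \<mu>_def using dini_share(3)[OF r] \<open>0 < N\<close> by (intro mult_right_mono mult_left_mono) auto
    also have "\<dots> = c1 * H" by (simp add: c1_def H_def)
    finally have \<mu>_le: "\<mu> \<le> c1 * H" .
    define f1 where "f1 x = (if x \<in> ball x0 (r/2) then 0 else f x / of_real \<mu>)" for x
    define f2 where "f2 x = (if x \<in> ball x0 (r/2) then f x else 0)" for x
    have f1m[measurable]: "f1 \<in> borel_measurable lebesgue" unfolding f1_def by measurable
    have [measurable]: "f2 \<in> borel_measurable lebesgue" unfolding f2_def by measurable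
    have f1_off: "f1 x = 0" if "x \<notin> \<Omega>" for x using off[OF that] by (simp add: f1_def)
    have f1_mod: "(\<integral>\<^sup>+x. ennreal (norm (f1 x) powr p x) \<partial>lebesgue) \<le> 1"
    proof -
      have "(\<integral>\<^sup>+x. ennreal (norm (f1 x) powr p x) \<partial>lebesgue)
          = (\<integral>\<^sup>+x\<in>\<Omega> - ball x0 (r/2). ennreal ((norm (f x) / \<mu>) powr p x) \<partial>lebesgue)"
        using off \<open>0 < \<mu>\<close> by (intro nn_integral_cong) (auto simp: f1_def indicator_def norm_divide)
      also have "\<dots> \<le> 1" unfolding \<mu>_def by (rule annular_modular(2)[OF r N])
      finally show ?thesis .
    qed
    have fL1: "f \<in> L1" by (rule morrey_function_in_L1[OF \<open>open \<Omega>\<close> f off N])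
    have f1L1: "f1 \<in> L1" by (rule log_holder_L1(1)[OF lh f1m f1_off f1_mod])
    have f2i: "integrable lebesgue f2"
      by (rule Bochner_Integration.integrable_bound[of _ f]) (use fL1 in \<open>auto simp: L1_def f2_def\<close>)
    then have f2L1: "f2 \<in> L1" by (simp add: L1_def)
    have \<mu>f1L1: "(\<lambda>x. of_real \<mu> * f1 x) \<in> L1" using f1L1 by (simp add: L1_def)
    have [measurable]: "T f1 \<in> borel_measurable lebesgue" by (rule B[OF f1L1])
    have f2_norm: "L1_norm f2 \<le> Cb * N * \<omega>\<^sub>2 r"
    proof -
      have nonneg: "0 \<le> Cb * N * \<omega>\<^sub>2 r" using Cb \<open>0 < N\<close> weight_pos(2)[OF r] by simp
      have "ennreal (L1_norm f2) = (\<integral>\<^sup>+x. ennreal (norm (f2 x)) \<partial>lebesgue)"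
        unfolding L1_norm_def using f2i by (intro nn_integral_eq_integral[symmetric]) auto
      also have "\<dots> \<le> (\<integral>\<^sup>+x\<in>\<Omega> \<inter> ball x0 r. ennreal (norm (f x)) \<partial>lebesgue)"
      proof (intro nn_integral_mono)
        fix x
        have "ball x0 (r/2) \<subseteq> ball x0 r" using r by (intro subset_ball) simp
        then show "ennreal (norm (f2 x)) \<le> ennreal (norm (f x)) * indicator (\<Omega> \<inter> ball x0 r) x"
          using off[of x] unfolding f2_def by (cases "x \<in> \<Omega>"; cases "x \<in> ball x0 (r/2)") auto
      qed
      also have "\<dots> \<le> ennreal (Cb * N * \<omega>\<^sub>2 r)" by (rule near[OF f N r])
      finally show ?thesis by (simp only: ennreal_le_iff[OF nonneg])
    qed
    define X where "X x = (if x \<in> \<Omega> - ball x0 r then norm (T f1 x) else 0)" for x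
    define Y where "Y x = (if x \<in> \<Omega> - ball x0 r then r powr \<kappa> * norm (x - x0) powr (- real CARD('n)) else 0)" for x
    have XY0: "0 \<le> X x" "0 \<le> Y x" for x by (auto simp: X_def Y_def)
    have Xm: "X \<in> borel_measurable lebesgue" unfolding X_def by measurable
    have "(\<lambda>x. r powr \<kappa> * norm (x - x0) powr (- real CARD('n))) \<in> borel_measurable lebesgue"
      by (intro measurable_completion) measurable
    then have Ym: "Y \<in> borel_measurable lebesgue" unfolding Y_def by measurable
    have XY_off: "X x = 0" "Y x = 0" if "x \<notin> \<Omega>" for x using that by (simp_all add: X_def Y_def)
    have [measurable]: "(\<lambda>x. X x powr p x) \<in> borel_measurable lebesgue"
      using measurable_powr_exponent[OF Xm XY_off(1), of "\<lambda>t. t"] by simp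
    have [measurable]: "(\<lambda>x. Y x powr p x) \<in> borel_measurable lebesgue"
      using measurable_powr_exponent[OF Ym XY_off(2), of "\<lambda>t. t"] by simp
    have pointwise: "AE x in lebesgue. x \<in> \<Omega> - ball x0 r \<longrightarrow> norm (T f x) \<le> (c1 * X x + c2 * Y x) * H"
    proof -
      have f_eq: "f = (\<lambda>x. of_real \<mu> * f1 x + f2 x)"
        using \<open>0 < \<mu>\<close> by (auto simp: f1_def f2_def fun_eq_iff)
      have "AE x in lebesgue. T f x = T (\<lambda>x. of_real \<mu> * f1 x) x + T f2 x"
        by (subst f_eq) (rule cz_add[OF cz \<mu>f1L1 f2L1])
      moreover have "AE x in lebesgue. T (\<lambda>x. of_real \<mu> * f1 x) x = of_real \<mu> * T f1 x"
        by (rule cz_scale[OF cz f1L1])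
      moreover have "AE x in lebesgue. x \<notin> ball x0 r \<longrightarrow> norm (T f2 x) \<le> Cf * L1_norm f2 * norm (x - x0) powr (- real CARD('n))"
        by (rule far[OF f2L1 r(1)]) (simp add: f2_def)
      ultimately show ?thesis
      proof eventually_elim
        case (elim x)
        show ?case
        proof
          assume x: "x \<in> \<Omega> - ball x0 r"
          have "norm (T f x) \<le> norm (of_real \<mu> * T f1 x) + norm (T f2 x)"
            unfolding elim(1) elim(2) by (rule norm_triangle_ineq)
          also have "norm (of_real \<mu> * T f1 x) \<le> c1 * H * X x"
            using x \<mu>_le \<open>0 < \<mu>\<close> by (simp add: X_def norm_mult mult_right_mono)
          also have "norm (T f2 x) \<le> Cf * L1_norm f2 * norm (x - x0) powr (- real CARD('n))" using elim x by simp
          also have "\<dots> \<le> Cf * (Cb * N * \<omega>\<^sub>2 r) * norm (x - x0) powr (- real CARD('n))"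
            using f2_norm Cf by (intro mult_right_mono mult_left_mono) auto
          also have "\<dots> = c2 * H * Y x" using x r by (simp add: c2_def H_def Y_def powr_minus)
          finally show "norm (T f x) \<le> (c1 * X x + c2 * Y x) * H" by (simp add: algebra_simps)
        qed
      qed
    qed
    have "(\<integral>\<^sup>+x\<in>\<Omega> - ball x0 r. ennreal ((norm (T f x) / (G * H)) powr p x) \<partial>lebesgue)
        \<le> (\<integral>\<^sup>+x. ennreal (1 / Gm) * (ennreal (X x powr p x) + ennreal (Y x powr p x)) \<partial>lebesgue)"
    proof (rule nn_integral_mono_AE)
      show "AE x in lebesgue. ennreal ((norm (T f x) / (G * H)) powr p x) * indicator (\<Omega> - ball x0 r) x
          \<le> ennreal (1 / Gm) * (ennreal (X x powr p x) + ennreal (Y x powr p x))"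
        using pointwise
      proof eventually_elim
        case (elim x)
        show ?case
        proof (cases "x \<in> \<Omega> - ball x0 r")
          case True
          have px: "1 < p x" using True exponent_gt_1' by auto
          define Z where "Z = max (X x) (Y x)"
          have "0 \<le> Z" using XY0[of x] by (simp add: Z_def)
          have "c1 * X x + c2 * Y x \<le> c1 * Z + c2 * Z" using c by (intro add_mono mult_left_mono) (auto simp: Z_def)
          then have "(c1 * X x + c2 * Y x) * H \<le> (c1 + c2) * Z * H"
            using \<open>0 < H\<close> by (intro mult_right_mono) (auto simp: distrib_right)
          then have "norm (T f x) \<le> (c1 + c2) * Z * H" using elim True by auto
          then have "norm (T f x) / (G * H) \<le> (c1 + c2) * Z * H / (G * H)"
            using \<open>0 < H\<close> \<open>0 < G\<close> by (intro divide_right_mono) auto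
          also have "\<dots> = Z / Gm" using c \<open>0 < H\<close> Gm by (simp add: G_def)
          finally have "(norm (T f x) / (G * H)) powr p x \<le> (Z / Gm) powr p x"
            using px \<open>0 < H\<close> \<open>0 < G\<close> by (intro powr_mono2) auto
          also have "\<dots> = Z powr p x / Gm powr p x" by (rule powr_divide)
          also have "\<dots> \<le> Z powr p x / Gm"
          proof (rule divide_left_mono)
            show "Gm \<le> Gm powr p x" using Gm px powr_mono[of 1 "p x" Gm] by simp
          qed (use Gm in auto)
          also have "Z powr p x \<le> X x powr p x + Y x powr p x" by (simp add: Z_def max_def)
          finally have "(norm (T f x) / (G * H)) powr p x \<le> 1 / Gm * (X x powr p x + Y x powr p x)"
            using Gm by (simp add: divide_right_mono)
          then have "ennreal ((norm (T f x) / (G * H)) powr p x) \<le> ennreal (1 / Gm * (X x powr p x + Y x powr p x))"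
            by (rule ennreal_leI)
          also have "\<dots> = ennreal (1 / Gm) * (ennreal (X x powr p x) + ennreal (Y x powr p x))"
            using Gm by (subst ennreal_mult) auto
          finally show ?thesis using True by simp
        qed simp
      qed
    qed
    also have "\<dots> = ennreal (1 / Gm) * (\<integral>\<^sup>+x. ennreal (X x powr p x) + ennreal (Y x powr p x) \<partial>lebesgue)"
      by (rule nn_integral_cmult) measurable
    also have "(\<integral>\<^sup>+x. ennreal (X x powr p x) + ennreal (Y x powr p x) \<partial>lebesgue)
        = (\<integral>\<^sup>+x. ennreal (X x powr p x) \<partial>lebesgue) + (\<integral>\<^sup>+x. ennreal (Y x powr p x) \<partial>lebesgue)"
      by (rule nn_integral_add) measurable
    also have "ennreal (1 / Gm) * \<dots> \<le> ennreal (1 / Gm) * (ennreal Ec + ennreal Ct)"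
    proof (intro mult_left_mono add_mono)
      have "(\<integral>\<^sup>+x. ennreal (X x powr p x) \<partial>lebesgue) \<le> (\<integral>\<^sup>+x\<in>\<Omega>. ennreal (norm (T f1 x) powr p x) \<partial>lebesgue)"
        by (intro nn_integral_mono) (auto simp: X_def indicator_def)
      also have "\<dots> \<le> ennreal Ec" by (rule modular[OF f1m f1_off f1_mod])
      finally show "(\<integral>\<^sup>+x. ennreal (X x powr p x) \<partial>lebesgue) \<le> ennreal Ec" .
      have "(\<integral>\<^sup>+x. ennreal (Y x powr p x) \<partial>lebesgue)
          = (\<integral>\<^sup>+x\<in>\<Omega> - ball x0 r. ennreal ((r powr (real DIM(real ^ 'n) * (1 - 1 / p x0))
              * norm (x - x0) powr (- real DIM(real ^ 'n))) powr p x) \<partial>lebesgue)"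
        by (intro nn_integral_cong) (simp add: Y_def \<kappa>_def indicator_def)
      also have "\<dots> \<le> ennreal Ct" by (rule tail[OF r(1)])
      finally show "(\<integral>\<^sup>+x. ennreal (Y x powr p x) \<partial>lebesgue) \<le> ennreal Ct" .
    qed auto
    also have "\<dots> = ennreal ((Ec + Ct) / Gm)"
      using Ec Ct Gm by (simp flip: ennreal_plus ennreal_mult)
    also have "\<dots> \<le> ennreal 1" using Gm by (intro ennreal_leI) simp
    finally show "(\<integral>\<^sup>+x\<in>\<Omega> - ball x0 r. ennreal ((norm (T f x) / (G * (N * \<omega>\<^sub>2 r * r powr (- \<kappa>)))) powr p x) \<partial>lebesgue) \<le> 1"
      by (simp add: H_def)
  qed
qed

text \<open>
  The truncated estimate holds for every \<open>N\<close> above the source norm of \<open>f\<close>, and the norm inequality follows as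
  \<open>N\<close> decreases to it.
\<close>

lemma bounded_compl_morrey:
  assumes cz: "calderon_zygmund_operator K T" and "open \<Omega>"
  shows "bounded_between_compl_morrey \<Omega> p x0 \<omega>\<^sub>1 \<omega>\<^sub>2 T"
proof -
  obtain G :: real where G: "0 < G" and modular:
    "\<And>f N r. f \<in> borel_measurable lebesgue \<Longrightarrow> (\<And>x. x \<notin> \<Omega> \<Longrightarrow> f x = 0) \<Longrightarrow>
       compl_morrey_norm \<Omega> p \<omega>\<^sub>1 x0 f < ennreal N \<Longrightarrow> 0 < r \<Longrightarrow> r < diameter \<Omega> \<Longrightarrow>
       (\<integral>\<^sup>+x\<in>\<Omega> - ball x0 r. ennreal ((norm (T f x) / (G * (N * \<omega>\<^sub>2 r * r powr (- \<kappa>)))) powr p x) \<partial>lebesgue) \<le> 1"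
    by (rule truncated_modular_estimate[OF cz \<open>open \<Omega>\<close>]) blast
  obtain B where B: "\<And>f. f \<in> L1 \<Longrightarrow> T f \<in> borel_measurable lebesgue"
    by (rule cz_weak_type[OF cz]) blast
  show ?thesis
    unfolding bounded_between_compl_morrey_def
  proof (intro exI[of _ G] ballI)
    fix f assume "f \<in> compl_morrey_space \<Omega> p \<omega>\<^sub>1 x0"
    then have fm: "f \<in> borel_measurable (lebesgue_on \<Omega>)" and fin: "compl_morrey_norm \<Omega> p \<omega>\<^sub>1 x0 f < \<infinity>"
      by (auto simp: compl_morrey_space_def)
    define e where "e = zero_extension \<Omega> f"
    have em: "e \<in> borel_measurable lebesgue"
      unfolding e_def zero_extension_def using fm Omega_sets by (simp add: borel_measurable_if)
    have e_off: "e x = 0" if "x \<notin> \<Omega>" for x using that by (simp add: e_def zero_extension_def)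
    have "luxemburg_norm p (\<Omega> - S) e = luxemburg_norm p (\<Omega> - S) f" for S
    proof -
      have "(\<integral>\<^sup>+x\<in>\<Omega> - S. ennreal (norm (e x / of_real \<eta>) powr p x) \<partial>lebesgue)
          = (\<integral>\<^sup>+x\<in>\<Omega> - S. ennreal (norm (f x / of_real \<eta>) powr p x) \<partial>lebesgue)" for \<eta> :: real
        by (intro nn_integral_cong) (simp add: e_def zero_extension_def indicator_def)
      then show ?thesis unfolding luxemburg_norm_def by simp
    qed
    then have e_norm: "compl_morrey_norm \<Omega> p \<omega>\<^sub>1 x0 e = compl_morrey_norm \<Omega> p \<omega>\<^sub>1 x0 f"
      unfolding compl_morrey_norm_def by simp
    obtain m where m: "0 \<le> m" "compl_morrey_norm \<Omega> p \<omega>\<^sub>1 x0 f = ennreal m"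
      using fin by (cases "compl_morrey_norm \<Omega> p \<omega>\<^sub>1 x0 f") auto
    have bound: "compl_morrey_norm \<Omega> p \<omega>\<^sub>2 x0 (T e) \<le> ennreal (G * N)" if N: "m < N" for N
      unfolding compl_morrey_norm_def
    proof (rule SUP_least)
      fix r assume "r \<in> {0<..<diameter \<Omega>}"
      then have r: "0 < r" "r < diameter \<Omega>" by auto
      define \<eta> where "\<eta> = G * (N * \<omega>\<^sub>2 r * r powr (- \<kappa>))"
      have "0 < N" using m N by linarith
      have "0 < \<eta>" using G \<open>0 < N\<close> weight_pos(2)[OF r] r by (simp add: \<eta>_def)
      have eN: "compl_morrey_norm \<Omega> p \<omega>\<^sub>1 x0 e < ennreal N" unfolding e_norm m using m N by (simp add: ennreal_less_iff)
      have "luxemburg_norm p (\<Omega> - ball x0 r) (T e) \<le> ennreal \<eta>"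
        by (rule luxemburg_le_of_modular[OF \<open>0 < \<eta>\<close>]) (unfold \<eta>_def, rule modular[OF em e_off eN r])
      moreover have "\<Omega> - (ball x0 r \<inter> \<Omega>) = \<Omega> - ball x0 r" by blast
      moreover have "morrey_factor p \<omega>\<^sub>2 x0 r = ennreal (r powr \<kappa> / \<omega>\<^sub>2 r)"
        unfolding morrey_factor_def \<kappa>_eq using weight_pos(2)[OF r] by (intro divide_ennreal) auto
      ultimately have "morrey_factor p \<omega>\<^sub>2 x0 r * luxemburg_norm p (\<Omega> - (ball x0 r \<inter> \<Omega>)) (T e)
          \<le> ennreal (r powr \<kappa> / \<omega>\<^sub>2 r) * ennreal \<eta>"
        by (simp add: mult_left_mono)
      also have "\<dots> = ennreal (r powr \<kappa> / \<omega>\<^sub>2 r * \<eta>)"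
        using weight_pos(2)[OF r] \<open>0 < \<eta>\<close> by (intro ennreal_mult[symmetric]) auto
      also have "r powr \<kappa> / \<omega>\<^sub>2 r * \<eta> = G * N" using weight_pos(2)[OF r] r by (simp add: \<eta>_def powr_minus)
      finally show "morrey_factor p \<omega>\<^sub>2 x0 r * luxemburg_norm p (\<Omega> - (ball x0 r \<inter> \<Omega>)) (T e) \<le> ennreal (G * N)" .
    qed
    have le: "compl_morrey_norm \<Omega> p \<omega>\<^sub>2 x0 (T e) \<le> ennreal G * ennreal m"
    proof (rule ennreal_le_epsilon)
      fix d :: real assume "0 < d"
      then have "compl_morrey_norm \<Omega> p \<omega>\<^sub>2 x0 (T e) \<le> ennreal (G * (m + d / G))" using G by (intro bound) simp
      also have "G * (m + d / G) = G * m + d" using G by (simp add: field_simps)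
      also have "ennreal (G * m + d) = ennreal G * ennreal m + ennreal d" using G m(1) \<open>0 < d\<close> by (simp add: ennreal_mult)
      finally show "compl_morrey_norm \<Omega> p \<omega>\<^sub>2 x0 (T e) \<le> ennreal G * ennreal m + ennreal d" .
    qed
    have eN: "compl_morrey_norm \<Omega> p \<omega>\<^sub>1 x0 e < ennreal (m + 1)" unfolding e_norm m using m(1) by (simp add: ennreal_less_iff)
    have eL1: "e \<in> L1" by (rule morrey_function_in_L1[OF \<open>open \<Omega>\<close> em e_off eN])
    have "T e \<in> borel_measurable (lebesgue_on \<Omega>)" by (rule measurable_restrict_space1[OF B[OF eL1]])
    moreover have "compl_morrey_norm \<Omega> p \<omega>\<^sub>2 x0 (T e) < \<infinity>"
      using le by (rule order_le_less_trans) (simp add: ennreal_mult_less_top)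
    ultimately show "zero_extension \<Omega> f \<in> L1 \<and>
        T (zero_extension \<Omega> f) \<in> compl_morrey_space \<Omega> p \<omega>\<^sub>2 x0 \<and>
        compl_morrey_norm \<Omega> p \<omega>\<^sub>2 x0 (T (zero_extension \<Omega> f)) \<le> ennreal G * compl_morrey_norm \<Omega> p \<omega>\<^sub>1 x0 f"
      using eL1 le m by (simp add: e_def[symmetric] compl_morrey_space_def)
  qed
qed

end

theorem theorem7p2:
  fixes \<Omega> :: "(real ^ 'n) set" and x\<^sub>0 :: "real ^ 'n"
    and p :: "real ^ 'n \<Rightarrow> real" and \<omega>\<^sub>1 \<omega>\<^sub>2 :: "real \<Rightarrow> real"
    and K :: "real ^ 'n \<Rightarrow> real ^ 'n \<Rightarrow> complex"
    and T :: "(real ^ 'n \<Rightarrow> complex) \<Rightarrow> real ^ 'n \<Rightarrow> complex"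
  assumes "open \<Omega>" and "bounded \<Omega>" and "x\<^sub>0 \<in> \<Omega>"
    and "p \<in> borel_measurable (lebesgue_on \<Omega>)"
    and "p \<in> WL \<Omega>"
    and "1 < exponent_minus \<Omega> p"
    and "\<forall>x\<in>\<Omega>. exponent_minus \<Omega> p \<le> ereal (p x) \<and> ereal (p x) \<le> exponent_plus \<Omega> p"
    and "exponent_plus \<Omega> p < \<infinity>"
    and "admissible_weight \<Omega> p x\<^sub>0 \<omega>\<^sub>1" and "admissible_weight \<Omega> p x\<^sub>0 \<omega>\<^sub>2"
    and "\<exists>C::real. \<forall>t\<in>{0<..<diameter \<Omega>}.
           (\<integral>\<^sup>+ r\<in>{0<..<t}. ennreal (\<omega>\<^sub>1 r / r) \<partial>lebesgue) \<le> ennreal (C * \<omega>\<^sub>2 t)"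
    and "calderon_zygmund_operator K T"
  shows "bounded_between_compl_morrey \<Omega> p x\<^sub>0 \<omega>\<^sub>1 \<omega>\<^sub>2 T"
proof -
  have bx: "exponent_minus \<Omega> p \<le> ereal (p x)" "ereal (p x) \<le> exponent_plus \<Omega> p" if "x \<in> \<Omega>" for x
    using assms(7) that by auto
  obtain pm where pm: "exponent_minus \<Omega> p = ereal pm"
    using bx(1)[OF assms(3)] assms(6) by (cases "exponent_minus \<Omega> p") auto
  obtain pp where pp: "exponent_plus \<Omega> p = ereal pp"
    using bx(2)[OF assms(3)] assms(8) by (cases "exponent_plus \<Omega> p") auto
  obtain A where A: "0 < A" "\<And>x y. x \<in> \<Omega> \<Longrightarrow> y \<in> \<Omega> \<Longrightarrow> norm (x - y) \<le> 1/2 \<Longrightarrow> \<bar>p x - p y\<bar> \<le> A / (- ln (norm (x - y)))"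
    using assms(5) by (auto simp: WL_def)
  obtain C :: real where C: "\<forall>t\<in>{0<..<diameter \<Omega>}.
      (\<integral>\<^sup>+ r\<in>{0<..<t}. ennreal (\<omega>\<^sub>1 r / r) \<partial>lebesgue) \<le> ennreal (C * \<omega>\<^sub>2 t)"
    using assms(11) by (rule exE)
  interpret complementary_morrey \<Omega> p pm pp A x\<^sub>0 \<omega>\<^sub>1 \<omega>\<^sub>2 "max C 1"
  proof
    show "\<Omega> \<in> sets lebesgue" using assms(1) by simp
    show "1 < pm" using assms(6) pm by (simp add: one_ereal_def)
    show "pm \<le> p x" "p x \<le> pp" if "x \<in> \<Omega>" for x using bx[OF that] pm pp by auto
    fix t assume t: "0 < t" "t < diameter \<Omega>"
    have "0 \<le> \<omega>\<^sub>2 t" using assms(10) t by (auto simp: admissible_weight_def)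
    then have le: "C * \<omega>\<^sub>2 t \<le> max C 1 * \<omega>\<^sub>2 t" by (intro mult_right_mono) auto
    have "(\<integral>\<^sup>+ r\<in>{0<..<t}. ennreal (\<omega>\<^sub>1 r / r) \<partial>lebesgue) \<le> ennreal (C * \<omega>\<^sub>2 t)"
      using C t by simp
    then show "(\<integral>\<^sup>+ r\<in>{0<..<t}. ennreal (\<omega>\<^sub>1 r / r) \<partial>lebesgue) \<le> ennreal (max C 1 * \<omega>\<^sub>2 t)"
      using ennreal_leI[OF le] by (rule order_trans)
  qed (use assms A in auto)
  show ?thesis by (rule bounded_compl_morrey[OF assms(12) assms(1)])
qed

end
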